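(* Let $k\ge1$, let $M$ be a $(4k-1)$-dimensional (smooth, Riemannian) manifold, let $\nabla^{TM}$ be a connection on $TM$, and let $\xi$ be a two-dimensional oriented Euclidean real vector bundle over $M$ with two Euclidean connections $\nabla_1^{\xi},\nabla_0^{\xi}$. With the transgressed forms $CS\Phi_L, CS\Phi_W, CS\Phi_W'$ defined in the context: 1) $\{CS\Phi_L(\nabla^{TM},\nabla_0^{\xi},\nabla_1^{\xi},\tau)\}^{(4k-1)}$ is a modular form of weight $2k$ over $\Gamma_0(2)$; $\{CS\Phi_W(\nabla^{TM},\nabla_0^{\xi},\nabla_1^{\xi},\tau)\}^{(4k-1)}$ is a modular form of weight $2k$ over $\Gamma^0(2)$; $\{CS\Phi_W'(\nabla^{TM},\nabla_0^{\xi},\nabla_1^{\xi},\tau)\}^{(4k-1)}$ is a modular form of weight $2k$ over $\Gamma_\theta$. 2) The following equalities hold: $$\Big\{CS\Phi_L\big(\nabla^{TM},\nabla_0^{\xi},\nabla_1^{\xi},-\tfrac1\tau\big)\Big\}^{(4k-1)}=(2\tau)^{2k}\{CS\Phi_W(\nabla^{TM},\nabla_0^{\xi},\nabla_1^{\xi},\tau)\}^{(4k-1)},$$ $$CS\Phi_W(\nabla^{TM},\nabla_0^{\xi},\nabla_1^{\xi},\tau+1)=CS\Phi_W'(\nabla^{TM},\nabla_0^{\xi},\nabla_1^{\xi},\tau).$$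
   Context: Theta functions. For $\tau\in\mathbf H$ (upper half plane), $q=e^{2\pi\sqrt{-1}\tau}$, $q^{a}=e^{2\pi\sqrt{-1}a\tau}$, $v\in\mathbf C$: $\theta(v,\tau)=2q^{1/8}\sin(\pi v)\prod_{j\ge1}(1-q^j)(1-e^{2\pi\sqrt{-1}v}q^j)(1-e^{-2\pi\sqrt{-1}v}q^j)$, $\theta_1(v,\tau)=2q^{1/8}\cos(\pi v)\prod_{j\ge1}(1-q^j)(1+e^{2\pi\sqrt{-1}v}q^j)(1+e^{-2\pi\sqrt{-1}v}q^j)$, $\theta_2(v,\tau)=\prod_{j\ge1}(1-q^j)(1-e^{2\pi\sqrt{-1}v}q^{j-1/2})(1-e^{-2\pi\sqrt{-1}v}q^{j-1/2})$, $\theta_3(v,\tau)=\prod_{j\ge1}(1-q^j)(1+e^{2\pi\sqrt{-1}v}q^{j-1/2})(1+e^{-2\pi\sqrt{-1}v}q^{j-1/2})$. A prime denotes $\partial/\partial v$. Modular forms. $\Gamma_0(2)$, resp. $\Gamma^0(2)$, is the subgroup of matrices $\begin{pmatrix}a&b\\c&d\end{pmatrix}\in SL_2(\mathbf Z)$ with $c$ even, resp. $b$ even; $\Gamma_\theta$ is the subgroup of those congruent mod 2 to $\begin{pmatrix}1&0\\0&1\end{pmatrix}$ or $\begin{pmatrix}0&1\\1&0\end{pmatrix}$. A modular form of weight $w$ over $\Gamma\subset SL_2(\mathbf Z)$ is a holomorphic function $f$ on $\mathbf H$ with $f\big(\frac{a\tau+b}{c\tau+d}\big)=\chi(g)(c\tau+d)^{w}f(\tau)$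 for all $g=\begin{pmatrix}a&b\\c&d\end{pmatrix}\in\Gamma$, where $\chi:\Gamma\to\mathbf C^*$ is a character. For functions of $\tau$ with values in differential forms the condition is understood coefficientwise (pointwise on $M$). $\{\cdot\}^{(p)}$ denotes the degree $p$ component of a form. Conventions. A power series (in $z$) is evaluated on a curvature by substitution (curvatures are nilpotent), and for a power series $f$ with nonzero constant term $\det^{1/2}(f(R))$ is the usual Chern–Weil square root $\exp(\frac12\mathrm{tr}\log f(R))$. Removable singularities at $z=0$ are understood as removed. Characteristic forms. For a connection $\nabla^{TM}$ on $TM$ with curvature $R^{TM}$ and a Euclidean connection $\nabla^\xi$ on $\xi$ with curvature $R^\xi$ put $\Phi_L(\nabla^{TM},\nabla^\xi,\tau)=\sqrt2^{\,4k-1}\det^{1/2}\Big(f_L(\tfrac{R^{TM}}{4\pi^2},\tau)\Big)\det^{1/2}\Big(h_L(\tfrac{R^\xi}{4\pi^2},\tau)\Big)$, $\Phi_W(\nabla^{TM},\nabla^\xi,\tau)=\det^{1/2}\Big(f_W(\tfrac{R^{TM}}{4\pi^2},\tau)\Big)\det^{1/2}\Big(h_W(\tfrac{R^\xi}{4\pi^2},\tau)\Big)$, $\Phi_W'(\nabla^{TM},\nabla^\xi,\tau)=\det^{1/2}\Big(f_{W'}(\tfrac{R^{TM}}{4\pi^2},\tau)\Big)\det^{1/2}\Big(h_{W'}(\tfrac{R^\xi}{4\pi^2},\tau)\Big)$, where $f_L(z,\tau)=z\frac{\theta'(0,\tau)}{\theta(z,\tau)}\frac{\theta_1(z,\tau)}{\theta_1(0,\tau)}$,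 $f_W(z,\tau)=z\frac{\theta'(0,\tau)}{\theta(z,\tau)}\frac{\theta_2(z,\tau)}{\theta_2(0,\tau)}$, $f_{W'}(z,\tau)=z\frac{\theta'(0,\tau)}{\theta(z,\tau)}\frac{\theta_3(z,\tau)}{\theta_3(0,\tau)}$, $h_L(z,\tau)=\frac{\theta_1^2(0,\tau)}{\theta_1^2(z,\tau)}\frac{\theta_3(z,\tau)}{\theta_3(0,\tau)}\frac{\theta_2(z,\tau)}{\theta_2(0,\tau)}$, $h_W(z,\tau)=\frac{\theta_2^2(0,\tau)}{\theta_2^2(z,\tau)}\frac{\theta_3(z,\tau)}{\theta_3(0,\tau)}\frac{\theta_1(z,\tau)}{\theta_1(0,\tau)}$, $h_{W'}(z,\tau)=\frac{\theta_3^2(0,\tau)}{\theta_3^2(z,\tau)}\frac{\theta_1(z,\tau)}{\theta_1(0,\tau)}\frac{\theta_2(z,\tau)}{\theta_2(0,\tau)}$. (For Euclidean $\nabla^{TM}$ these are the forms $\frac{\widehat L(TM)}{\cosh^2(c/2)}\mathrm{ch}(\Theta_1)$, $\widehat A(TM)\cosh(\frac c2)\mathrm{ch}(\Theta_2)$, $\widehat A(TM)\cosh(\frac c2)\mathrm{ch}(\Theta_3)$, where $c$ is the Euler form of $(\xi,\nabla^\xi)$, $\widehat A(TM)=\det^{1/2}\Big(\frac{\frac{\sqrt{-1}}{4\pi}R^{TM}}{\sinh(\frac{\sqrt{-1}}{4\pi}R^{TM})}\Big)$, $\widehat L(TM)=\det^{1/2}\Big(\frac{\frac{\sqrt{-1}}{2\pi}R^{TM}}{\tanh(\frac{\sqrt{-1}}{4\pi}R^{TM})}\Big)$,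 and, with $\widetilde E=E-\dim E$ and $S_t,\wedge_t$ the total symmetric and exterior powers, $\Theta_1=\bigotimes_{n\ge1}S_{q^n}(\widetilde{T_CM})\otimes\bigotimes_{m\ge1}\wedge_{q^m}(\widetilde{T_CM}-2\widetilde{\xi_C})\otimes\bigotimes_{r\ge1}\wedge_{q^{r-1/2}}(\widetilde{\xi_C})\otimes\bigotimes_{s\ge1}\wedge_{-q^{s-1/2}}(\widetilde{\xi_C})$, $\Theta_2=\bigotimes_{n\ge1}S_{q^n}(\widetilde{T_CM})\otimes\bigotimes_{m\ge1}\wedge_{-q^{m-1/2}}(\widetilde{T_CM}-2\widetilde{\xi_C})\otimes\bigotimes_{r\ge1}\wedge_{q^{r-1/2}}(\widetilde{\xi_C})\otimes\bigotimes_{s\ge1}\wedge_{q^{s}}(\widetilde{\xi_C})$, $\Theta_3=\bigotimes_{n\ge1}S_{q^n}(\widetilde{T_CM})\otimes\bigotimes_{m\ge1}\wedge_{q^{m-1/2}}(\widetilde{T_CM}-2\widetilde{\xi_C})\otimes\bigotimes_{r\ge1}\wedge_{q^{r}}(\widetilde{\xi_C})\otimes\bigotimes_{s\ge1}\wedge_{-q^{s-1/2}}(\widetilde{\xi_C})$.) Transgressed forms. Let $B=\nabla_1^{\xi}-\nabla_0^{\xi}\in\Omega^1(M,\mathrm{End}\,\xi)$, $\nabla_t^{\xi}=(1-t)\nabla_0^{\xi}+t\nabla_1^{\xi}$ with curvature $R_t^{\xi}$, and $Y_t=R_t^{\xi}/(4\pi^2)$. Define $CS\Phi_L(\nabla^{TM},\nabla_0^\xi,\nabla_1^\xi,\tau)=\frac{\sqrt2}{8\pi^2}\int_0^1\Phi_L(\nabla^{TM},\nabla_t^\xi,\tau)\,\mathrm{tr}\Big[B\Big(\frac{\theta_2'(Y_t,\tau)}{\theta_2(Y_t,\tau)}+\frac{\theta_3'(Y_t,\tau)}{\theta_3(Y_t,\tau)}-2\frac{\theta_1'(Y_t,\tau)}{\theta_1(Y_t,\tau)}\Big)\Big]dt$,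 $CS\Phi_W(\nabla^{TM},\nabla_0^\xi,\nabla_1^\xi,\tau)=\frac{1}{8\pi^2}\int_0^1\Phi_W(\nabla^{TM},\nabla_t^\xi,\tau)\,\mathrm{tr}\Big[B\Big(\frac{\theta_3'(Y_t,\tau)}{\theta_3(Y_t,\tau)}+\frac{\theta_1'(Y_t,\tau)}{\theta_1(Y_t,\tau)}-2\frac{\theta_2'(Y_t,\tau)}{\theta_2(Y_t,\tau)}\Big)\Big]dt$, $CS\Phi_W'(\nabla^{TM},\nabla_0^\xi,\nabla_1^\xi,\tau)=\frac{1}{8\pi^2}\int_0^1\Phi_W'(\nabla^{TM},\nabla_t^\xi,\tau)\,\mathrm{tr}\Big[B\Big(\frac{\theta_2'(Y_t,\tau)}{\theta_2(Y_t,\tau)}+\frac{\theta_1'(Y_t,\tau)}{\theta_1(Y_t,\tau)}-2\frac{\theta_3'(Y_t,\tau)}{\theta_3(Y_t,\tau)}\Big)\Big]dt$. *)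

theory Defs
  imports
    "HOL-Complex_Analysis.Complex_Analysis"
    "HOL-Library.Function_Algebras"
begin

unbundle no Formal_Power_Series.fps_syntax

section \<open>Theta functions\<close>

text \<open>\<open>qpow \<tau> a\<close> is $q^a$ for the branch fixed by $q^a = e^{2\pi i a\tau}$. The products over
  $j \ge 1$ are indexed by \<open>Suc j\<close>.\<close>

definition qpow :: "complex \<Rightarrow> real \<Rightarrow> complex" where
  "qpow \<tau> a = exp (2 * of_real pi * \<i> * of_real a * \<tau>)"

definition theta :: "complex \<Rightarrow> complex \<Rightarrow> complex" where
  "theta v \<tau> = 2 * qpow \<tau> (1/8) * sin (of_real pi * v) *
     (\<Prod>j. (1 - qpow \<tau> (Suc j)) * (1 - exp (2 * of_real pi * \<i> * v) * qpow \<tau> (Suc j))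
                                * (1 - exp (- (2 * of_real pi * \<i> * v)) * qpow \<tau> (Suc j)))"

definition theta1 :: "complex \<Rightarrow> complex \<Rightarrow> complex" where
  "theta1 v \<tau> = 2 * qpow \<tau> (1/8) * cos (of_real pi * v) *
     (\<Prod>j. (1 - qpow \<tau> (Suc j)) * (1 + exp (2 * of_real pi * \<i> * v) * qpow \<tau> (Suc j))
                                * (1 + exp (- (2 * of_real pi * \<i> * v)) * qpow \<tau> (Suc j)))"

definition theta2 :: "complex \<Rightarrow> complex \<Rightarrow> complex" where
  "theta2 v \<tau> =
     (\<Prod>j. (1 - qpow \<tau> (Suc j)) * (1 - exp (2 * of_real pi * \<i> * v) * qpow \<tau> (Suc j - 1/2))
                                * (1 - exp (- (2 * of_real pi * \<i> * v)) * qpow \<tau> (Suc j - 1/2)))"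

definition theta3 :: "complex \<Rightarrow> complex \<Rightarrow> complex" where
  "theta3 v \<tau> =
     (\<Prod>j. (1 - qpow \<tau> (Suc j)) * (1 + exp (2 * of_real pi * \<i> * v) * qpow \<tau> (Suc j - 1/2))
                                * (1 + exp (- (2 * of_real pi * \<i> * v)) * qpow \<tau> (Suc j - 1/2)))"

definition dv :: "(complex \<Rightarrow> complex \<Rightarrow> complex) \<Rightarrow> complex \<Rightarrow> complex \<Rightarrow> complex" where
  "dv th v \<tau> = deriv (\<lambda>u. th u \<tau>) v"

definition f_L :: "complex \<Rightarrow> complex \<Rightarrow> complex" where
  "f_L z \<tau> = z * (dv theta 0 \<tau> / theta z \<tau>) * (theta1 z \<tau> / theta1 0 \<tau>)"

definition f_W :: "complex \<Rightarrow> complex \<Rightarrow> complex" where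
  "f_W z \<tau> = z * (dv theta 0 \<tau> / theta z \<tau>) * (theta2 z \<tau> / theta2 0 \<tau>)"

definition f_W' :: "complex \<Rightarrow> complex \<Rightarrow> complex" where
  "f_W' z \<tau> = z * (dv theta 0 \<tau> / theta z \<tau>) * (theta3 z \<tau> / theta3 0 \<tau>)"

definition h_L :: "complex \<Rightarrow> complex \<Rightarrow> complex" where
  "h_L z \<tau> = (theta1 0 \<tau>)\<^sup>2 / (theta1 z \<tau>)\<^sup>2 * (theta3 z \<tau> / theta3 0 \<tau>) * (theta2 z \<tau> / theta2 0 \<tau>)"

definition h_W :: "complex \<Rightarrow> complex \<Rightarrow> complex" where
  "h_W z \<tau> = (theta2 0 \<tau>)\<^sup>2 / (theta2 z \<tau>)\<^sup>2 * (theta3 z \<tau> / theta3 0 \<tau>) * (theta1 z \<tau> / theta1 0 \<tau>)"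

definition h_W' :: "complex \<Rightarrow> complex \<Rightarrow> complex" where
  "h_W' z \<tau> = (theta3 0 \<tau>)\<^sup>2 / (theta3 z \<tau>)\<^sup>2 * (theta1 z \<tau> / theta1 0 \<tau>) * (theta2 z \<tau> / theta2 0 \<tau>)"

definition g_L :: "complex \<Rightarrow> complex \<Rightarrow> complex" where
  "g_L z \<tau> = dv theta2 z \<tau> / theta2 z \<tau> + dv theta3 z \<tau> / theta3 z \<tau> - 2 * (dv theta1 z \<tau> / theta1 z \<tau>)"

definition g_W :: "complex \<Rightarrow> complex \<Rightarrow> complex" where
  "g_W z \<tau> = dv theta3 z \<tau> / theta3 z \<tau> + dv theta1 z \<tau> / theta1 z \<tau> - 2 * (dv theta2 z \<tau> / theta2 z \<tau>)"

definition g_W' :: "complex \<Rightarrow> complex \<Rightarrow> complex" where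
  "g_W' z \<tau> = dv theta2 z \<tau> / theta2 z \<tau> + dv theta1 z \<tau> / theta1 z \<tau> - 2 * (dv theta3 z \<tau> / theta3 z \<tau>)"

text \<open>The Taylor series at $z = 0$ in the first variable; \<^const>\<open>remove_sings\<close> fills in the
  removable singularity that the formulas for $f_L$, $f_W$, $f_{W'}$ have there.\<close>

definition taylor :: "(complex \<Rightarrow> complex \<Rightarrow> complex) \<Rightarrow> complex \<Rightarrow> complex fps" where
  "taylor f \<tau> = fps_expansion (remove_sings (\<lambda>z. f z \<tau>)) 0"


section \<open>Modular forms\<close>

definition upper_half_plane :: "complex set" where
  "upper_half_plane = {\<tau>. Im \<tau> > 0}"

definition SL2Z :: "(int^2^2) set" where
  "SL2Z = {g. det g = 1}"

definition Gamma_0_2 :: "(int^2^2) set" where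
  "Gamma_0_2 = {g \<in> SL2Z. even (g $ 2 $ 1)}"

definition Gamma_up_0_2 :: "(int^2^2) set" where
  "Gamma_up_0_2 = {g \<in> SL2Z. even (g $ 1 $ 2)}"

definition Gamma_theta :: "(int^2^2) set" where
  "Gamma_theta = {g \<in> SL2Z.
     (odd (g $ 1 $ 1) \<and> even (g $ 1 $ 2) \<and> even (g $ 2 $ 1) \<and> odd (g $ 2 $ 2)) \<or>
     (even (g $ 1 $ 1) \<and> odd (g $ 1 $ 2) \<and> odd (g $ 2 $ 1) \<and> even (g $ 2 $ 2))}"

definition group_character :: "(int^2^2) set \<Rightarrow> (int^2^2 \<Rightarrow> complex) \<Rightarrow> bool" where
  "group_character \<Gamma> \<rho> \<longleftrightarrow>
     (\<forall>g\<in>\<Gamma>. \<rho> g \<noteq> 0) \<and> (\<forall>g\<in>\<Gamma>. \<forall>h\<in>\<Gamma>. \<rho> (g ** h) = \<rho> g * \<rho> h)"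

definition modular_form_with ::
    "(int^2^2) set \<Rightarrow> (int^2^2 \<Rightarrow> complex) \<Rightarrow> int \<Rightarrow> (complex \<Rightarrow> complex) \<Rightarrow> bool" where
  "modular_form_with \<Gamma> \<rho> w f \<longleftrightarrow> f holomorphic_on upper_half_plane \<and>
     (\<forall>g\<in>\<Gamma>. \<forall>\<tau>\<in>upper_half_plane.
        f ((of_int (g $ 1 $ 1) * \<tau> + of_int (g $ 1 $ 2)) / (of_int (g $ 2 $ 1) * \<tau> + of_int (g $ 2 $ 2)))
          = \<rho> g * (of_int (g $ 2 $ 1) * \<tau> + of_int (g $ 2 $ 2)) powi w * f \<tau>)"


section \<open>The algebra of complex differential forms at a point\<close>

text \<open>A possibly inhomogeneous form on a space of vectors of type \<open>'t\<close> is represented by all its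
  values: the degree $d$ component is the restriction to lists of $d$ vectors. Multiplication is the
  wedge product, given by the sum over shuffles with the determinant normalisation
  $(\alpha\wedge\beta)(v,w) = \alpha(v)\beta(w) - \alpha(w)\beta(v)$ for 1-forms; \<open>S\<close> is the set of
  positions that are fed to the left factor. The product is associative on arbitrary functions on
  lists, so neither multilinearity nor alternation need be part of the type: the forms built below
  inherit both from curvatures and connections.\<close>

typedef 't form = "UNIV :: ('t list \<Rightarrow> complex) set"
  morphisms form_at Form by auto

lemmas form_at_Form [simp] = Form_inverse[OF UNIV_I]

lemma form_eqI: "(\<And>vs. form_at \<alpha> vs = form_at \<beta> vs) \<Longrightarrow> \<alpha> = \<beta>"
  by (metis ext form_at_inject)

definition shuffle_sign :: "nat set \<Rightarrow> complex" where
  "shuffle_sign S = (\<Prod>i\<in>S. (-1) ^ card {j. j < i \<and> j \<notin> S})"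

definition shuffle_prod :: "('t list \<Rightarrow> complex) \<Rightarrow> ('t list \<Rightarrow> complex) \<Rightarrow> 't list \<Rightarrow> complex" where
  "shuffle_prod a b vs =
     (\<Sum>S\<in>Pow {..<length vs}. shuffle_sign S * a (nths vs S) * b (nths vs (- S)))"

lemma shuffle_prod_Nil [simp]: "shuffle_prod a b [] = a [] * b []"
  by (simp add: shuffle_prod_def shuffle_sign_def)

lemma card_shift:
  "card {j. j < Suc i \<and> j \<notin> A} = card {j. j < i \<and> Suc j \<notin> A} + (if 0 \<in> A then 0 else 1)"
proof -
  have "{j. j < Suc i \<and> j \<notin> A}
      = (if 0 \<in> A then {} else {0}) \<union> Suc ` {j. j < i \<and> Suc j \<notin> A}"
    by (auto simp: image_iff) (metis less_Suc_eq_0_disj)+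
  then show ?thesis
    by (auto simp: card_image card_insert_if)
qed

lemma shuffle_sign_shift:
  assumes "finite T"
  shows "shuffle_sign (Suc ` T) = (-1) ^ card T * shuffle_sign T"
proof -
  have "card {j. j < Suc i \<and> j \<notin> Suc ` T} = Suc (card {j. j < i \<and> j \<notin> T})" for i
    by (subst card_shift) (auto simp: inj_image_mem_iff)
  then have "shuffle_sign (Suc ` T) = (\<Prod>i\<in>T. (-1) * (-1) ^ card {j. j < i \<and> j \<notin> T})"
    by (simp add: shuffle_sign_def prod.reindex)
  also have "\<dots> = (-1) ^ card T * shuffle_sign T"
    unfolding prod.distrib shuffle_sign_def by simp
  finally show ?thesis .
qed

lemma shuffle_sign_shift0:
  assumes "finite T"
  shows "shuffle_sign (insert 0 (Suc ` T)) = shuffle_sign T"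
proof -
  have "card {j. j < Suc i \<and> j \<notin> insert 0 (Suc ` T)} = card {j. j < i \<and> j \<notin> T}" for i
    by (subst card_shift) (auto simp: inj_image_mem_iff)
  then have "(\<Prod>i\<in>Suc ` T. (-1) ^ card {j. j < i \<and> j \<notin> insert 0 (Suc ` T)}) = shuffle_sign T"
    by (simp add: shuffle_sign_def prod.reindex del: insert_iff)
  moreover have "0 \<notin> Suc ` T"
    by auto
  ultimately show ?thesis
    using assms unfolding shuffle_sign_def by (subst prod.insert) auto
qed

lemma sum_Pow_Suc:
  fixes f :: "nat set \<Rightarrow> complex"
  shows "sum f (Pow {..<Suc n})
       = (\<Sum>T\<in>Pow {..<n}. f (insert 0 (Suc ` T))) + (\<Sum>T\<in>Pow {..<n}. f (Suc ` T))"
proof -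
  have *: "Pow {..<Suc n} = insert 0 ` Pow (Suc ` {..<n}) \<union> Pow (Suc ` {..<n})"
    unfolding lessThan_Suc_eq_insert_0 Pow_insert by (rule Un_commute)
  have P: "Pow (Suc ` {..<n}) = (`) Suc ` Pow {..<n}"
    by (rule image_Pow_surj[symmetric]) simp
  have "sum f (Pow {..<Suc n}) = sum f (insert 0 ` Pow (Suc ` {..<n})) + sum f (Pow (Suc ` {..<n}))"
    unfolding * by (rule sum.union_disjoint) auto
  moreover have "sum f (insert 0 ` (`) Suc ` Pow {..<n}) = (\<Sum>T\<in>Pow {..<n}. f (insert 0 (Suc ` T)))"
    unfolding image_image
  proof (subst sum.reindex)
    show "inj_on (\<lambda>T. insert 0 (Suc ` T)) (Pow {..<n})"
    proof (rule inj_onI)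
      fix S T assume "insert 0 (Suc ` S) = insert 0 (Suc ` T)"
      then have "{j. Suc j \<in> insert 0 (Suc ` S)} = {j. Suc j \<in> insert 0 (Suc ` T)}"
        by (rule arg_cong)
      then show "S = T"
        by (simp add: inj_image_mem_iff)
    qed
  qed simp
  moreover have "sum f ((`) Suc ` Pow {..<n}) = (\<Sum>T\<in>Pow {..<n}. f (Suc ` T))"
    by (subst sum.reindex) (auto intro!: inj_onI simp: inj_image_eq_iff)
  ultimately show ?thesis
    by (simp only: P)
qed

text \<open>The antiderivation rule $\iota_v(\alpha\wedge\beta) = \iota_v\alpha\wedge\beta +
  (-1)^{\deg\alpha}\alpha\wedge\iota_v\beta$.\<close>

lemma shuffle_prod_Cons:
  "shuffle_prod a b (v # vs) =
     shuffle_prod (\<lambda>ws. a (v # ws)) b vs + shuffle_prod (\<lambda>ws. (-1) ^ length ws * a ws) (\<lambda>ws. b (v # ws)) vs"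
proof -
  have len: "length (nths vs T) = card T" if "T \<subseteq> {..<length vs}" for T
    unfolding length_nths by (rule arg_cong[of _ _ card]) (use that in auto)
  have fin: "finite T" if "T \<subseteq> {..<length vs}" for T
    using that finite_subset by blast
  have sets: "{j. Suc j \<in> Suc ` T} = T" "{j. Suc j \<in> insert 0 (Suc ` T)} = T"
    "{j. Suc j \<in> - Suc ` T} = - T" "{j. Suc j \<in> - insert 0 (Suc ` T)} = - T"
    "(0 \<in> Suc ` T) = False" "(0 \<in> insert 0 (Suc ` T)) = True"
    "(0 \<in> - Suc ` T) = True" "(0 \<in> - insert 0 (Suc ` T)) = False" for T
    by auto
  have nths: "nths (v # vs) (Suc ` T) = nths vs T" "nths (v # vs) (insert 0 (Suc ` T)) = v # nths vs T"
    "nths (v # vs) (- Suc ` T) = v # nths vs (- T)" "nths (v # vs) (- insert 0 (Suc ` T)) = nths vs (- T)" for T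
    unfolding nths_Cons sets by simp_all
  have 1: "shuffle_sign (insert 0 (Suc ` T)) * a (nths (v # vs) (insert 0 (Suc ` T))) *
      b (nths (v # vs) (- insert 0 (Suc ` T))) = shuffle_sign T * a (v # nths vs T) * b (nths vs (- T))"
    if "T \<in> Pow {..<length vs}" for T
    using that fin[of T] unfolding nths by (simp only: shuffle_sign_shift0 Pow_iff)
  have 2: "shuffle_sign (Suc ` T) * a (nths (v # vs) (Suc ` T)) * b (nths (v # vs) (- Suc ` T))
      = shuffle_sign T * ((-1) ^ length (nths vs T) * a (nths vs T)) * b (v # nths vs (- T))"
    if "T \<in> Pow {..<length vs}" for T
    using that fin[of T] unfolding nths by (simp only: shuffle_sign_shift len Pow_iff) (simp only: ac_simps)
  show ?thesis
    unfolding shuffle_prod_def list.size(4) add_0_right add_Suc_right sum_Pow_Suc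
    by (rule arg_cong2[of _ _ _ _ "(+)", OF sum.cong[OF refl 1] sum.cong[OF refl 2]])
qed

lemma shuffle_prod_add_left:
  "shuffle_prod (\<lambda>ws. a ws + b ws) c vs = shuffle_prod a c vs + shuffle_prod b c vs"
  by (simp add: shuffle_prod_def algebra_simps sum.distrib)

lemma shuffle_prod_add_right:
  "shuffle_prod a (\<lambda>ws. b ws + c ws) vs = shuffle_prod a b vs + shuffle_prod a c vs"
  by (simp add: shuffle_prod_def algebra_simps sum.distrib)

lemma shuffle_prod_minus_left: "shuffle_prod (\<lambda>ws. - a ws) b vs = - shuffle_prod a b vs"
  and shuffle_prod_minus_right: "shuffle_prod a (\<lambda>ws. - b ws) vs = - shuffle_prod a b vs"
  by (simp_all add: shuffle_prod_def sum_negf)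

lemma shuffle_prod_parity:
  "(-1) ^ length vs * shuffle_prod a b vs
     = shuffle_prod (\<lambda>ws. (-1) ^ length ws * a ws) (\<lambda>ws. (-1) ^ length ws * b ws) vs"
proof (induction vs arbitrary: a b)
  case Nil
  show ?case by (simp only: shuffle_prod_Nil list.size power_0 mult_1)
next
  case (Cons v vs)
  have *: "(-1) ^ length (v # ws) * c = - ((-1) ^ length ws * c)" for ws :: "'a list" and c :: complex
    by simp
  have "(-1) ^ length (v # vs) * shuffle_prod a b (v # vs)
     = - ((-1) ^ length vs * shuffle_prod (\<lambda>ws. a (v # ws)) b vs)
       + - ((-1) ^ length vs * shuffle_prod (\<lambda>ws. (-1) ^ length ws * a ws) (\<lambda>ws. b (v # ws)) vs)"
    by (simp only: * shuffle_prod_Cons distrib_left minus_add_distrib)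
  also have "\<dots> = shuffle_prod (\<lambda>ws. (-1) ^ length ws * a ws) (\<lambda>ws. (-1) ^ length ws * b ws) (v # vs)"
    by (simp only: Cons.IH shuffle_prod_Cons * shuffle_prod_minus_left shuffle_prod_minus_right)
  finally show ?case .
qed

lemma shuffle_prod_assoc: "shuffle_prod (shuffle_prod a b) c vs = shuffle_prod a (shuffle_prod b c) vs"
proof (induction vs arbitrary: a b c)
  case (Cons v vs)
  have "shuffle_prod (shuffle_prod a b) c (v # vs)
    = shuffle_prod (shuffle_prod (\<lambda>ws. a (v # ws)) b) c vs
    + shuffle_prod (shuffle_prod (\<lambda>ws. (-1) ^ length ws * a ws) (\<lambda>ws. b (v # ws))) c vs
    + shuffle_prod (shuffle_prod (\<lambda>ws. (-1) ^ length ws * a ws) (\<lambda>ws. (-1) ^ length ws * b ws))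
        (\<lambda>ws. c (v # ws)) vs"
    by (simp only: shuffle_prod_Cons shuffle_prod_add_left shuffle_prod_parity)
  also have "\<dots> = shuffle_prod a (shuffle_prod b c) (v # vs)"
    by (simp only: Cons.IH shuffle_prod_Cons shuffle_prod_add_right add.assoc)
  finally show ?case .
qed simp

definition one_fun :: "'t list \<Rightarrow> complex" where
  "one_fun vs = (if vs = [] then 1 else 0)"

lemma shuffle_prod_zero_left: "shuffle_prod (\<lambda>ws. 0) b vs = 0"
  and shuffle_prod_zero_right: "shuffle_prod a (\<lambda>ws. 0) vs = 0"
  by (simp_all add: shuffle_prod_def)

lemma shuffle_prod_one_left: "shuffle_prod one_fun b vs = b vs"
proof (induction vs arbitrary: b)
  case (Cons v vs)
  have "(\<lambda>ws. (-1) ^ length ws * one_fun ws) = (one_fun :: 'a list \<Rightarrow> complex)"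
    by (auto simp: one_fun_def)
  moreover have "(\<lambda>ws. one_fun (v # ws)) = (\<lambda>ws. 0)"
    by (auto simp: one_fun_def)
  ultimately show ?case
    by (simp add: shuffle_prod_Cons Cons.IH shuffle_prod_zero_left)
qed (simp add: one_fun_def)

lemma shuffle_prod_one_right: "shuffle_prod a one_fun vs = a vs"
proof (induction vs arbitrary: a)
  case (Cons v vs)
  have "(\<lambda>ws. one_fun (v # ws)) = (\<lambda>ws. 0)"
    by (auto simp: one_fun_def)
  then show ?case
    by (simp add: shuffle_prod_Cons Cons.IH shuffle_prod_zero_right)
qed (simp add: one_fun_def)

instantiation form :: (type) ring_1
begin

definition "0 = Form (\<lambda>vs. 0)"
definition "1 = Form one_fun"
definition "\<alpha> + \<beta> = Form (\<lambda>vs. form_at \<alpha> vs + form_at \<beta> vs)"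
definition "\<alpha> - \<beta> = Form (\<lambda>vs. form_at \<alpha> vs - form_at \<beta> vs)"
definition "- \<alpha> = Form (\<lambda>vs. - form_at \<alpha> vs)"
definition "\<alpha> * \<beta> = Form (shuffle_prod (form_at \<alpha>) (form_at \<beta>))"

lemmas form_defs = zero_form_def one_form_def plus_form_def minus_form_def uminus_form_def
  times_form_def

instance
proof
  show "(0::'a form) \<noteq> 1"
    by (auto simp: form_defs Form_inject one_fun_def fun_eq_iff)
qed (auto intro!: form_eqI simp: form_defs shuffle_prod_one_left shuffle_prod_one_right
      shuffle_prod_add_left shuffle_prod_add_right shuffle_prod_assoc)

end

definition scale_form :: "complex \<Rightarrow> 't form \<Rightarrow> 't form" where
  "scale_form c \<omega> = Form (\<lambda>vs. c * form_at \<omega> vs)"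

definition degree_part :: "nat \<Rightarrow> 't form \<Rightarrow> 't form" where
  "degree_part d \<omega> = Form (\<lambda>vs. if length vs = d then form_at \<omega> vs else 0)"

definition integral_form :: "real set \<Rightarrow> (real \<Rightarrow> 't form) \<Rightarrow> 't form" where
  "integral_form I \<omega> = Form (\<lambda>vs. integral I (\<lambda>t. form_at (\<omega> t) vs))"

text \<open>Substitution of a form, or of a matrix of forms, without degree 0 component into a power
  series. The $n$-th power then vanishes on lists with fewer than $n$ vectors, so the sums below
  are the full series.\<close>

definition fps_at_form :: "complex fps \<Rightarrow> 't form \<Rightarrow> 't form" where
  "fps_at_form f \<omega> = Form (\<lambda>vs. \<Sum>n\<le>length vs. fps_nth f n * form_at (\<omega> ^ n) vs)"

primrec matrix_power :: "'a::semiring_1^'r^'r \<Rightarrow> nat \<Rightarrow> 'a^'r^'r" where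
  "matrix_power A 0 = mat 1"
| "matrix_power A (Suc n) = A ** matrix_power A n"

definition fps_at_matrix :: "complex fps \<Rightarrow> 't form^'r^'r \<Rightarrow> 't form^'r^'r" where
  "fps_at_matrix f R = (\<chi> i j. Form (\<lambda>vs. \<Sum>n\<le>length vs.
     fps_nth f n * form_at (matrix_power R n $ i $ j) vs))"

definition scale_matrix :: "complex \<Rightarrow> 't form^'r^'r \<Rightarrow> 't form^'r^'r" where
  "scale_matrix c R = (\<chi> i j. scale_form c (R $ i $ j))"

text \<open>$\det^{1/2}(f(R)) = \exp(\frac12\mathrm{tr}\log f(R))$ for a power series \<open>f\<close> with constant
  term 1, which is the constant term of each of $f_L, f_W, f_{W'}, h_L, h_W, h_{W'}$.\<close>

definition det_half :: "complex fps \<Rightarrow> 't form^'r^'r \<Rightarrow> 't form" where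
  "det_half f R =
     fps_at_form (fps_exp 1) (scale_form (1/2) (trace (fps_at_matrix (fps_ln 1 oo (f - 1)) R)))"


section \<open>Smooth manifolds\<close>

text \<open>\<open>Ck_on k S f\<close> is meant for open \<open>S\<close>.\<close>

primrec Ck_on ::
    "nat \<Rightarrow> 'a::euclidean_space set \<Rightarrow> ('a \<Rightarrow> 'b::real_normed_vector) \<Rightarrow> bool" where
  "Ck_on 0 S f \<longleftrightarrow> continuous_on S f"
| "Ck_on (Suc k) S f \<longleftrightarrow>
     f differentiable_on S \<and> (\<forall>v. Ck_on k S (\<lambda>x. frechet_derivative f (at x) v))"

definition smooth_on :: "'a::euclidean_space set \<Rightarrow> ('a \<Rightarrow> 'b::real_normed_vector) \<Rightarrow> bool" where
  "smooth_on S f \<longleftrightarrow> (\<forall>k. Ck_on k S f)"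

type_synonym ('m, 'n) atlas = "('m set \<times> ('m \<Rightarrow> real^'n)) set"

text \<open>The manifold is the whole type \<open>'m\<close> (Hausdorff and second countable by its sort), of dimension
  \<open>CARD('n)\<close>. A chart is a pair of its domain and its coordinate map.\<close>

locale smooth_manifold =
  fixes A :: "('m::{t2_space, second_countable_topology}, 'n::finite) atlas"
  assumes charts_cover: "\<exists>(U, \<phi>)\<in>A. p \<in> U"
    and chart_open: "(U, \<phi>) \<in> A \<Longrightarrow> open U \<and> open (\<phi> ` U)"
    and chart_homeomorphism: "(U, \<phi>) \<in> A \<Longrightarrow> homeomorphism U (\<phi> ` U) \<phi> (inv_into U \<phi>)"
    and charts_compatible:
      "(U, \<phi>) \<in> A \<Longrightarrow> (V, \<psi>) \<in> A \<Longrightarrow> smooth_on (\<phi> ` (U \<inter> V)) (\<psi> \<circ> inv_into U \<phi>)"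

definition smooth_function :: "('m, 'n::finite) atlas \<Rightarrow> 'm set \<Rightarrow> ('m \<Rightarrow> real) \<Rightarrow> bool" where
  "smooth_function A W f \<longleftrightarrow> (\<forall>(U, \<phi>)\<in>A. smooth_on (\<phi> ` (U \<inter> W)) (f \<circ> inv_into U \<phi>))"

definition smooth_near :: "('m::topological_space, 'n::finite) atlas \<Rightarrow> 'm \<Rightarrow> ('m \<Rightarrow> real) \<Rightarrow> bool" where
  "smooth_near A p f \<longleftrightarrow> (\<exists>W. open W \<and> p \<in> W \<and> smooth_function A W f)"

text \<open>Tangent vectors at \<open>p\<close> are derivations of germs at \<open>p\<close> of smooth functions. They are extended
  by 0 to functions that are not smooth near \<open>p\<close>, to make equality of derivations extensional.\<close>

type_synonym 'm tangent = "('m \<Rightarrow> real) \<Rightarrow> real"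

instantiation "fun" :: (type, real_vector) real_vector
begin

definition "scaleR c f = (\<lambda>x. c *\<^sub>R f x)"

instance
  by standard (auto simp: scaleR_fun_def plus_fun_def algebra_simps)

end

definition tangent_space ::
    "('m::topological_space, 'n::finite) atlas \<Rightarrow> 'm \<Rightarrow> 'm tangent set" where
  "tangent_space A p = {D.
     (\<forall>f. \<not> smooth_near A p f \<longrightarrow> D f = 0) \<and>
     (\<forall>f g. smooth_near A p f \<longrightarrow> smooth_near A p g \<longrightarrow>
        ((\<forall>\<^sub>F x in nhds p. f x = g x) \<longrightarrow> D f = D g) \<and>
        D (\<lambda>x. f x + g x) = D f + D g \<and>
        (\<forall>c. D (\<lambda>x. c * f x) = c * D f) \<and>
        D (\<lambda>x. f x * g x) = D f * g p + f p * D g)}"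

definition coord_vector ::
    "('m::topological_space, 'n::finite) atlas \<Rightarrow> 'm set \<times> ('m \<Rightarrow> real^'n) \<Rightarrow> 'n \<Rightarrow> 'm \<Rightarrow> 'm tangent"
where
  "coord_vector A c i p f =
     (if smooth_near A p f
      then frechet_derivative (f \<circ> inv_into (fst c) (snd c)) (at (snd c p)) (axis i 1) else 0)"

definition lie_bracket ::
    "('m::topological_space, 'n::finite) atlas \<Rightarrow> ('m \<Rightarrow> 'm tangent) \<Rightarrow> ('m \<Rightarrow> 'm tangent)
       \<Rightarrow> 'm \<Rightarrow> 'm tangent" where
  "lie_bracket A X Y p f =
     (if smooth_near A p f then X p (\<lambda>x. Y x f) - Y p (\<lambda>x. X x f) else 0)"


section \<open>Vector bundles and connections\<close>

text \<open>A bundle is given by its fibres \<open>E p\<close>, subspaces of an arbitrary real vector space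
  \<open>'v\<close> (in which fibres over different points need not be related), together with a family of local
  frames \<open>(U, e)\<close> that define the smooth structure; \<open>e i\<close> is the \<open>i\<close>-th section of the frame, and the
  rank is \<open>CARD('r)\<close>.\<close>

type_synonym ('m, 'v, 'r) frames = "('m set \<times> ('r \<Rightarrow> 'm \<Rightarrow> 'v)) set"

definition coord_of :: "('r \<Rightarrow> 'v::real_vector) \<Rightarrow> 'v \<Rightarrow> 'r \<Rightarrow> real" where
  "coord_of b v i = representation (range b) v (b i)"

abbreviation (input) basis_at :: "('r \<Rightarrow> 'm \<Rightarrow> 'v) \<Rightarrow> 'm \<Rightarrow> 'r \<Rightarrow> 'v" where
  "basis_at e p \<equiv> \<lambda>i. e i p"

locale vector_bundle = smooth_manifold A
  for A :: "('m::{t2_space, second_countable_topology}, 'n::finite) atlas" +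
  fixes E :: "'m \<Rightarrow> 'v::real_vector set"
    and F :: "('m, 'v, 'r::finite) frames"
  assumes frames_cover: "\<exists>(U, e)\<in>F. p \<in> U"
    and frame_open: "(U, e) \<in> F \<Longrightarrow> open U"
    and frame_basis: "(U, e) \<in> F \<Longrightarrow> p \<in> U \<Longrightarrow>
      inj (basis_at e p) \<and> independent (range (basis_at e p)) \<and> span (range (basis_at e p)) = E p"
    and frames_compatible: "(U, e) \<in> F \<Longrightarrow> (V, e') \<in> F \<Longrightarrow>
      smooth_function A (U \<inter> V) (\<lambda>p. coord_of (basis_at e p) (e' j p) i)"

text \<open>Frames of one orientation: all changes of frame have positive determinant.\<close>

definition oriented_frames :: "('m, 'v::real_vector, 'r::finite) frames \<Rightarrow> bool" where
  "oriented_frames F \<longleftrightarrow> (\<forall>(U, e)\<in>F. \<forall>(V, e')\<in>F. \<forall>p\<in>U \<inter> V.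
     det (\<chi> i j. coord_of (basis_at e p) (e' j p) i) > 0)"

text \<open>The tangent bundle has the fibres \<^const>\<open>tangent_space\<close> and the coordinate frames.\<close>

definition coord_frames ::
    "('m::topological_space, 'n::finite) atlas \<Rightarrow> ('m, 'm tangent, 'n) frames" where
  "coord_frames A = (\<lambda>c. (fst c, coord_vector A c)) ` A"

definition smooth_section ::
    "('m, 'n::finite) atlas \<Rightarrow> ('m \<Rightarrow> 'v::real_vector set) \<Rightarrow> ('m, 'v, 'r::finite) frames
       \<Rightarrow> 'm set \<Rightarrow> ('m \<Rightarrow> 'v) \<Rightarrow> bool" where
  "smooth_section A E F W s \<longleftrightarrow> (\<forall>p\<in>W. s p \<in> E p) \<and>
     (\<forall>(U, e)\<in>F. \<forall>i. smooth_function A (U \<inter> W) (\<lambda>p. coord_of (basis_at e p) (s p) i))"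

locale fibre_metric =
  fixes A :: "('m::topological_space, 'n::finite) atlas"
    and E :: "'m \<Rightarrow> 'v::real_vector set"
    and F :: "('m, 'v, 'r::finite) frames"
    and g :: "'m \<Rightarrow> 'v \<Rightarrow> 'v \<Rightarrow> real"
  assumes metric_sym: "x \<in> E p \<Longrightarrow> y \<in> E p \<Longrightarrow> g p x y = g p y x"
    and metric_add: "x \<in> E p \<Longrightarrow> y \<in> E p \<Longrightarrow> z \<in> E p \<Longrightarrow> g p (x + y) z = g p x z + g p y z"
    and metric_scale: "x \<in> E p \<Longrightarrow> y \<in> E p \<Longrightarrow> g p (c *\<^sub>R x) y = c * g p x y"
    and metric_pos: "x \<in> E p \<Longrightarrow> x \<noteq> 0 \<Longrightarrow> g p x x > 0"
    and metric_smooth: "open W \<Longrightarrow> smooth_section A E F W s \<Longrightarrow> smooth_section A E F W s' \<Longrightarrow>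
      smooth_function A W (\<lambda>x. g x (s x) (s' x))"

text \<open>\<open>nab p v s\<close> is the covariant derivative at \<open>p\<close>, in the direction of the tangent vector \<open>v\<close> at
  \<open>p\<close>, of the section \<open>s\<close> defined near \<open>p\<close>. Smoothness is tested on coordinate vector fields, which
  suffices by linearity in \<open>v\<close>.\<close>

type_synonym ('m, 'v) covariant_derivative = "'m \<Rightarrow> 'm tangent \<Rightarrow> ('m \<Rightarrow> 'v) \<Rightarrow> 'v"

locale connection =
  fixes A :: "('m::topological_space, 'n::finite) atlas"
    and E :: "'m \<Rightarrow> 'v::real_vector set"
    and F :: "('m, 'v, 'r::finite) frames"
    and nab :: "('m, 'v) covariant_derivative"
  assumes nab_in: "open W \<Longrightarrow> p \<in> W \<Longrightarrow> smooth_section A E F W s \<Longrightarrow> v \<in> tangent_space A p \<Longrightarrow>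
      nab p v s \<in> E p"
    and nab_add_vector: "open W \<Longrightarrow> p \<in> W \<Longrightarrow> smooth_section A E F W s \<Longrightarrow>
      v \<in> tangent_space A p \<Longrightarrow> w \<in> tangent_space A p \<Longrightarrow> nab p (v + w) s = nab p v s + nab p w s"
    and nab_scale_vector: "open W \<Longrightarrow> p \<in> W \<Longrightarrow> smooth_section A E F W s \<Longrightarrow>
      v \<in> tangent_space A p \<Longrightarrow> nab p (c *\<^sub>R v) s = c *\<^sub>R nab p v s"
    and nab_local: "open W \<Longrightarrow> p \<in> W \<Longrightarrow> smooth_section A E F W s \<Longrightarrow> smooth_section A E F W s' \<Longrightarrow>
      v \<in> tangent_space A p \<Longrightarrow> \<forall>x\<in>W. s x = s' x \<Longrightarrow> nab p v s = nab p v s'"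
    and nab_add: "open W \<Longrightarrow> p \<in> W \<Longrightarrow> smooth_section A E F W s \<Longrightarrow> smooth_section A E F W s' \<Longrightarrow>
      v \<in> tangent_space A p \<Longrightarrow> nab p v (\<lambda>x. s x + s' x) = nab p v s + nab p v s'"
    and nab_leibniz: "open W \<Longrightarrow> p \<in> W \<Longrightarrow> smooth_section A E F W s \<Longrightarrow> smooth_function A W f \<Longrightarrow>
      v \<in> tangent_space A p \<Longrightarrow> nab p v (\<lambda>x. f x *\<^sub>R s x) = v f *\<^sub>R s p + f p *\<^sub>R nab p v s"
    and nab_smooth: "open W \<Longrightarrow> smooth_section A E F W s \<Longrightarrow> (U, \<phi>) \<in> A \<Longrightarrow>
      smooth_section A E F (U \<inter> W) (\<lambda>p. nab p (coord_vector A (U, \<phi>) a p) s)"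

locale metric_connection = connection A E F nab + fibre_metric A E F g
  for A :: "('m::topological_space, 'n::finite) atlas"
    and E :: "'m \<Rightarrow> 'v::real_vector set"
    and F :: "('m, 'v, 'r::finite) frames"
    and g :: "'m \<Rightarrow> 'v \<Rightarrow> 'v \<Rightarrow> real"
    and nab :: "('m, 'v) covariant_derivative" +
  assumes nab_metric: "open W \<Longrightarrow> p \<in> W \<Longrightarrow> smooth_section A E F W s \<Longrightarrow> smooth_section A E F W s' \<Longrightarrow>
      v \<in> tangent_space A p \<Longrightarrow> v (\<lambda>x. g x (s x) (s' x)) = g p (nab p v s) (s' p) + g p (s p) (nab p v s')"

definition curvature ::
    "('m::topological_space, 'n::finite) atlas \<Rightarrow> ('m, 'v::real_vector) covariant_derivative
       \<Rightarrow> ('m \<Rightarrow> 'm tangent) \<Rightarrow> ('m \<Rightarrow> 'm tangent) \<Rightarrow> ('m \<Rightarrow> 'v) \<Rightarrow> 'm \<Rightarrow> 'v" where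
  "curvature A nab X Y s p =
     nab p (X p) (\<lambda>x. nab x (Y x) s) - nab p (Y p) (\<lambda>x. nab x (X x) s)
     - nab p (lie_bracket A X Y p) s"

definition chart_at :: "('m, 'n) atlas \<Rightarrow> 'm \<Rightarrow> 'm set \<times> ('m \<Rightarrow> real^'n)" where
  "chart_at A p = (SOME c. c \<in> A \<and> p \<in> fst c)"

definition frame_at :: "('m, 'v, 'r) frames \<Rightarrow> 'm \<Rightarrow> 'r \<Rightarrow> 'm \<Rightarrow> 'v" where
  "frame_at F p = snd (SOME c. c \<in> F \<and> p \<in> fst c)"

text \<open>The curvature at \<open>p\<close> as a matrix of 2-forms with respect to a local frame:
  $R(v,w)e_j = \sum_i R_{ij}(v,w)e_i$, where $R = \sum_{a,b} dx^a\otimes dx^b\, R(\partial_a,\partial_b)$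
  and $dx^a(v) = v(x^a)$. Since curvature is a tensor, the choice of chart is immaterial and the choice
  of frame changes the matrix by conjugation, which the invariant expressions below do not see.\<close>

definition curvature_matrix ::
    "('m::topological_space, 'n::finite) atlas \<Rightarrow> ('m, 'v::real_vector, 'r::finite) frames
       \<Rightarrow> ('m, 'v) covariant_derivative \<Rightarrow> 'm \<Rightarrow> 'm tangent form^'r^'r" where
  "curvature_matrix A F nab p = (let c = chart_at A p; e = frame_at F p in
     \<chi> i j. Form (\<lambda>vs. case vs of
         [v, w] \<Rightarrow> of_real (\<Sum>a\<in>UNIV. \<Sum>b\<in>UNIV. v (\<lambda>x. snd c x $ a) * w (\<lambda>x. snd c x $ b) *
            coord_of (basis_at e p) (curvature A nab (coord_vector A c a) (coord_vector A c b) (e j) p) i)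
       | _ \<Rightarrow> 0))"

text \<open>The $\mathrm{End}$-valued 1-form $\nabla_1 - \nabla_0$ at \<open>p\<close> in the same frame.\<close>

definition difference_matrix ::
    "('m, 'v::real_vector, 'r::finite) frames \<Rightarrow> ('m, 'v) covariant_derivative
       \<Rightarrow> ('m, 'v) covariant_derivative \<Rightarrow> 'm \<Rightarrow> 'm tangent form^'r^'r" where
  "difference_matrix F nab0 nab1 p = (let e = frame_at F p in
     \<chi> i j. Form (\<lambda>vs. case vs of
         [v] \<Rightarrow> of_real (coord_of (basis_at e p) (nab1 p v (e j) - nab0 p v (e j)) i)
       | _ \<Rightarrow> 0))"

definition connection_path ::
    "('m, 'v::real_vector) covariant_derivative \<Rightarrow> ('m, 'v) covariant_derivative \<Rightarrow> real
       \<Rightarrow> ('m, 'v) covariant_derivative" where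
  "connection_path nab0 nab1 t p v s = (1 - t) *\<^sub>R nab0 p v s + t *\<^sub>R nab1 p v s"


section \<open>The characteristic forms and their transgressions\<close>

text \<open>All forms are given at a point \<open>p\<close>. \<open>A\<close> is the atlas, \<open>F\<close> the frames of \<open>\<xi>\<close>.\<close>

definition tangent_curvature ::
    "('m::topological_space, 'n::finite) atlas \<Rightarrow> ('m, 'm tangent) covariant_derivative
       \<Rightarrow> 'm \<Rightarrow> 'm tangent form^'n^'n" where
  "tangent_curvature A nabT p = scale_matrix (1 / (4 * pi\<^sup>2)) (curvature_matrix A (coord_frames A) nabT p)"

definition bundle_curvature ::
    "('m::topological_space, 'n::finite) atlas \<Rightarrow> ('m, 'v::real_vector, 'r::finite) frames
       \<Rightarrow> ('m, 'v) covariant_derivative \<Rightarrow> 'm \<Rightarrow> 'm tangent form^'r^'r" where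
  "bundle_curvature A F nab p = scale_matrix (1 / (4 * pi\<^sup>2)) (curvature_matrix A F nab p)"

context
  fixes A :: "('m::topological_space, 'n::finite) atlas"
    and F :: "('m, 'v::real_vector, 'r::finite) frames"
    and nabT :: "('m, 'm tangent) covariant_derivative"
begin

definition Phi_L :: "nat \<Rightarrow> ('m, 'v) covariant_derivative \<Rightarrow> complex \<Rightarrow> 'm \<Rightarrow> 'm tangent form" where
  "Phi_L k nab \<tau> p = scale_form (sqrt 2 ^ (4 * k - 1))
     (det_half (taylor f_L \<tau>) (tangent_curvature A nabT p) *
      det_half (taylor h_L \<tau>) (bundle_curvature A F nab p))"

definition Phi_W :: "('m, 'v) covariant_derivative \<Rightarrow> complex \<Rightarrow> 'm \<Rightarrow> 'm tangent form" where
  "Phi_W nab \<tau> p =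
     det_half (taylor f_W \<tau>) (tangent_curvature A nabT p) *
     det_half (taylor h_W \<tau>) (bundle_curvature A F nab p)"

definition Phi_W' :: "('m, 'v) covariant_derivative \<Rightarrow> complex \<Rightarrow> 'm \<Rightarrow> 'm tangent form" where
  "Phi_W' nab \<tau> p =
     det_half (taylor f_W' \<tau>) (tangent_curvature A nabT p) *
     det_half (taylor h_W' \<tau>) (bundle_curvature A F nab p)"

definition CSPhi_L :: "nat \<Rightarrow> ('m, 'v) covariant_derivative \<Rightarrow> ('m, 'v) covariant_derivative
    \<Rightarrow> complex \<Rightarrow> 'm \<Rightarrow> 'm tangent form" where
  "CSPhi_L k nab0 nab1 \<tau> p = scale_form (sqrt 2 / (8 * pi\<^sup>2)) (integral_form {0..1} (\<lambda>t.
     Phi_L k (connection_path nab0 nab1 t) \<tau> p *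
     trace (difference_matrix F nab0 nab1 p **
       fps_at_matrix (taylor g_L \<tau>) (bundle_curvature A F (connection_path nab0 nab1 t) p))))"

definition CSPhi_W :: "('m, 'v) covariant_derivative \<Rightarrow> ('m, 'v) covariant_derivative
    \<Rightarrow> complex \<Rightarrow> 'm \<Rightarrow> 'm tangent form" where
  "CSPhi_W nab0 nab1 \<tau> p = scale_form (1 / (8 * pi\<^sup>2)) (integral_form {0..1} (\<lambda>t.
     Phi_W (connection_path nab0 nab1 t) \<tau> p *
     trace (difference_matrix F nab0 nab1 p **
       fps_at_matrix (taylor g_W \<tau>) (bundle_curvature A F (connection_path nab0 nab1 t) p))))"

definition CSPhi_W' :: "('m, 'v) covariant_derivative \<Rightarrow> ('m, 'v) covariant_derivative
    \<Rightarrow> complex \<Rightarrow> 'm \<Rightarrow> 'm tangent form" where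
  "CSPhi_W' nab0 nab1 \<tau> p = scale_form (1 / (8 * pi\<^sup>2)) (integral_form {0..1} (\<lambda>t.
     Phi_W' (connection_path nab0 nab1 t) \<tau> p *
     trace (difference_matrix F nab0 nab1 p **
       fps_at_matrix (taylor g_W' \<tau>) (bundle_curvature A F (connection_path nab0 nab1 t) p))))"

end

text \<open>Modularity of a family of differential forms, tested on its values on tangent vectors at each
  point, with one character for all of them.\<close>

definition modular_differential_form ::
    "('m::topological_space, 'n::finite) atlas \<Rightarrow> (int^2^2) set \<Rightarrow> int
       \<Rightarrow> (complex \<Rightarrow> 'm \<Rightarrow> 'm tangent form) \<Rightarrow> bool" where
  "modular_differential_form A \<Gamma> w \<omega> \<longleftrightarrow> (\<exists>\<rho>. group_character \<Gamma> \<rho> \<and>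
     (\<forall>p vs. set vs \<subseteq> tangent_space A p \<longrightarrow> modular_form_with \<Gamma> \<rho> w (\<lambda>\<tau>. form_at (\<omega> \<tau> p) vs)))"

end

theory Submission
  imports Defs
begin

text \<open>
  Put $r_i(z,\tau) = \theta'(0,\tau)\theta_i(z,\tau)/(\theta(z,\tau)\theta_i(0,\tau))$. As a
  function of $z$ it has simple poles on the lattice $\mathbf Z+\tau\mathbf Z$, residue $1$ at $0$, and
  is multiplied by a nontrivial sign character of the lattice when $z$ is translated; by Liouville's
  theorem these properties determine it. A matrix in $SL_2(\mathbf Z)$ maps one lattice to a multiple
  of the other, so $r_i(z,g\tau) = (c\tau+d)\,r_{\sigma(i)}((c\tau+d)z,\tau)$ where the permutation
  $\sigma$ is the action of $g$ modulo $2$ on the three characters. Neither the Jacobi triple product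
  nor Poisson summation is needed, and no multiplier systems appear, so that the character in the
  theorem is trivial. Since $f_i = zr_i$, $h_i = r_jr_k/r_i^2$ and $g_i = h_i'/h_i$, all the
  transformation laws become dilations $z \mapsto (c\tau+d)z$ of power series (with an extra factor
  $c\tau+d$ for $g_i$).

  A dilation by $s^2$ acts on a power series of curvatures, which are 2-forms, by multiplying
  the degree $d$ part by $s^d$; the transgressed form contains in addition the 1-form $B$, and its
  degree $4k-1$ part is multiplied by $s^2 s^{4k-2} = (c\tau+d)^{2k}$.

  The forms are holomorphic in $\tau$ because the Taylor coefficients in $z$ of the theta functions are,
  by locally uniform convergence of the products, and because the integrand is a polynomial in $t$:
  the curvature of $(1-t)\nabla_0+t\nabla_1$ is quadratic in $t$.
\<close>

section \<open>Power series whose coefficients depend holomorphically on a parameter\<close>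

text \<open>Up to constants the three transgressed forms are one expression in three series
  \<open>F1\<close>, \<open>F2\<close>, \<open>F3\<close>, symmetric in the last two; they differ
  only in which of the three theta quotients is \<open>F1\<close>. Each of the three subgroups is
  the stabiliser modulo 2 of one of the three characters, so it fixes \<open>F1\<close> and at most
  exchanges \<open>F2\<close> and \<open>F3\<close>; the substitutions -1/\<tau> and \<tau> + 1
  change \<open>F1\<close> and give the second half of the theorem. The multipliers are signs
  because all four theta functions acquire the same exponential factor under v \<mapsto> v + \<tau>,
  which cancels in quotients. Nontriviality of the character is essential: Liouville's theorem alone
  would determine a quotient only up to an additive constant. Since the 1-form B makes the total
  degree odd, the scaling by degree uses a square root s of c\<tau> + d; its choice drops out
  because only s to the power 4k remains. The constants sqrt 2 and sqrt 2 ^ (4k-1) of the L-form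
  multiply to 2 ^ (2k), which is the origin of (2\<tau>) ^ (2k).\<close>

definition holomorphic_fps_on :: "(complex \<Rightarrow> complex fps) \<Rightarrow> complex set \<Rightarrow> bool" where
  "holomorphic_fps_on \<Phi> S \<longleftrightarrow> (\<forall>n. (\<lambda>\<tau>. fps_nth (\<Phi> \<tau>) n) holomorphic_on S)"

lemma holomorphic_fps_onI: "(\<And>n. (\<lambda>\<tau>. fps_nth (\<Phi> \<tau>) n) holomorphic_on S) \<Longrightarrow> holomorphic_fps_on \<Phi> S"
  by (simp add: holomorphic_fps_on_def)

lemma holomorphic_fps_onD: "holomorphic_fps_on \<Phi> S \<Longrightarrow> (\<lambda>\<tau>. fps_nth (\<Phi> \<tau>) n) holomorphic_on S"
  by (simp add: holomorphic_fps_on_def)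

lemma holomorphic_fps_on_cong:
  assumes "\<And>\<tau>. \<tau> \<in> S \<Longrightarrow> \<Phi> \<tau> = \<Psi> \<tau>"
  shows "holomorphic_fps_on \<Phi> S \<longleftrightarrow> holomorphic_fps_on \<Psi> S"
  unfolding holomorphic_fps_on_def using assms by (metis (mono_tags, lifting) holomorphic_cong)

lemma holomorphic_fps_on_constant [simp]: "holomorphic_fps_on (\<lambda>_. F) S"
  by (auto intro!: holomorphic_fps_onI)

lemma holomorphic_fps_on_const:
  assumes "f holomorphic_on S"
  shows "holomorphic_fps_on (\<lambda>\<tau>. fps_const (f \<tau>)) S"
proof (rule holomorphic_fps_onI)
  show "(\<lambda>\<tau>. fps_nth (fps_const (f \<tau>)) n) holomorphic_on S" for n
    using assms by (cases "n = 0") auto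
qed

lemma holomorphic_fps_on_diff:
  "holomorphic_fps_on \<Phi> S \<Longrightarrow> holomorphic_fps_on \<Psi> S \<Longrightarrow> holomorphic_fps_on (\<lambda>\<tau>. \<Phi> \<tau> - \<Psi> \<tau>) S"
  by (auto intro!: holomorphic_fps_onI holomorphic_intros dest: holomorphic_fps_onD)

lemma holomorphic_fps_on_mult:
  "holomorphic_fps_on \<Phi> S \<Longrightarrow> holomorphic_fps_on \<Psi> S \<Longrightarrow> holomorphic_fps_on (\<lambda>\<tau>. \<Phi> \<tau> * \<Psi> \<tau>) S"
  by (auto intro!: holomorphic_fps_onI holomorphic_intros dest: holomorphic_fps_onD simp: fps_mult_nth)

lemma holomorphic_fps_on_prod:
  "(\<And>i. i \<in> I \<Longrightarrow> holomorphic_fps_on (\<Phi> i) S) \<Longrightarrow> holomorphic_fps_on (\<lambda>\<tau>. \<Prod>i\<in>I. \<Phi> i \<tau>) S"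
  by (induction I rule: infinite_finite_induct) (auto intro: holomorphic_fps_on_mult)

lemma holomorphic_fps_on_power: "holomorphic_fps_on \<Phi> S \<Longrightarrow> holomorphic_fps_on (\<lambda>\<tau>. \<Phi> \<tau> ^ n) S"
  by (induction n) (auto intro: holomorphic_fps_on_mult)

lemma holomorphic_fps_on_deriv: "holomorphic_fps_on \<Phi> S \<Longrightarrow> holomorphic_fps_on (\<lambda>\<tau>. fps_deriv (\<Phi> \<tau>)) S"
  by (auto intro!: holomorphic_fps_onI holomorphic_intros dest: holomorphic_fps_onD)

lemma holomorphic_fps_on_shift: "holomorphic_fps_on \<Phi> S \<Longrightarrow> holomorphic_fps_on (\<lambda>\<tau>. fps_shift m (\<Phi> \<tau>)) S"
  by (auto intro!: holomorphic_fps_onI dest: holomorphic_fps_onD)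

text \<open>Coefficient n of a composition is a finite sum over i \<le> n of products of
  coefficients of \<Phi> and of powers of \<Psi>, so no convergence is involved.\<close>

lemma holomorphic_fps_on_compose:
  "holomorphic_fps_on \<Phi> S \<Longrightarrow> holomorphic_fps_on \<Psi> S \<Longrightarrow> holomorphic_fps_on (\<lambda>\<tau>. fps_compose (\<Phi> \<tau>) (\<Psi> \<tau>)) S"
  by (auto intro!: holomorphic_fps_onI holomorphic_intros dest: holomorphic_fps_onD
      simp: fps_compose_nth intro: holomorphic_fps_onD[OF holomorphic_fps_on_power])

text \<open>The coefficients of an inverse satisfy a recursion whose only denominator is the
  constant term; hence the strong induction.\<close>

lemma holomorphic_fps_on_inverse:
  assumes \<Phi>: "holomorphic_fps_on \<Phi> S" and nz: "\<And>\<tau>. \<tau> \<in> S \<Longrightarrow> fps_nth (\<Phi> \<tau>) 0 \<noteq> 0"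
  shows "holomorphic_fps_on (\<lambda>\<tau>. inverse (\<Phi> \<tau>)) S"
proof (rule holomorphic_fps_onI)
  fix n
  show "(\<lambda>\<tau>. fps_nth (inverse (\<Phi> \<tau>)) n) holomorphic_on S"
  proof (induction n rule: less_induct)
    case (less n)
    have "(\<lambda>\<tau>. if n = 0 then inverse (fps_nth (\<Phi> \<tau>) 0) else
        - inverse (fps_nth (\<Phi> \<tau>) 0) * (\<Sum>i = 1..n. fps_nth (\<Phi> \<tau>) i * fps_nth (inverse (\<Phi> \<tau>)) (n - i)))
        holomorphic_on S"
      using holomorphic_fps_onD[OF \<Phi>] less nz by (cases "n = 0") (auto intro!: holomorphic_intros)
    also have "?this \<longleftrightarrow> ?case"
      by (cases n) (auto intro!: holomorphic_cong simp: fps_inverse_def fps_nth_Abs_fps nz)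
    finally show ?case .
  qed
qed

section \<open>The infinite product $\prod_{j\ge0}(1 - xq^j)$\<close>

definition qpochhammer :: "complex \<Rightarrow> complex \<Rightarrow> complex" where
  "qpochhammer x q = (\<Prod>j. 1 - x * q ^ j)"

lemma convergent_prod_qpochhammer:
  fixes x q :: complex
  assumes "norm q < 1"
  shows "convergent_prod (\<lambda>j. 1 - x * q ^ j)"
proof -
  have "summable (\<lambda>j. norm (1 - x * q ^ j - 1))"
    using assms by (simp add: norm_mult norm_power summable_mult summable_geometric)
  then show ?thesis
    by (intro abs_convergent_prod_imp_convergent_prod summable_imp_abs_convergent_prod)
qed

lemma qpochhammer_eq:
  assumes "norm q < 1"
  shows "qpochhammer x q = (1 - x) * qpochhammer (x * q) q"
\<comment> \<open>Splitting off the head divides by its value 1 - x, so x = 1 is separate; both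
  sides are then 0.\<close>
proof (cases "x = 1")
  case True
  have "(\<Prod>j. 1 - x * q ^ j) = 0"
    by (rule has_prod_zeroI[OF convergent_prod_has_prod, of _ 0])
       (use convergent_prod_qpochhammer[OF assms, of x] True in auto)
  with True show ?thesis
    by (simp add: qpochhammer_def)
next
  case False
  with prodinf_split_head[OF convergent_prod_qpochhammer[OF assms, of x]] show ?thesis
    by (simp add: qpochhammer_def mult_ac)
qed

lemma qpochhammer_nonzero:
  assumes "norm q < 1" "\<And>j. x * q ^ j \<noteq> 1"
  shows "qpochhammer x q \<noteq> 0"
  unfolding qpochhammer_def
  by (rule prodinf_nonzero[OF convergent_prod_qpochhammer[OF assms(1)]]) (use assms(2) in auto)

text \<open>M-test with the bound max |x| * (max |q|) ^ n, both maxima being attained on K. The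
  parameter space is general so that s can be \<tau> alone or a pair (\<tau>, z).\<close>

lemma uniform_limit_qpochhammer:
  fixes x q :: "'a::topological_space \<Rightarrow> complex"
  assumes K: "compact K" and x: "continuous_on K x" and q: "continuous_on K q"
    and less: "\<And>s. s \<in> K \<Longrightarrow> norm (q s) < 1"
  shows "uniform_limit K (\<lambda>N s. \<Prod>j<N. 1 - x s * q s ^ j) (\<lambda>s. qpochhammer (x s) (q s)) sequentially"
proof -
  have "uniformly_convergent_on K (\<lambda>N s. \<Sum>n<N. norm (- (x s * q s ^ n)))"
  proof (cases "K = {}")
    case False
    obtain s0 where s0: "s0 \<in> K" "\<And>s. s \<in> K \<Longrightarrow> norm (q s) \<le> norm (q s0)"
      using continuous_attains_sup[OF K False, of "\<lambda>s. norm (q s)"] q by (auto intro: continuous_intros)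
    obtain s1 where s1: "s1 \<in> K" "\<And>s. s \<in> K \<Longrightarrow> norm (x s) \<le> norm (x s1)"
      using continuous_attains_sup[OF K False, of "\<lambda>s. norm (x s)"] x by (auto intro: continuous_intros)
    show ?thesis
    proof (rule uniformly_convergentI, rule Weierstrass_m_test_ev)
      show "\<forall>\<^sub>F n in sequentially. \<forall>s\<in>K. norm (norm (- (x s * q s ^ n))) \<le> norm (x s1) * norm (q s0) ^ n"
        by (auto simp: norm_mult norm_power intro!: mult_mono power_mono s0 s1 always_eventually)
      show "summable (\<lambda>n. norm (x s1) * norm (q s0) ^ n)"
        using less[OF s0(1)] by (intro summable_mult summable_geometric) auto
    qed
  qed auto
  then have "uniformly_convergent_on K (\<lambda>N s. \<Prod>n<N. 1 + - (x s * q s ^ n))"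
    by (intro Infinite_Products.uniformly_convergent_on_prod K) (auto intro!: continuous_intros x q)
  then obtain L where L: "uniform_limit K (\<lambda>N s. \<Prod>j<N. 1 - x s * q s ^ j) L sequentially"
    by (auto simp: uniformly_convergent_on_def)
  have "L s = qpochhammer (x s) (q s)" if "s \<in> K" for s
    using tendsto_uniform_limitI[OF L that]
      convergent_prod_LIMSEQ[OF convergent_prod_qpochhammer[OF less[OF that], of "x s"]]
    by (metis LIMSEQ_lessThan_iff_atMost LIMSEQ_unique qpochhammer_def)
  with L show ?thesis
    by (simp cong: uniform_limit_cong')
qed

section \<open>Holomorphic dependence of the product and of its Taylor coefficients on
  parameters\<close>

lemma holomorphic_on_qpochhammer [holomorphic_intros]:
  assumes x: "x holomorphic_on S" and q: "q holomorphic_on S" and S: "open S"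
    and less: "\<And>s. s \<in> S \<Longrightarrow> norm (q s) < 1"
  shows "(\<lambda>s. qpochhammer (x s) (q s)) holomorphic_on S"
proof (rule holomorphic_uniform_sequence[OF S])
  show "(\<lambda>s. \<Prod>j<N. 1 - x s * q s ^ j) holomorphic_on S" for N
    using x q by (auto intro!: holomorphic_intros)
  fix s assume "s \<in> S"
  then obtain d where d: "d > 0" "cball s d \<subseteq> S"
    using S open_contains_cball by blast
  have "continuous_on (cball s d) x" "continuous_on (cball s d) q"
    using holomorphic_on_imp_continuous_on[OF x] holomorphic_on_imp_continuous_on[OF q] d
    by (auto intro: continuous_on_subset)
  with d less show "\<exists>d>0. cball s d \<subseteq> S \<and>
      uniform_limit (cball s d) (\<lambda>N s. \<Prod>j<N. 1 - x s * q s ^ j) (\<lambda>s. qpochhammer (x s) (q s)) sequentially"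
    by (intro exI[of _ d] conjI uniform_limit_qpochhammer) auto
qed

lemma holomorphic_on_qpochhammer_exp:
  "norm q < 1 \<Longrightarrow> (\<lambda>z. qpochhammer (b * exp (c * z)) q) holomorphic_on A"
  by (rule holomorphic_on_subset[of _ UNIV]) (auto intro!: holomorphic_intros)

lemma has_fps_expansion_qpochhammer_exp:
  assumes "norm q < 1"
  shows "(\<lambda>z. qpochhammer (b * exp (c * z)) q) has_fps_expansion
           fps_expansion (\<lambda>z. qpochhammer (b * exp (c * z)) q) 0"
  by (rule has_fps_expansion_fps_expansion[of UNIV]) (auto intro: holomorphic_on_qpochhammer_exp assms)

text \<open>The partial products have coefficients that are visibly holomorphic in \<tau>. Cauchy's
  inequality on the unit circle in z turns their uniform convergence into uniform convergence of
  each Taylor coefficient, locally in \<tau>.\<close>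

lemma holomorphic_fps_on_qpochhammer_exp:
  assumes b: "b holomorphic_on S" and q: "q holomorphic_on S" and S: "open S"
    and less: "\<And>\<tau>. \<tau> \<in> S \<Longrightarrow> norm (q \<tau>) < 1"
  shows "holomorphic_fps_on (\<lambda>\<tau>. fps_expansion (\<lambda>z. qpochhammer (b \<tau> * exp (c * z)) (q \<tau>)) 0) S"
proof (rule holomorphic_fps_onI)
  fix n
  define P where "P = (\<lambda>N \<tau> z. \<Prod>j<N. 1 - b \<tau> * exp (c * z) * q \<tau> ^ j)"
  define Q where "Q = (\<lambda>\<tau> z. qpochhammer (b \<tau> * exp (c * z)) (q \<tau>))"
  define \<Psi> where "\<Psi> = (\<lambda>N \<tau>. \<Prod>j<N. 1 - fps_const (b \<tau> * q \<tau> ^ j) * fps_exp c)"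
  have holP: "P N \<tau> holomorphic_on A" for N \<tau> A
    unfolding P_def by (intro holomorphic_intros)
  have holQ: "Q \<tau> holomorphic_on A" if "\<tau> \<in> S" for \<tau> A
    unfolding Q_def by (rule holomorphic_on_qpochhammer_exp) (use less that in auto)
  have P: "P N \<tau> has_fps_expansion \<Psi> N \<tau>" for N \<tau>
  proof -
    have "(\<lambda>z. \<Prod>j<N. 1 - (b \<tau> * q \<tau> ^ j) * exp (c * z)) has_fps_expansion \<Psi> N \<tau>"
      unfolding \<Psi>_def by (intro fps_expansion_intros)
    then show ?thesis
      by (simp add: P_def mult_ac)
  qed
  have "(\<lambda>\<tau>. (deriv ^^ n) (Q \<tau>) 0 / fact n) holomorphic_on S"
  proof (rule holomorphic_uniform_sequence[OF S])
    show "(\<lambda>\<tau>. fps_nth (\<Psi> N \<tau>) n) holomorphic_on S" for N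
      unfolding \<Psi>_def using b q
      by (intro holomorphic_fps_onD holomorphic_fps_on_prod holomorphic_fps_on_diff
          holomorphic_fps_on_mult holomorphic_fps_on_const holomorphic_intros) auto
    fix s assume "s \<in> S"
    then obtain d where d: "d > 0" "cball s d \<subseteq> S"
      using S open_contains_cball by blast
    have cont: "continuous_on (cball s d) b" "continuous_on (cball s d) q"
      using holomorphic_on_imp_continuous_on[OF b] holomorphic_on_imp_continuous_on[OF q] d
      by (auto intro: continuous_on_subset)
    \<comment> \<open>Uniformity jointly in \<tau> and z: one N must serve the Cauchy estimate for
      every \<tau> in the disc.\<close>
    have ul: "uniform_limit (cball s d \<times> cball 0 1) (\<lambda>N (\<tau>, z). P N \<tau> z) (\<lambda>(\<tau>, z). Q \<tau> z) sequentially"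
      unfolding P_def Q_def split_beta
      by (rule uniform_limit_qpochhammer)
         (use d less in \<open>auto intro!: continuous_intros compact_Times
            continuous_on_compose2[OF cont(1)] continuous_on_compose2[OF cont(2)]\<close>)
    have "uniform_limit (cball s d) (\<lambda>N \<tau>. fps_nth (\<Psi> N \<tau>) n) (\<lambda>\<tau>. (deriv ^^ n) (Q \<tau>) 0 / fact n) sequentially"
    proof (rule uniform_limitI)
      fix e :: real assume "e > 0"
      show "\<forall>\<^sub>F N in sequentially. \<forall>\<tau>\<in>cball s d. dist (fps_nth (\<Psi> N \<tau>) n) ((deriv ^^ n) (Q \<tau>) 0 / fact n) < e"
        \<comment> \<open>Half of e, because Cauchy's inequality returns a non-strict
          estimate.\<close>
        using uniform_limitD[OF ul half_gt_zero[OF \<open>e > 0\<close>]]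
      proof eventually_elim
        case (elim N)
        show ?case
        proof
          fix \<tau> assume \<tau>: "\<tau> \<in> cball s d"
          then have "\<tau> \<in> S"
            using d by auto
          have "norm ((deriv ^^ n) (\<lambda>z. P N \<tau> z - Q \<tau> z) 0) \<le> fact n * (e / 2) / 1 ^ n"
          proof (rule Cauchy_inequality)
            show "continuous_on (cball 0 1) (\<lambda>z. P N \<tau> z - Q \<tau> z)"
              using holP holQ[OF \<open>\<tau> \<in> S\<close>] by (intro continuous_intros holomorphic_on_imp_continuous_on)
            show "norm (P N \<tau> z - Q \<tau> z) \<le> e / 2" if "norm (0 - z) = 1" for z
              using bspec[OF elim, of "(\<tau>, z)"] \<tau> that by (simp add: dist_norm)
          qed (use holP holQ[OF \<open>\<tau> \<in> S\<close>] in \<open>auto intro: holomorphic_intros\<close>)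
          also have "(deriv ^^ n) (\<lambda>z. P N \<tau> z - Q \<tau> z) 0 = (deriv ^^ n) (P N \<tau>) 0 - (deriv ^^ n) (Q \<tau>) 0"
            using holP holQ[OF \<open>\<tau> \<in> S\<close>] by (intro higher_deriv_diff[of _ UNIV]) auto
          also have "(deriv ^^ n) (P N \<tau>) 0 = fact n * fps_nth (\<Psi> N \<tau>) n"
            using fps_nth_fps_expansion[OF P] by simp
          finally have "norm (fact n * fps_nth (\<Psi> N \<tau>) n - (deriv ^^ n) (Q \<tau>) 0) \<le> fact n * (e / 2)"
            by simp
          moreover have "fps_nth (\<Psi> N \<tau>) n - (deriv ^^ n) (Q \<tau>) 0 / fact n
              = (fact n * fps_nth (\<Psi> N \<tau>) n - (deriv ^^ n) (Q \<tau>) 0) / fact n"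
            by (simp add: field_simps)
          ultimately have "dist (fps_nth (\<Psi> N \<tau>) n) ((deriv ^^ n) (Q \<tau>) 0 / fact n) \<le> e / 2"
            by (simp add: dist_norm norm_divide field_simps)
          with \<open>e > 0\<close> show "dist (fps_nth (\<Psi> N \<tau>) n) ((deriv ^^ n) (Q \<tau>) 0 / fact n) < e"
            by simp
        qed
      qed
    qed
    with d show "\<exists>d>0. cball s d \<subseteq> S \<and> uniform_limit (cball s d) (\<lambda>N \<tau>. fps_nth (\<Psi> N \<tau>) n)
        (\<lambda>\<tau>. (deriv ^^ n) (Q \<tau>) 0 / fact n) sequentially"
      by blast
  qed
  then show "(\<lambda>\<tau>. fps_nth (fps_expansion (\<lambda>z. qpochhammer (b \<tau> * exp (c * z)) (q \<tau>)) 0) n) holomorphic_on S"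
    by (simp add: fps_expansion_def Q_def)
qed

section \<open>Quasi-periodicity and zeros of the theta functions\<close>

lemma qpow_add: "qpow \<tau> (a + b) = qpow \<tau> a * qpow \<tau> b"
  by (simp add: qpow_def algebra_simps flip: exp_add)

lemma qpow_nonzero [simp]: "qpow \<tau> a \<noteq> 0"
  by (simp add: qpow_def)

lemma qpow_of_nat: "qpow \<tau> (of_nat n) = qpow \<tau> 1 ^ n"
  by (simp add: qpow_def mult_ac flip: exp_of_nat_mult)

lemma qpow_half_squared: "qpow \<tau> (1/2) * qpow \<tau> (1/2) = qpow \<tau> 1"
  by (simp flip: qpow_add)

lemma norm_qpow_less_1: "\<tau> \<in> upper_half_plane \<Longrightarrow> a > 0 \<Longrightarrow> norm (qpow \<tau> a) < 1"
  by (simp add: qpow_def upper_half_plane_def)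

lemma open_upper_half_plane: "open upper_half_plane"
  unfolding upper_half_plane_def by (rule open_halfspace_Im_gt)

text \<open>The product side of Jacobi's triple product. With nome q the four theta functions are,
  up to a trigonometric prefactor, the cases b = q, -q, q^(1/2), -q^(1/2).\<close>

definition triple_product :: "complex \<Rightarrow> complex \<Rightarrow> complex \<Rightarrow> complex" where
  "triple_product b q v = qpochhammer q q * qpochhammer (b * exp (2 * of_real pi * \<i> * v)) q *
     qpochhammer (b * exp (- (2 * of_real pi * \<i>) * v)) q"

lemma prodinf_triple_product:
  assumes "norm q < 1"
  shows "(\<Prod>j. (1 - q * q ^ j) * (1 - exp (2 * of_real pi * \<i> * v) * (b * q ^ j))
                * (1 - exp (- (2 * of_real pi * \<i> * v)) * (b * q ^ j))) = triple_product b q v"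
proof -
  note conv = convergent_prod_qpochhammer[OF assms]
  have "triple_product b q v = (\<Prod>j. (1 - q * q ^ j) * (1 - b * exp (2 * of_real pi * \<i> * v) * q ^ j)
                * (1 - b * exp (- (2 * of_real pi * \<i>) * v) * q ^ j))"
    unfolding triple_product_def qpochhammer_def
    by (simp add: prodinf_mult convergent_prod_mult conv)
  then show ?thesis
    by (simp add: mult_ac)
qed

lemma triple_product_add_1: "triple_product b q (v + 1) = triple_product b q v"
proof -
  have "exp (2 * of_real pi * \<i> * (v + 1)) = exp (2 * of_real pi * \<i> * v)"
    using exp_integer_2pi[of 1] by (simp add: distrib_left exp_add mult_ac)
  moreover have "exp (- (2 * of_real pi * \<i>) * (v + 1)) = exp (- (2 * of_real pi * \<i>) * v)"
    using calculation by (simp add: exp_minus)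
  ultimately show ?thesis
    by (simp add: triple_product_def)
qed

text \<open>Adding \<tau> multiplies exp (2 pi i v) by q, so one Pochhammer factor moves one step
  forward and the other one step back, gaining the factor with c = b/q. The first is left in shifted
  form: the factor it has lost is compared with the gained one in the two lemmas below.\<close>

lemma triple_product_add_tau:
  assumes "norm (qpow \<tau> 1) < 1" and c: "c * qpow \<tau> 1 = b"
  shows "triple_product b (qpow \<tau> 1) (v + \<tau>) =
     qpochhammer (qpow \<tau> 1) (qpow \<tau> 1) * qpochhammer (b * exp (2 * of_real pi * \<i> * v) * qpow \<tau> 1) (qpow \<tau> 1) *
     ((1 - c * exp (- (2 * of_real pi * \<i>) * v)) * qpochhammer (b * exp (- (2 * of_real pi * \<i>) * v)) (qpow \<tau> 1))"
proof -
  have 1: "exp (2 * of_real pi * \<i> * (v + \<tau>)) = exp (2 * of_real pi * \<i> * v) * qpow \<tau> 1"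
    by (simp add: qpow_def distrib_left exp_add)
  have 2: "b * exp (- (2 * of_real pi * \<i>) * (v + \<tau>)) = c * exp (- (2 * of_real pi * \<i>) * v)"
    by (simp add: c[symmetric] qpow_def distrib_left exp_add exp_diff exp_minus field_simps)
  show ?thesis
    unfolding triple_product_def 1 2
    using qpochhammer_eq[OF assms(1), of "c * exp (- (2 * of_real pi * \<i>) * v)"]
    by (simp add: c[symmetric] mult_ac)
qed

text \<open>When b * b = q, the gained factor has c = 1/b and is a multiple of the lost factor 1 - b
  exp (2 pi i v).\<close>

lemma triple_product_half_add_tau:
  assumes q: "norm (qpow \<tau> 1) < 1" and b: "b * b = qpow \<tau> 1"
  shows "triple_product b (qpow \<tau> 1) (v + \<tau>)
           = - (exp (- (2 * of_real pi * \<i>) * v) / b) * triple_product b (qpow \<tau> 1) v"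
proof -
  have [simp]: "b \<noteq> 0"
    using b by (metis mult_zero_left qpow_nonzero)
  have "1 - (1 / b) * exp (- (2 * of_real pi * \<i>) * v)
      = - (exp (- (2 * of_real pi * \<i>) * v) / b) * (1 - b * exp (2 * of_real pi * \<i> * v))"
    by (simp add: exp_minus field_simps)
  moreover have "qpochhammer (b * exp (2 * of_real pi * \<i> * v)) (qpow \<tau> 1)
      = (1 - b * exp (2 * of_real pi * \<i> * v)) *
        qpochhammer (b * exp (2 * of_real pi * \<i> * v) * qpow \<tau> 1) (qpow \<tau> 1)"
    by (rule qpochhammer_eq[OF q])
  moreover have "1 / b * qpow \<tau> 1 = b"
    by (simp add: b[symmetric])
  ultimately show ?thesis
    unfolding triple_product_def[of b _ v]
    by (subst triple_product_add_tau[OF q, of "1 / b"]) (simp_all only: mult_ac)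
qed

text \<open>For b = \<plusminus>q the gained and lost factors are not proportional; the
  trigonometric prefactor makes up the difference. Its shifted value is a multiple of the lost
  factor, and the gained factor is a multiple of its unshifted value. The sign e = 1 gives 2i sin
  (pi v), e = -1 gives 2 cos (pi v).\<close>

lemma triple_product_sin_add_tau:
  assumes q: "norm (qpow \<tau> 1) < 1" and e: "e * e = 1"
  shows "(exp (of_real pi * \<i> * (v + \<tau>)) - e * exp (- (of_real pi * \<i> * (v + \<tau>)))) *
           triple_product (e * qpow \<tau> 1) (qpow \<tau> 1) (v + \<tau>)
       = - (e * exp (- (2 * of_real pi * \<i>) * v) / qpow \<tau> (1/2)) *
         ((exp (of_real pi * \<i> * v) - e * exp (- (of_real pi * \<i> * v))) *
           triple_product (e * qpow \<tau> 1) (qpow \<tau> 1) v)"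
proof -
  define u p where "u = exp (of_real pi * \<i> * v)" and "p = qpow \<tau> (1/2)"
  have [simp]: "u \<noteq> 0" "p \<noteq> 0"
    by (auto simp: u_def p_def)
  have w: "exp (2 * of_real pi * \<i> * v) = u * u" "exp (- (2 * of_real pi * \<i>) * v) = 1 / (u * u)"
    "exp (- (of_real pi * \<i> * v)) = 1 / u"
    by (simp_all add: u_def exp_minus field_simps flip: exp_add)
  have up: "exp (of_real pi * \<i> * (v + \<tau>)) = u * p" "exp (- (of_real pi * \<i> * (v + \<tau>))) = 1 / (u * p)"
    by (simp_all add: u_def p_def qpow_def distrib_left exp_diff exp_minus exp_add field_simps)
  have p: "qpow \<tau> 1 = p * p"
    by (simp add: p_def qpow_half_squared)
  have 1: "u * p - e * (1 / (u * p)) = - (e / (u * p)) * (1 - e * (p * p) * (u * u))"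
    using e by (simp add: field_simps)
  have 2: "qpochhammer (e * (p * p) * (u * u)) (p * p)
      = (1 - e * (p * p) * (u * u)) * qpochhammer (e * (p * p) * (u * u) * (p * p)) (p * p)"
    using qpochhammer_eq[OF q] unfolding p .
  have 3: "1 - e * (1 / (u * u)) = (u - e * (1 / u)) / u"
    by (simp add: field_simps)
  show ?thesis
    unfolding up triple_product_add_tau[OF q refl] w unfolding p triple_product_def w p_def[symmetric] u_def[symmetric]
    by (simp only: 1 2 3) (simp add: field_simps)
qed

section \<open>The four theta functions at a fixed \<tau>: periods, holomorphy, values at 0\<close>

context
  fixes \<tau> :: complex
  assumes \<tau>: "\<tau> \<in> upper_half_plane"
begin

lemma norm_q_less_1: "norm (qpow \<tau> 1) < 1"
  using norm_qpow_less_1[OF \<tau>, of 1] by simp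

lemma qpow_Suc: "qpow \<tau> (Suc j) = qpow \<tau> 1 * qpow \<tau> 1 ^ j"
  by (simp only: qpow_of_nat power_Suc)

lemma qpow_Suc_minus_half: "qpow \<tau> (Suc j - 1/2) = qpow \<tau> (1/2) * qpow \<tau> 1 ^ j"
  using qpow_add[of \<tau> "1/2" "of_nat j"] by (simp add: qpow_of_nat algebra_simps)

lemma theta_eq:
  "theta v \<tau> = 2 * qpow \<tau> (1/8) * sin (of_real pi * v) * triple_product (qpow \<tau> 1) (qpow \<tau> 1) v"
  unfolding theta_def prodinf_triple_product[OF norm_q_less_1, symmetric]
  by (simp only: qpow_Suc)

lemma theta1_eq:
  "theta1 v \<tau> = 2 * qpow \<tau> (1/8) * cos (of_real pi * v) * triple_product (- qpow \<tau> 1) (qpow \<tau> 1) v"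
  unfolding theta1_def prodinf_triple_product[OF norm_q_less_1, symmetric]
  by (simp only: qpow_Suc mult_minus_left mult_minus_right diff_minus_eq_add)

lemma theta2_eq: "theta2 v \<tau> = triple_product (qpow \<tau> (1/2)) (qpow \<tau> 1) v"
  unfolding theta2_def prodinf_triple_product[OF norm_q_less_1, symmetric]
  by (simp only: qpow_Suc qpow_Suc_minus_half)

lemma theta3_eq: "theta3 v \<tau> = triple_product (- qpow \<tau> (1/2)) (qpow \<tau> 1) v"
  unfolding theta3_def prodinf_triple_product[OF norm_q_less_1, symmetric]
  by (simp only: qpow_Suc qpow_Suc_minus_half mult_minus_left mult_minus_right diff_minus_eq_add)

lemma theta_add_1: "theta (v + 1) \<tau> = - theta v \<tau>"
  and theta1_add_1: "theta1 (v + 1) \<tau> = - theta1 v \<tau>"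
  and theta2_add_1: "theta2 (v + 1) \<tau> = theta2 v \<tau>"
  and theta3_add_1: "theta3 (v + 1) \<tau> = theta3 v \<tau>"
  by (simp_all add: theta_eq theta1_eq theta2_eq theta3_eq triple_product_add_1 distrib_left sin_add cos_add
      flip: sin_of_real cos_of_real)

lemma theta_add_tau:
    "theta (v + \<tau>) \<tau> = - (exp (- (2 * of_real pi * \<i>) * v) / qpow \<tau> (1/2)) * theta v \<tau>"
  using arg_cong[OF triple_product_sin_add_tau[OF norm_q_less_1, of 1 v],
      where f = "\<lambda>x. qpow \<tau> (1/8) / \<i> * x"]
  by (simp add: theta_eq sin_exp_eq mult_ac)

lemma theta1_add_tau:
    "theta1 (v + \<tau>) \<tau> = exp (- (2 * of_real pi * \<i>) * v) / qpow \<tau> (1/2) * theta1 v \<tau>"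
  using arg_cong[OF triple_product_sin_add_tau[OF norm_q_less_1, of "-1" v],
      where f = "\<lambda>x. qpow \<tau> (1/8) * x"]
  by (simp add: theta1_eq cos_exp_eq mult_ac)

lemma theta2_add_tau:
    "theta2 (v + \<tau>) \<tau> = - (exp (- (2 * of_real pi * \<i>) * v) / qpow \<tau> (1/2)) * theta2 v \<tau>"
  unfolding theta2_eq by (rule triple_product_half_add_tau[OF norm_q_less_1]) (rule qpow_half_squared)

lemma theta3_add_tau:
    "theta3 (v + \<tau>) \<tau> = exp (- (2 * of_real pi * \<i>) * v) / qpow \<tau> (1/2) * theta3 v \<tau>"
  using triple_product_half_add_tau[OF norm_q_less_1, of "- qpow \<tau> (1/2)" v]
  by (simp add: theta3_eq qpow_half_squared)

lemma holomorphic_on_triple_product: "(\<lambda>v. triple_product b (qpow \<tau> 1) v) holomorphic_on A"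
  unfolding triple_product_def
  by (intro holomorphic_intros holomorphic_on_qpochhammer_exp norm_q_less_1)

lemma holomorphic_on_theta: "(\<lambda>v. theta v \<tau>) holomorphic_on A"
  and holomorphic_on_theta1: "(\<lambda>v. theta1 v \<tau>) holomorphic_on A"
  and holomorphic_on_theta2: "(\<lambda>v. theta2 v \<tau>) holomorphic_on A"
  and holomorphic_on_theta3: "(\<lambda>v. theta3 v \<tau>) holomorphic_on A"
  unfolding theta_eq theta1_eq theta2_eq theta3_eq
  by (intro holomorphic_intros holomorphic_on_triple_product)+

lemma triple_product_0_nonzero:
  assumes "norm b < 1"
  shows "triple_product b (qpow \<tau> 1) 0 \<noteq> 0"
proof -
  have "qpochhammer x (qpow \<tau> 1) \<noteq> 0" if "norm x < 1" for x
  proof (rule qpochhammer_nonzero[OF norm_q_less_1])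
    fix j
    have "norm (x * qpow \<tau> 1 ^ j) \<le> norm x * 1"
      unfolding norm_mult norm_power using norm_q_less_1
      by (intro mult_left_mono power_le_one) auto
    with that show "x * qpow \<tau> 1 ^ j \<noteq> 1"
      by auto
  qed
  with assms norm_q_less_1 show ?thesis
    by (simp add: triple_product_def)
qed

lemma theta1_0_nonzero: "theta1 0 \<tau> \<noteq> 0"
  and theta2_0_nonzero: "theta2 0 \<tau> \<noteq> 0"
  and theta3_0_nonzero: "theta3 0 \<tau> \<noteq> 0"
  using norm_qpow_less_1[OF \<tau>, of 1] norm_qpow_less_1[OF \<tau>, of "1/2"]
  by (simp_all add: theta1_eq theta2_eq theta3_eq triple_product_0_nonzero)

lemma theta_0 [simp]: "theta 0 \<tau> = 0"
  by (simp add: theta_def)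

lemma has_field_derivative_theta_0: "((\<lambda>v. theta v \<tau>) has_field_derivative dv theta 0 \<tau>) (at 0)"
  unfolding dv_def by (rule holomorphic_derivI[OF holomorphic_on_theta[of UNIV]]) auto

text \<open>Only the sine vanishes at 0, so the product rule leaves pi times the remaining factors,
  none of which is 0.\<close>

lemma dv_theta_0_nonzero: "dv theta 0 \<tau> \<noteq> 0"
proof -
  have "((\<lambda>v. triple_product (qpow \<tau> 1) (qpow \<tau> 1) v) has_field_derivative
      deriv (\<lambda>v. triple_product (qpow \<tau> 1) (qpow \<tau> 1) v) 0) (at 0)"
    by (rule holomorphic_derivI[OF holomorphic_on_triple_product[of _ UNIV]]) auto
  then have "((\<lambda>v. theta v \<tau>) has_field_derivative
      2 * qpow \<tau> (1/8) * of_real pi * triple_product (qpow \<tau> 1) (qpow \<tau> 1) 0) (at 0)"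
    unfolding theta_eq by (auto intro!: derivative_eq_intros)
  then have "dv theta 0 \<tau> = 2 * qpow \<tau> (1/8) * of_real pi * triple_product (qpow \<tau> 1) (qpow \<tau> 1) 0"
    using has_field_derivative_theta_0 DERIV_unique by blast
  then show ?thesis
    using triple_product_0_nonzero[OF norm_q_less_1] by simp
qed

end

section \<open>Elliptic functions of the second kind with a simple pole\<close>

definition lattice :: "complex \<Rightarrow> complex set" where
  "lattice \<tau> = {of_int m + of_int n * \<tau> | m n. True}"

lemma lattice_add: "x \<in> lattice \<tau> \<Longrightarrow> y \<in> lattice \<tau> \<Longrightarrow> x + y \<in> lattice \<tau>"
  unfolding lattice_def
  by clarify (metis (no_types, opaque_lifting) add.assoc add.left_commute distrib_right of_int_add)

lemma lattice_diff: "x \<in> lattice \<tau> \<Longrightarrow> y \<in> lattice \<tau> \<Longrightarrow> x - y \<in> lattice \<tau>"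
  unfolding lattice_def
  by clarify (metis (no_types, opaque_lifting) add_diff_add left_diff_distrib of_int_diff)

lemma zero_in_lattice [simp]: "0 \<in> lattice \<tau>"
  unfolding lattice_def by (auto intro!: exI[of _ 0])

lemma lattice_uniformly_discrete:
  assumes "\<tau> \<in> upper_half_plane"
  obtains d where "d > 0" "\<And>x y. x \<in> lattice \<tau> \<Longrightarrow> y \<in> lattice \<tau> \<Longrightarrow> dist y x < d \<Longrightarrow> y = x"
proof
  have \<tau>: "Im \<tau> > 0"
    using assms by (simp add: upper_half_plane_def)
  \<comment> \<open>A lattice point of norm below Im \<tau> is an integer m, and then norm below 1
    forces m = 0.\<close>
  then show "min 1 (Im \<tau>) > 0"
    by simp
  have *: "z = 0" if z_in: "z \<in> lattice \<tau>" and less: "norm z < min 1 (Im \<tau>)" for z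
  proof -
    obtain m n where z: "z = of_int m + of_int n * \<tau>"
      using z_in unfolding lattice_def by blast
    have "\<bar>of_int n * Im \<tau>\<bar> < Im \<tau>"
      using abs_Im_le_cmod[of z] less by (simp add: z)
    then have "\<bar>real_of_int n\<bar> < 1"
      using \<tau> by (simp add: abs_mult)
    then have n: "n = 0"
      by linarith
    have "\<bar>real_of_int m\<bar> < 1"
      using less by (simp add: z n)
    then show ?thesis
      using n by (simp add: z)
  qed
  show "y = x" if "x \<in> lattice \<tau>" "y \<in> lattice \<tau>" "dist y x < min 1 (Im \<tau>)" for x y
    using *[OF lattice_diff[OF that(2,1)]] that(3) by (simp add: dist_norm)
qed

lemma open_Compl_lattice:
  assumes "\<tau> \<in> upper_half_plane"
  shows "open (- lattice \<tau>)"
  using lattice_uniformly_discrete[OF assms] discrete_imp_closed by (metis open_Compl)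

text \<open>A zero needs exp (2 pi i (v + n\<tau>)) = 1 for some integer n: the sine accounts for n
  = 0, the two Pochhammer factors for n > 0 and n < 0.\<close>

lemma theta_nonzero:
  assumes \<tau>: "\<tau> \<in> upper_half_plane" and v: "v \<notin> lattice \<tau>"
  shows "theta v \<tau> \<noteq> 0"
proof -
  have *: "exp (2 * of_real pi * \<i> * (v + of_int n * \<tau>)) \<noteq> 1" for n
  proof
    assume "exp (2 * of_real pi * \<i> * (v + of_int n * \<tau>)) = 1"
    then obtain k :: int where "2 * of_real pi * \<i> * (v + of_int n * \<tau>) = of_int (2 * k) * of_real pi * \<i>"
      using exp_eq[of "2 * of_real pi * \<i> * (v + of_int n * \<tau>)" 0] by auto
    then have "v + of_int n * \<tau> = of_int k"
      by simp
    then have "v = of_int k + of_int (- n) * \<tau>"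
      by (simp add: algebra_simps)
    with v show False
      unfolding lattice_def by blast
  qed
  have **: "exp (- (2 * of_real pi * \<i>) * (v + of_int n * \<tau>)) \<noteq> 1" for n
    using *[of n] by (simp add: exp_minus)
  have "sin (of_real pi * v) \<noteq> 0"
  proof
    assume "sin (of_real pi * v) = 0"
    then obtain n :: int where "v = of_int n + of_int 0 * \<tau>"
      by (auto simp: sin_eq_0)
    with v show False
      unfolding lattice_def by blast
  qed
  moreover have "qpochhammer (qpow \<tau> 1 * exp (2 * of_real pi * \<i> * v)) (qpow \<tau> 1) \<noteq> 0"
  proof (rule qpochhammer_nonzero[OF norm_q_less_1[OF \<tau>]])
    show "qpow \<tau> 1 * exp (2 * of_real pi * \<i> * v) * qpow \<tau> 1 ^ j \<noteq> 1" for j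
      using *[of "int j + 1"]
      by (simp add: qpow_def algebra_simps flip: exp_of_nat_mult exp_add)
  qed
  moreover have "qpochhammer (qpow \<tau> 1 * exp (- (2 * of_real pi * \<i>) * v)) (qpow \<tau> 1) \<noteq> 0"
  proof (rule qpochhammer_nonzero[OF norm_q_less_1[OF \<tau>]])
    show "qpow \<tau> 1 * exp (- (2 * of_real pi * \<i>) * v) * qpow \<tau> 1 ^ j \<noteq> 1" for j
      using **[of "- int j - 1"]
      by (simp add: qpow_def algebra_simps flip: exp_of_nat_mult exp_add)
  qed
  moreover have "qpochhammer (qpow \<tau> 1) (qpow \<tau> 1) \<noteq> 0"
    using triple_product_0_nonzero[OF \<tau> norm_q_less_1[OF \<tau>]] by (auto simp: triple_product_def)
  ultimately show ?thesis
    by (simp add: theta_eq[OF \<tau>] triple_product_def)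
qed

text \<open>The limit says simple pole of residue 1 at 0; the multipliers carry it to the other
  lattice points. The functional equations are required at lattice points too, where a theta
  quotient has the value 0 by division by zero.\<close>

definition simple_elliptic ::
    "complex \<Rightarrow> complex \<Rightarrow> complex \<Rightarrow> (complex \<Rightarrow> complex) \<Rightarrow> bool" where
  "simple_elliptic \<tau> \<alpha> \<beta> F \<longleftrightarrow> F holomorphic_on - lattice \<tau> \<and>
     (\<forall>z. F (z + 1) = \<alpha> * F z) \<and> (\<forall>z. F (z + \<tau>) = \<beta> * F z) \<and> (\<lambda>z. z * F z) \<midarrow>0\<rightarrow> 1"

lemma quasi_periodic_int:
  assumes "\<And>z. F (z + \<omega>) = \<gamma> * F z" "\<gamma> \<noteq> (0::complex)"
  shows "F (z + of_int n * \<omega>) = \<gamma> powi n * F z"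
proof (induction n arbitrary: z rule: int_induct[of _ 0])
  case (step1 n)
  show ?case
    using step1(2)[of "z + \<omega>"] assms(1)[of z] assms(2) by (simp add: algebra_simps power_int_add)
next
  case (step2 n)
  show ?case
    using step2(2)[of "z - \<omega>"] assms(1)[of "z - \<omega>"] assms(2)
    by (simp add: algebra_simps power_int_diff)
qed simp

lemma simple_elliptic_lattice:
  assumes "simple_elliptic \<tau> \<alpha> \<beta> F" "\<alpha> \<noteq> 0" "\<beta> \<noteq> 0"
  shows "F (z + (of_int m + of_int n * \<tau>)) = \<alpha> powi m * \<beta> powi n * F z"
  using quasi_periodic_int[of F 1 \<alpha> "z + of_int n * \<tau>" m] quasi_periodic_int[of F \<tau> \<beta> z n] assms
  by (simp add: simple_elliptic_def add_ac)

text \<open>The difference of two such functions extends to a bounded entire function, which is constant by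
  Liouville's theorem and vanishes because the character is nontrivial.\<close>

lemma simple_elliptic_unique:
  assumes \<tau>: "\<tau> \<in> upper_half_plane"
    and F: "simple_elliptic \<tau> \<alpha> \<beta> F" and G: "simple_elliptic \<tau> \<alpha> \<beta> G"
    and \<alpha>\<beta>: "norm \<alpha> = 1" "norm \<beta> = 1" "\<alpha> \<noteq> 1 \<or> \<beta> \<noteq> 1"
    and z: "z \<notin> lattice \<tau>"
  shows "F z = G z"
proof -
  define D where "D = (\<lambda>z. F z - G z)"
  define H where "H = remove_sings D"
  have nz: "\<alpha> \<noteq> 0" "\<beta> \<noteq> 0"
    using \<alpha>\<beta> by auto
  obtain d where d: "d > 0" "\<And>x y. x \<in> lattice \<tau> \<Longrightarrow> y \<in> lattice \<tau> \<Longrightarrow> dist y x < d \<Longrightarrow> y = x"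
    by (rule lattice_uniformly_discrete[OF \<tau>]) blast
  have ball: "ball x d - {x} \<subseteq> - lattice \<tau>" if "x \<in> lattice \<tau>" for x
    using d(2)[OF that] by (auto simp: dist_commute)
  have holD: "D holomorphic_on - lattice \<tau>"
    unfolding D_def using F G by (intro holomorphic_intros) (auto simp: simple_elliptic_def)
  then have anaD: "D analytic_on - lattice \<tau>"
    by (simp add: analytic_on_open open_Compl_lattice \<tau>)
  have D: "D (z + (of_int m + of_int n * \<tau>)) = \<alpha> powi m * \<beta> powi n * D z" for z m n
    using simple_elliptic_lattice[OF F nz] simple_elliptic_lattice[OF G nz]
    by (simp add: D_def algebra_simps)
  \<comment> \<open>Equal residues cancel, so Riemann's removable singularity criterion applies to
    the difference at 0.\<close>
  have "(\<lambda>z. z * F z - z * G z) \<midarrow>0\<rightarrow> 1 - 1"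
    using F G unfolding simple_elliptic_def by (intro tendsto_diff) auto
  then have "(\<lambda>z. (z - 0) * D z) \<midarrow>0\<rightarrow> 0"
    by (simp add: D_def algebra_simps)
  then obtain g where g: "g holomorphic_on ball 0 d" "\<And>z. z \<in> ball 0 d - {0} \<Longrightarrow> g z = D z"
    using holomorphic_on_extend_lim[of D "ball 0 d" 0] holomorphic_on_subset[OF holD ball[of 0]] d(1)
    by auto
  have "g \<midarrow>0\<rightarrow> g 0"
    using holomorphic_on_imp_continuous_on[OF g(1)] d(1)
    by (simp add: continuous_on_eq_continuous_at isCont_def)
  moreover have "eventually (\<lambda>z. g z = D z) (at 0)"
    using d(1) g(2) by (intro eventually_at_in_open[of "ball 0 d", THEN eventually_mono]) auto
  ultimately have D0: "D \<midarrow>0\<rightarrow> g 0"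
    by (rule Lim_transform_eventually)
  have anaH: "H analytic_on {x}" for x
  proof (cases "x \<in> lattice \<tau>")
    case True
    then obtain m n where x: "x = of_int m + of_int n * \<tau>"
      by (auto simp: lattice_def)
    \<comment> \<open>Quasi-periodicity transports the finite limit from 0 to every lattice
      point.\<close>
    have "(\<lambda>z. D (z + x)) \<midarrow>0\<rightarrow> \<alpha> powi m * \<beta> powi n * g 0"
      unfolding x D by (intro tendsto_intros D0)
    then have "D \<midarrow>x\<rightarrow> \<alpha> powi m * \<beta> powi n * g 0"
      by (simp add: at_to_0[of x] filterlim_filtermap)
    moreover have "isolated_singularity_at D x"
      unfolding isolated_singularity_at_def using d(1) analytic_on_subset[OF anaD ball[OF True]] by blast
    ultimately show ?thesis
      unfolding H_def by (rule remove_sings_analytic_at[rotated])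
  next
    case False
    then show ?thesis
      unfolding H_def using anaD by (intro remove_sings_analytic_on) (auto intro: analytic_on_subset)
  qed
  have HD: "H z = D z" if "z \<notin> lattice \<tau>" for z
    unfolding H_def using anaD that by (intro remove_sings_at_analytic) (auto intro: analytic_on_subset)
  have holH: "H holomorphic_on UNIV"
    using anaH analytic_imp_holomorphic analytic_on_analytic_at by blast
  \<comment> \<open>The closed fundamental parallelogram spanned by 1 and \<tau>; unimodular
    multipliers make a bound on it global.\<close>
  define K where "K = (\<lambda>(x, y). complex_of_real x + of_real y * \<tau>) ` (cbox 0 1 \<times> cbox 0 1)"
  have "compact (H ` K)"
    unfolding K_def
    by (intro compact_continuous_image compact_Times compact_cbox)
       (auto intro!: continuous_intros holomorphic_on_imp_continuous_on holomorphic_on_subset[OF holH]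
          simp: split_beta)
  then obtain M where M: "\<And>k. k \<in> K \<Longrightarrow> norm (H k) \<le> M"
    using compact_imp_bounded[of "H ` K"] by (auto simp: bounded_iff)
  \<comment> \<open>The bound is first proved off the lattice, where H agrees with D and so inherits
    the multipliers.\<close>
  have M': "norm (H z) \<le> M" if z: "z \<notin> lattice \<tau>" for z
  proof -
    define y where "y = Im z / Im \<tau>"
    define x where "x = Re (z - of_real y * \<tau>)"
    \<comment> \<open>Subtracting the integer parts of the real coordinates of z moves it into
      K.\<close>
    define l where "l = of_int \<lfloor>x\<rfloor> + of_int \<lfloor>y\<rfloor> * \<tau>"
    have "Im \<tau> > 0"
      using \<tau> by (simp add: upper_half_plane_def)
    then have "z = of_real x + of_real y * \<tau>"
      by (simp add: x_def y_def complex_eq_iff)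
    then have "z - l = of_real (frac x) + of_real (frac y) * \<tau>"
      by (simp add: l_def frac_def algebra_simps)
    moreover have "(\<lambda>(x, y). complex_of_real x + of_real y * \<tau>) (frac x, frac y) \<in> K"
      unfolding K_def by (rule imageI) (simp add: less_imp_le frac_lt_1)
    ultimately have "z - l \<in> K"
      by simp
    have "l \<in> lattice \<tau>"
      unfolding l_def lattice_def by blast
    with z have "z - l \<notin> lattice \<tau>"
      using lattice_add[of "z - l" \<tau> l] by auto
    have "norm (D z) = norm (D (z - l + l))"
      by simp
    also have "\<dots> = norm (D (z - l))"
      unfolding l_def D by (simp add: norm_mult norm_power_int \<alpha>\<beta>)
    also have "\<dots> \<le> M"
      using M[OF \<open>z - l \<in> K\<close>] HD[OF \<open>z - l \<notin> lattice \<tau>\<close>] by simp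
    finally show ?thesis
      using HD[OF z] by simp
  qed
  have "norm (H z) \<le> M" for z
  proof (cases "z \<in> lattice \<tau>")
    case True
    have lim: "H \<midarrow>z\<rightarrow> H z"
      using analytic_at_imp_isCont[OF anaH] by (simp add: isCont_def)
    have "eventually (\<lambda>w. w \<in> ball z d - {z}) (at z)"
      using d(1) by (intro eventually_at_in_open) auto
    then have "eventually (\<lambda>w. norm (H w) \<le> M) (at z)"
      by eventually_elim (use ball[OF True] M' in blast)
    then show ?thesis
      by (rule tendsto_upperbound[OF tendsto_norm[OF lim]]) simp
  qed (use M' in auto)
  then have "H constant_on UNIV"
    by (intro Liouville_theorem holH boundedI[of _ M]) blast
  then obtain c where c: "\<And>z. H z = c"
    by (auto simp: constant_on_def)
  have "z + 1 \<notin> lattice \<tau>" "z + \<tau> \<notin> lattice \<tau>"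
  proof -
    have "of_int 1 + of_int 0 * \<tau> \<in> lattice \<tau>" "of_int 0 + of_int 1 * \<tau> \<in> lattice \<tau>"
      unfolding lattice_def by blast+
    with z show "z + 1 \<notin> lattice \<tau>" "z + \<tau> \<notin> lattice \<tau>"
      using lattice_diff[of "z + 1" \<tau> 1] lattice_diff[of "z + \<tau>" \<tau> \<tau>] by auto
  qed
  then have "H (z + 1) = \<alpha> * H z" "H (z + \<tau>) = \<beta> * H z"
    using D[of z 1 0] D[of z 0 1] by (simp_all add: HD z)
  then have "(\<alpha> - 1) * c = 0" "(\<beta> - 1) * c = 0"
    by (simp_all add: c algebra_simps)
  with \<alpha>\<beta>(3) have "c = 0"
    by auto
  then show ?thesis
    using HD[OF z] c by (simp add: D_def)
qed

section \<open>Behaviour of the theta quotients under modular substitutions\<close>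

definition theta_quotient :: "(complex \<Rightarrow> complex \<Rightarrow> complex) \<Rightarrow> complex \<Rightarrow> complex \<Rightarrow> complex" where
  "theta_quotient th z \<tau> = dv theta 0 \<tau> / theta z \<tau> * (th z \<tau> / th 0 \<tau>)"

text \<open>The multipliers of \<open>th\<close> carry minus signs because \<open>theta\<close>
  itself contributes - 1 for either period. The normalisation theta'(0) / th(0) gives residue
  1.\<close>

lemma simple_elliptic_theta_quotient:
  assumes \<tau>: "\<tau> \<in> upper_half_plane" and hol: "(\<lambda>z. th z \<tau>) holomorphic_on UNIV" and nz: "th 0 \<tau> \<noteq> 0"
    and 1: "\<And>z. th (z + 1) \<tau> = - \<alpha> * th z \<tau>"
    and 2: "\<And>z. th (z + \<tau>) \<tau> = - \<beta> * (exp (- (2 * of_real pi * \<i>) * z) / qpow \<tau> (1/2)) * th z \<tau>"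
  shows "simple_elliptic \<tau> \<alpha> \<beta> (\<lambda>z. theta_quotient th z \<tau>)"
  unfolding simple_elliptic_def
proof (intro conjI allI)
  show "(\<lambda>z. theta_quotient th z \<tau>) holomorphic_on - lattice \<tau>"
    unfolding theta_quotient_def using nz theta_nonzero[OF \<tau>] holomorphic_on_subset[OF hol]
    by (intro holomorphic_intros holomorphic_on_theta \<tau>) auto
  show "theta_quotient th (z + 1) \<tau> = \<alpha> * theta_quotient th z \<tau>" for z
    by (simp add: theta_quotient_def theta_add_1[OF \<tau>] 1)
  show "theta_quotient th (z + \<tau>) \<tau> = \<beta> * theta_quotient th z \<tau>" for z
    unfolding theta_quotient_def theta_add_tau[OF \<tau>] 2 by (simp add: field_simps)
  have "(\<lambda>z. theta z \<tau> / z) \<midarrow>0\<rightarrow> dv theta 0 \<tau>"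
    using has_field_derivative_theta_0[OF \<tau>] by (simp add: has_field_derivative_iff \<tau>)
  moreover have "(\<lambda>z. th z \<tau>) \<midarrow>0\<rightarrow> th 0 \<tau>"
    using holomorphic_on_imp_continuous_on[OF hol] by (simp add: continuous_on_def)
  ultimately have "(\<lambda>z. dv theta 0 \<tau> / (theta z \<tau> / z) * (th z \<tau> / th 0 \<tau>)) \<midarrow>0\<rightarrow>
      dv theta 0 \<tau> / dv theta 0 \<tau> * (th 0 \<tau> / th 0 \<tau>)"
    using nz dv_theta_0_nonzero[OF \<tau>] by (intro tendsto_intros) auto
  then show "(\<lambda>z. z * theta_quotient th z \<tau>) \<midarrow>0\<rightarrow> 1"
    using nz dv_theta_0_nonzero[OF \<tau>] by (simp add: theta_quotient_def mult_ac)
qed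

text \<open>The three quotients are told apart by their multipliers for the periods $1$ and $\tau$.\<close>

definition theta_with_multipliers :: "complex \<Rightarrow> complex \<Rightarrow> complex \<Rightarrow> complex \<Rightarrow> complex" where
  "theta_with_multipliers \<alpha> \<beta> = (if \<alpha> = 1 then theta1 else if \<beta> = 1 then theta2 else theta3)"

definition sign_pairs :: "(complex \<times> complex) set" where
  "sign_pairs = {(1, - 1), (- 1, 1), (- 1, - 1)}"

lemma simple_elliptic_theta_with_multipliers:
  assumes \<tau>: "\<tau> \<in> upper_half_plane" and "(\<alpha>, \<beta>) \<in> sign_pairs"
  shows "simple_elliptic \<tau> \<alpha> \<beta> (\<lambda>z. theta_quotient (theta_with_multipliers \<alpha> \<beta>) z \<tau>)"
proof -
  have "simple_elliptic \<tau> 1 (- 1) (\<lambda>z. theta_quotient theta1 z \<tau>)"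
    by (rule simple_elliptic_theta_quotient)
       (simp_all add: \<tau> holomorphic_on_theta1 theta1_0_nonzero theta1_add_1 theta1_add_tau)
  moreover have "simple_elliptic \<tau> (- 1) 1 (\<lambda>z. theta_quotient theta2 z \<tau>)"
    by (rule simple_elliptic_theta_quotient)
       (simp_all add: \<tau> holomorphic_on_theta2 theta2_0_nonzero theta2_add_1 theta2_add_tau)
  moreover have "simple_elliptic \<tau> (- 1) (- 1) (\<lambda>z. theta_quotient theta3 z \<tau>)"
    by (rule simple_elliptic_theta_quotient)
       (simp_all add: \<tau> holomorphic_on_theta3 theta3_0_nonzero theta3_add_1 theta3_add_tau)
  ultimately show ?thesis
    using assms(2) by (auto simp: sign_pairs_def theta_with_multipliers_def)
qed

lemma cocycle_nonzero:
  assumes "\<tau> \<in> upper_half_plane" and det: "a * d - b * c = (1::int)"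
  shows "of_int c * \<tau> + of_int d \<noteq> 0"
proof
  assume *: "of_int c * \<tau> + of_int d = 0"
  have "Im (of_int c * \<tau> + of_int d) = 0"
    unfolding * by simp
  then have "c = 0"
    using assms by (simp add: upper_half_plane_def)
  with * det show False
    by simp
qed

lemma moebius_in_upper_half_plane:
  assumes \<tau>: "\<tau> \<in> upper_half_plane" and det: "a * d - b * c = (1::int)"
  shows "(of_int a * \<tau> + of_int b) / (of_int c * \<tau> + of_int d) \<in> upper_half_plane"
proof -
  have j: "of_int c * \<tau> + of_int d \<noteq> 0"
    by (rule cocycle_nonzero[OF assms])
  have "Im ((of_int a * \<tau> + of_int b) / (of_int c * \<tau> + of_int d))
      = of_int (a * d - b * c) * Im \<tau> / (norm (of_int c * \<tau> + of_int d))\<^sup>2"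
    by (simp add: Im_divide cmod_power2 algebra_simps)
  with j \<tau> det show ?thesis
    by (simp add: upper_half_plane_def)
qed

text \<open>With j = c\<tau> + d, j(m + n g\<tau>) = m(c\<tau> + d) + n(a\<tau> + b) lies in the
  lattice of \<tau>.\<close>

lemma lattice_moebius:
  assumes \<tau>: "\<tau> \<in> upper_half_plane" and det: "a * d - b * c = (1::int)"
    and w: "w \<notin> lattice \<tau>"
  shows "w / (of_int c * \<tau> + of_int d) \<notin> lattice ((of_int a * \<tau> + of_int b) / (of_int c * \<tau> + of_int d))"
proof
  have j: "of_int c * \<tau> + of_int d \<noteq> 0"
    by (rule cocycle_nonzero[OF assms(1,2)])
  assume "w / (of_int c * \<tau> + of_int d) \<in> lattice ((of_int a * \<tau> + of_int b) / (of_int c * \<tau> + of_int d))"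
  then obtain m n where "w / (of_int c * \<tau> + of_int d)
      = of_int m + of_int n * ((of_int a * \<tau> + of_int b) / (of_int c * \<tau> + of_int d))"
    unfolding lattice_def by blast
  then have "w = of_int (m * d + n * b) + of_int (m * c + n * a) * \<tau>"
    using j by (simp add: field_simps)
  with w show False
    unfolding lattice_def by blast
qed

text \<open>With j = c\<tau> + d and \<tau>' = g\<tau>, determinant 1 gives 1/j = a - c\<tau>' and
  \<tau>/j = -b + d\<tau>'. So translating w by 1 or \<tau> translates w/j by a lattice vector with
  these coordinates, whence the new multipliers. The outer division by j restores residue 1.\<close>

lemma simple_elliptic_moebius:
  assumes \<tau>: "\<tau> \<in> upper_half_plane" and det: "a * d - b * c = (1::int)"
    and F: "simple_elliptic ((of_int a * \<tau> + of_int b) / (of_int c * \<tau> + of_int d)) \<alpha> \<beta> F"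
    and nz: "\<alpha> \<noteq> 0" "\<beta> \<noteq> 0"
  shows "simple_elliptic \<tau> (\<alpha> powi a * \<beta> powi (- c)) (\<alpha> powi (- b) * \<beta> powi d)
           (\<lambda>w. F (w / (of_int c * \<tau> + of_int d)) / (of_int c * \<tau> + of_int d))"
  unfolding simple_elliptic_def
proof (intro conjI allI)
  let ?j = "of_int c * \<tau> + of_int d" and ?\<tau> = "(of_int a * \<tau> + of_int b) / (of_int c * \<tau> + of_int d)"
  have j: "?j \<noteq> 0"
    by (rule cocycle_nonzero[OF assms(1,2)])
  have det': "of_int a * of_int d - of_int b * of_int c = (1 :: complex)"
    using arg_cong[OF det, of "of_int :: int \<Rightarrow> complex"] by simp
  have "F holomorphic_on - lattice ?\<tau>"
    using F by (simp add: simple_elliptic_def)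
  then have "F \<circ> (\<lambda>w. w / ?j) holomorphic_on - lattice \<tau>"
    using j lattice_moebius[OF \<tau> det]
    by (intro holomorphic_on_compose_gen[of _ _ _ "- lattice ?\<tau>"] holomorphic_intros) auto
  then show "(\<lambda>w. F (w / ?j) / ?j) holomorphic_on - lattice \<tau>"
    using j by (intro holomorphic_intros) (auto simp: o_def)
  fix w
  have "(w + 1) / ?j = w / ?j + (of_int a + of_int (- c) * ?\<tau>)"
    using j det' by (simp add: field_simps)
  then show "F ((w + 1) / ?j) / ?j = \<alpha> powi a * \<beta> powi (- c) * (F (w / ?j) / ?j)"
    using simple_elliptic_lattice[OF F nz, of "w / ?j" a "- c"] by simp
  have \<tau>_eq: "of_int (- b) * ?j + of_int d * (of_int a * \<tau> + of_int b) = \<tau>"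
    using arg_cong[OF det', of "\<lambda>x. x * \<tau>"] by (simp add: algebra_simps)
  have "(w + \<tau>) / ?j = w / ?j + (of_int (- b) + of_int d * ?\<tau>)"
    using j add_divide_distrib[of "of_int (- b) * ?j" "of_int d * (of_int a * \<tau> + of_int b)" ?j]
    unfolding \<tau>_eq by (simp add: add_divide_distrib[of w])
  then show "F ((w + \<tau>) / ?j) / ?j = \<alpha> powi (- b) * \<beta> powi d * (F (w / ?j) / ?j)"
    using simple_elliptic_lattice[OF F nz, of "w / ?j" "- b" d] by simp
next
  let ?j = "of_int c * \<tau> + of_int d"
  have j: "?j \<noteq> 0"
    by (rule cocycle_nonzero[OF assms(1,2)])
  have "(\<lambda>z. z * F z) \<midarrow>0\<rightarrow> 1"
    using F by (simp add: simple_elliptic_def)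
  moreover have "filterlim (\<lambda>w. w / ?j) (at 0) (at 0)"
    using j by (auto simp: filterlim_at eventually_at_filter intro!: tendsto_eq_intros)
  ultimately have "(\<lambda>w. w / ?j * F (w / ?j)) \<midarrow>0\<rightarrow> 1"
    by (rule filterlim_compose)
  then show "(\<lambda>w. w * (F (w / ?j) / ?j)) \<midarrow>0\<rightarrow> 1"
    by simp
qed

lemma theta_quotient_moebius:
  assumes \<tau>: "\<tau> \<in> upper_half_plane" and det: "a * d - b * c = (1::int)"
    and \<alpha>\<beta>: "(\<alpha>, \<beta>) \<in> sign_pairs" and \<alpha>\<beta>': "(\<alpha> powi a * \<beta> powi (- c), \<alpha> powi (- b) * \<beta> powi d) = (\<alpha>', \<beta>')"
    and w: "w \<notin> lattice \<tau>"
  shows "theta_quotient (theta_with_multipliers \<alpha> \<beta>) (w / (of_int c * \<tau> + of_int d))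
             ((of_int a * \<tau> + of_int b) / (of_int c * \<tau> + of_int d)) / (of_int c * \<tau> + of_int d)
       = theta_quotient (theta_with_multipliers \<alpha>' \<beta>') w \<tau>"
proof -
  have nz: "\<alpha> \<noteq> 0" "\<beta> \<noteq> 0" and norm: "norm \<alpha> = 1" "norm \<beta> = 1"
    using \<alpha>\<beta> by (auto simp: sign_pairs_def)
  have "odd (a * d - b * c)"
    by (simp add: det)
  then have par: "(even a \<or> even d) \<longleftrightarrow> (odd b \<and> odd c)"
    by auto
  \<comment> \<open>A matrix of odd determinant is invertible modulo 2 and so permutes the three
    nontrivial sign characters; this is checked over all parities of the entries.\<close>
  have "(\<alpha>', \<beta>') \<in> sign_pairs"
    unfolding \<alpha>\<beta>'[symmetric] using \<alpha>\<beta> par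
    by (cases "even a"; cases "even b"; cases "even c"; cases "even d")
       (auto simp: sign_pairs_def power_int_minus_left)
  then have *: "norm \<alpha>' = 1" "norm \<beta>' = 1" "\<alpha>' \<noteq> 1 \<or> \<beta>' \<noteq> 1"
    by (auto simp: sign_pairs_def)
  have eqs: "\<alpha> powi a * \<beta> powi (- c) = \<alpha>'" "\<alpha> powi (- b) * \<beta> powi d = \<beta>'"
    using \<alpha>\<beta>' by simp_all
  have "simple_elliptic ((of_int a * \<tau> + of_int b) / (of_int c * \<tau> + of_int d)) \<alpha> \<beta>
      (\<lambda>z. theta_quotient (theta_with_multipliers \<alpha> \<beta>) z
        ((of_int a * \<tau> + of_int b) / (of_int c * \<tau> + of_int d)))"
    by (rule simple_elliptic_theta_with_multipliers[OF moebius_in_upper_half_plane[OF \<tau> det] \<alpha>\<beta>])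
  note E = simple_elliptic_moebius[OF \<tau> det this nz, unfolded eqs]
  note E' = simple_elliptic_theta_with_multipliers[OF \<tau> \<open>(\<alpha>', \<beta>') \<in> sign_pairs\<close>]
  show ?thesis
    using simple_elliptic_unique[OF \<tau> E E' * w] .
qed

section \<open>The Taylor series of the characteristic power series\<close>

text \<open>A power series expansion speaks about a full neighbourhood of 0, but \<open>f\<close>
  may have a default value at 0 itself. \<open>remove_sings\<close> depends only on punctured
  neighbourhoods, so agreement with an analytic G away from 0 suffices.\<close>

lemma remove_sings_eventually_eq:
  assumes "eventually (\<lambda>z. f z = G z) (at 0)" "G has_fps_expansion \<Phi>"
  shows "remove_sings f has_fps_expansion \<Phi>"
proof -
  obtain S where S: "open S" "0 \<in> S" "\<And>z. z \<in> S \<Longrightarrow> z \<noteq> 0 \<Longrightarrow> f z = G z"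
    using assms(1) unfolding eventually_at_topological by blast
  have "remove_sings f z = remove_sings G z" if "z \<in> S" for z
  proof (rule remove_sings_cong[OF _ refl])
    have "eventually (\<lambda>w. w \<in> S - {0}) (at z)"
    proof (cases "z = 0")
      case True
      with S eventually_at_in_open[of S 0] show ?thesis
        by simp
    next
      case False
      with S that show ?thesis
        by (intro eventually_at_in_open') auto
    qed
    then show "eventually (\<lambda>w. f w = G w) (at z)"
      by eventually_elim (use S(3) in auto)
  qed
  then have "eventually (\<lambda>z. remove_sings f z = remove_sings G z) (nhds 0)"
    using S by (auto simp: eventually_nhds)
  moreover have "eventually (\<lambda>z. remove_sings G z = G z) (nhds 0)"
    by (rule eventually_remove_sings_eq_nhds[OF has_fps_expansion_imp_analytic_0[OF assms(2)]])
  ultimately have "eventually (\<lambda>z. remove_sings f z = G z) (nhds 0)"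
    by eventually_elim simp
  with assms(2) show ?thesis
    by (subst has_fps_expansion_cong) auto
qed

lemma taylor_eqI:
  assumes "eventually (\<lambda>z. f z \<tau> = G z) (at 0)" "G has_fps_expansion \<Phi>"
  shows "taylor f \<tau> = \<Phi>"
  unfolding taylor_def by (rule fps_expansion_eqI) (rule remove_sings_eventually_eq[OF assms])

lemma eventually_not_in_lattice:
  assumes "\<tau> \<in> upper_half_plane"
  shows "eventually (\<lambda>z. z \<notin> lattice \<tau>) (at 0)"
proof -
  obtain d where d: "d > 0" "\<And>x y. x \<in> lattice \<tau> \<Longrightarrow> y \<in> lattice \<tau> \<Longrightarrow> dist y x < d \<Longrightarrow> y = x"
    by (rule lattice_uniformly_discrete[OF assms]) blast
  have "eventually (\<lambda>z. z \<in> ball 0 d - {0}) (at (0::complex))"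
    using d(1) by (intro eventually_at_in_open) auto
  then show ?thesis
    by eventually_elim (use d(2)[of 0] in \<open>auto simp: dist_commute\<close>)
qed

definition theta_fps :: "(complex \<Rightarrow> complex \<Rightarrow> complex) \<Rightarrow> complex \<Rightarrow> complex fps" where
  "theta_fps th \<tau> = fps_expansion (\<lambda>z. th z \<tau>) 0"

lemma has_fps_expansion_theta_fps:
  "(\<lambda>z. th z \<tau>) holomorphic_on UNIV \<Longrightarrow> (\<lambda>z. th z \<tau>) has_fps_expansion theta_fps th \<tau>"
  unfolding theta_fps_def by (rule has_fps_expansion_fps_expansion[of UNIV]) auto

lemma theta_fps_nth_0: "fps_nth (theta_fps th \<tau>) 0 = th 0 \<tau>"
  by (simp add: theta_fps_def fps_expansion_def)

lemma theta_fps_nth_1: "fps_nth (theta_fps th \<tau>) 1 = dv th 0 \<tau>"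
  by (simp add: theta_fps_def fps_expansion_def dv_def)

definition triple_product_fps :: "complex \<Rightarrow> complex \<Rightarrow> complex fps" where
  "triple_product_fps b q = fps_const (qpochhammer q q) *
     fps_expansion (\<lambda>z. qpochhammer (b * exp (2 * of_real pi * \<i> * z)) q) 0 *
     fps_expansion (\<lambda>z. qpochhammer (b * exp (- (2 * of_real pi * \<i>) * z)) q) 0"

lemma has_fps_expansion_triple_product:
  "norm q < 1 \<Longrightarrow> triple_product b q has_fps_expansion triple_product_fps b q"
  unfolding triple_product_fps_def triple_product_def[abs_def]
  by (intro has_fps_expansion_mult has_fps_expansion_qpochhammer_exp has_fps_expansion_const)

lemma holomorphic_on_qpow [holomorphic_intros]: "(\<lambda>\<tau>. qpow \<tau> a) holomorphic_on S"
  unfolding qpow_def by (intro holomorphic_intros)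

lemma holomorphic_fps_on_triple_product:
  assumes "b holomorphic_on upper_half_plane"
  shows "holomorphic_fps_on (\<lambda>\<tau>. triple_product_fps (b \<tau>) (qpow \<tau> 1)) upper_half_plane"
  unfolding triple_product_fps_def
  by (intro holomorphic_fps_on_mult holomorphic_fps_on_const holomorphic_fps_on_qpochhammer_exp
      holomorphic_intros assms open_upper_half_plane norm_qpow_less_1) auto

lemma holomorphic_fps_on_theta: "holomorphic_fps_on (theta_fps theta) upper_half_plane"
proof -
  have "theta_fps theta \<tau> = fps_const (2 * qpow \<tau> (1/8)) * fps_sin (of_real pi) *
      triple_product_fps (qpow \<tau> 1) (qpow \<tau> 1)" if "\<tau> \<in> upper_half_plane" for \<tau>
    unfolding theta_fps_def theta_eq[OF that]
    by (intro fps_expansion_eqI fps_expansion_intros has_fps_expansion_triple_product norm_q_less_1[OF that])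
  then show ?thesis
    by (subst holomorphic_fps_on_cong)
       (auto intro!: holomorphic_fps_on_mult holomorphic_fps_on_const holomorphic_fps_on_triple_product
          holomorphic_intros)
qed

lemma holomorphic_fps_on_theta1: "holomorphic_fps_on (theta_fps theta1) upper_half_plane"
proof -
  have "theta_fps theta1 \<tau> = fps_const (2 * qpow \<tau> (1/8)) * fps_cos (of_real pi) *
      triple_product_fps (- qpow \<tau> 1) (qpow \<tau> 1)" if "\<tau> \<in> upper_half_plane" for \<tau>
    unfolding theta_fps_def theta1_eq[OF that]
    by (intro fps_expansion_eqI fps_expansion_intros has_fps_expansion_triple_product norm_q_less_1[OF that])
  then show ?thesis
    by (subst holomorphic_fps_on_cong)
       (auto intro!: holomorphic_fps_on_mult holomorphic_fps_on_const holomorphic_fps_on_triple_product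
          holomorphic_intros)
qed

lemma holomorphic_fps_on_theta2: "holomorphic_fps_on (theta_fps theta2) upper_half_plane"
proof -
  have "theta_fps theta2 \<tau> = triple_product_fps (qpow \<tau> (1/2)) (qpow \<tau> 1)" if "\<tau> \<in> upper_half_plane" for \<tau>
    unfolding theta_fps_def theta2_eq[OF that]
    by (intro fps_expansion_eqI has_fps_expansion_triple_product norm_q_less_1[OF that])
  then show ?thesis
    by (subst holomorphic_fps_on_cong) (auto intro!: holomorphic_fps_on_triple_product holomorphic_intros)
qed

lemma holomorphic_fps_on_theta3: "holomorphic_fps_on (theta_fps theta3) upper_half_plane"
proof -
  have "theta_fps theta3 \<tau> = triple_product_fps (- qpow \<tau> (1/2)) (qpow \<tau> 1)" if "\<tau> \<in> upper_half_plane" for \<tau>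
    unfolding theta_fps_def theta3_eq[OF that]
    by (intro fps_expansion_eqI has_fps_expansion_triple_product norm_q_less_1[OF that])
  then show ?thesis
    by (subst holomorphic_fps_on_cong) (auto intro!: holomorphic_fps_on_triple_product holomorphic_intros)
qed

lemma thetas_holomorphic_nonzero:
  assumes "\<tau> \<in> upper_half_plane" "th \<in> {theta1, theta2, theta3}"
  shows "(\<lambda>z. th z \<tau>) holomorphic_on UNIV" "th 0 \<tau> \<noteq> 0"
  using assms holomorphic_on_theta1 holomorphic_on_theta2 holomorphic_on_theta3
    theta1_0_nonzero theta2_0_nonzero theta3_0_nonzero by auto

text \<open>The series of z times the theta quotient. The factor z is absorbed by
  \<open>fps_shift 1\<close>, the series of theta(z)/z, which is invertible because its constant
  term is theta'(0).\<close>

definition quotient_fps :: "(complex \<Rightarrow> complex \<Rightarrow> complex) \<Rightarrow> complex \<Rightarrow> complex fps" where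
  "quotient_fps th \<tau> = fps_const (dv theta 0 \<tau> / th 0 \<tau>) *
     (theta_fps th \<tau> * inverse (fps_shift 1 (theta_fps theta \<tau>)))"

context
  fixes \<tau> th
  assumes \<tau>: "\<tau> \<in> upper_half_plane" and th: "th \<in> {theta1, theta2, theta3}"
begin

lemma quotient_fps_nth_0: "fps_nth (quotient_fps th \<tau>) 0 = 1"
  using dv_theta_0_nonzero[OF \<tau>] thetas_holomorphic_nonzero[OF \<tau> th] theta_fps_nth_1[of theta \<tau>]
  by (simp add: quotient_fps_def theta_fps_nth_0)

lemma quotient_fps_expansion:
  obtains G where "G has_fps_expansion quotient_fps th \<tau>"
    "eventually (\<lambda>z. z * theta_quotient th z \<tau> = G z) (at 0)"
proof
  let ?\<Theta> = "theta_fps theta \<tau>"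
  \<comment> \<open>The value at 0 is the limit theta'(0) of theta(z)/z.\<close>
  let ?s = "\<lambda>z. if z = 0 then fps_nth ?\<Theta> 1 else theta z \<tau> / z ^ 1"
  have \<Theta>: "(\<lambda>z. theta z \<tau>) has_fps_expansion ?\<Theta>"
    by (intro has_fps_expansion_theta_fps holomorphic_on_theta \<tau>)
  have nth1: "fps_nth ?\<Theta> 1 \<noteq> 0"
    unfolding theta_fps_nth_1 by (rule dv_theta_0_nonzero[OF \<tau>])
  have "fps_nth ?\<Theta> 0 = 0"
    by (simp add: theta_fps_nth_0 \<tau>)
  with nth1 have "subdegree ?\<Theta> = 1"
    by (intro subdegreeI) (simp_all add: less_Suc_eq)
  then have "?s has_fps_expansion fps_shift 1 ?\<Theta>"
    by (intro has_fps_expansion_shift \<Theta>) auto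
  moreover have "fps_nth (fps_shift 1 ?\<Theta>) 0 \<noteq> 0"
    using nth1 by simp
  ultimately show "(\<lambda>z. dv theta 0 \<tau> / th 0 \<tau> * (th z \<tau> * inverse (?s z))) has_fps_expansion quotient_fps th \<tau>"
    unfolding quotient_fps_def
    by (intro has_fps_expansion_cmult_left has_fps_expansion_mult has_fps_expansion_inverse
        has_fps_expansion_theta_fps thetas_holomorphic_nonzero[OF \<tau> th])
  show "eventually (\<lambda>z. z * theta_quotient th z \<tau> = dv theta 0 \<tau> / th 0 \<tau> * (th z \<tau> * inverse (?s z))) (at 0)"
    using eventually_neq_at_within[of 0 0 UNIV]
    by eventually_elim (simp add: theta_quotient_def field_simps)
qed

lemma taylor_theta_quotient: "taylor (\<lambda>z \<tau>. z * theta_quotient th z \<tau>) \<tau> = quotient_fps th \<tau>"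
  using quotient_fps_expansion taylor_eqI[where f = "\<lambda>z \<tau>. z * theta_quotient th z \<tau>"] by blast

end

lemma taylor_f_L: "\<tau> \<in> upper_half_plane \<Longrightarrow> taylor f_L \<tau> = quotient_fps theta1 \<tau>"
  and taylor_f_W: "\<tau> \<in> upper_half_plane \<Longrightarrow> taylor f_W \<tau> = quotient_fps theta2 \<tau>"
  and taylor_f_W': "\<tau> \<in> upper_half_plane \<Longrightarrow> taylor f_W' \<tau> = quotient_fps theta3 \<tau>"
  using taylor_theta_quotient[of \<tau> theta1] taylor_theta_quotient[of \<tau> theta2]
    taylor_theta_quotient[of \<tau> theta3]
  by (simp_all add: theta_quotient_def f_L_def[abs_def] f_W_def[abs_def] f_W'_def[abs_def] mult.assoc)

lemma holomorphic_fps_on_quotient: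
  assumes th: "th \<in> {theta1, theta2, theta3}"
  shows "holomorphic_fps_on (quotient_fps th) upper_half_plane"
proof -
  have TH: "holomorphic_fps_on (theta_fps th) upper_half_plane"
    using th holomorphic_fps_on_theta1 holomorphic_fps_on_theta2 holomorphic_fps_on_theta3 by auto
  have "(\<lambda>\<tau>. dv theta 0 \<tau>) holomorphic_on upper_half_plane"
    using holomorphic_fps_onD[OF holomorphic_fps_on_theta, of 1] by (simp only: theta_fps_nth_1)
  moreover have "(\<lambda>\<tau>. th 0 \<tau>) holomorphic_on upper_half_plane"
    using holomorphic_fps_onD[OF TH, of 0]
    by (simp only: theta_fps_nth_0)
  moreover have "fps_nth (fps_shift 1 (theta_fps theta \<tau>)) 0 \<noteq> 0" if "\<tau> \<in> upper_half_plane" for \<tau>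
    using dv_theta_0_nonzero[OF that] theta_fps_nth_1[of theta \<tau>] by simp
  ultimately show ?thesis
    unfolding quotient_fps_def[abs_def]
    by (intro holomorphic_fps_on_mult holomorphic_fps_on_const holomorphic_fps_on_inverse
        holomorphic_fps_on_shift holomorphic_fps_on_theta TH holomorphic_intros)
       (use thetas_holomorphic_nonzero[OF _ th] in auto)
qed

section \<open>The series of h and g in terms of the theta quotients\<close>

definition fps_log_deriv :: "complex fps \<Rightarrow> complex fps" where
  "fps_log_deriv F = fps_deriv F * inverse F"

lemma fps_log_deriv_mult:
  assumes "fps_nth F 0 \<noteq> 0" "fps_nth G 0 \<noteq> 0"
  shows "fps_log_deriv (F * G) = fps_log_deriv F + fps_log_deriv G"
proof -
  have "F * inverse F = 1" "G * inverse G = 1"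
    using assms by (auto simp: inverse_mult_eq_1')
  then show ?thesis
    unfolding fps_log_deriv_def fps_inverse_mult fps_deriv_mult by algebra
qed

text \<open>With $F_i$ the series of $z\,\theta'(0)\theta_i(z)/(\theta(z)\theta_i(0))$, the series of
  $h$ is $F_2F_3/F_1^2$ and that of $g$ is the logarithmic derivative of this quotient; the factor
  $z\,\theta'(0)/\theta(z)$ cancels in both.\<close>

definition h_fps :: "complex fps \<Rightarrow> complex fps \<Rightarrow> complex fps \<Rightarrow> complex fps" where
  "h_fps F1 F2 F3 = F2 * F3 * inverse (F1 * F1)"

definition g_fps :: "complex fps \<Rightarrow> complex fps \<Rightarrow> complex fps \<Rightarrow> complex fps" where
  "g_fps F1 F2 F3 = fps_log_deriv F2 + fps_log_deriv F3 - 2 * fps_log_deriv F1"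

context
  fixes \<tau> th1 th2 th3
  assumes \<tau>: "\<tau> \<in> upper_half_plane"
    and th: "th1 \<in> {theta1, theta2, theta3}" "th2 \<in> {theta1, theta2, theta3}" "th3 \<in> {theta1, theta2, theta3}"
begin

private lemma nz: "fps_nth (theta_fps th1 \<tau>) 0 \<noteq> 0" "fps_nth (theta_fps th2 \<tau>) 0 \<noteq> 0"
  "fps_nth (theta_fps th3 \<tau>) 0 \<noteq> 0"
  using thetas_holomorphic_nonzero[OF \<tau>] th by (simp_all add: theta_fps_nth_0)

lemma taylor_h:
  "taylor (\<lambda>z \<tau>. (th1 0 \<tau>)\<^sup>2 / (th1 z \<tau>)\<^sup>2 * (th3 z \<tau> / th3 0 \<tau>) * (th2 z \<tau> / th2 0 \<tau>)) \<tau>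
     = h_fps (quotient_fps th1 \<tau>) (quotient_fps th2 \<tau>) (quotient_fps th3 \<tau>)" (is "taylor ?h \<tau> = _")
proof -
  obtain G1 where G1: "G1 has_fps_expansion quotient_fps th1 \<tau>"
      "eventually (\<lambda>z. z * theta_quotient th1 z \<tau> = G1 z) (at 0)"
    by (rule quotient_fps_expansion[OF \<tau> th(1)])
  obtain G2 where G2: "G2 has_fps_expansion quotient_fps th2 \<tau>"
      "eventually (\<lambda>z. z * theta_quotient th2 z \<tau> = G2 z) (at 0)"
    by (rule quotient_fps_expansion[OF \<tau> th(2)])
  obtain G3 where G3: "G3 has_fps_expansion quotient_fps th3 \<tau>"
      "eventually (\<lambda>z. z * theta_quotient th3 z \<tau> = G3 z) (at 0)"
    by (rule quotient_fps_expansion[OF \<tau> th(3)])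
  show ?thesis
  proof (rule taylor_eqI)
    show "(\<lambda>z. G2 z * G3 z * inverse (G1 z * G1 z)) has_fps_expansion
        h_fps (quotient_fps th1 \<tau>) (quotient_fps th2 \<tau>) (quotient_fps th3 \<tau>)"
      unfolding h_fps_def
      by (intro fps_expansion_intros G1 G2 G3) (simp add: quotient_fps_nth_0[OF \<tau> th(1)])
    show "eventually (\<lambda>z. ?h z \<tau> = G2 z * G3 z * inverse (G1 z * G1 z)) (at 0)"
      using G1(2) G2(2) G3(2) eventually_not_in_lattice[OF \<tau>] eventually_neq_at_within[of 0 0 UNIV]
    proof eventually_elim
      case (elim z)
      \<comment> \<open>The factor common to all three series; off the lattice it is nonzero, so its
        square can be cancelled.\<close>
      define A where "A = z * (dv theta 0 \<tau> / theta z \<tau>)"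
      have "A \<noteq> 0"
        using elim theta_nonzero[OF \<tau>] dv_theta_0_nonzero[OF \<tau>] by (simp add: A_def)
      moreover have "G1 z = A * (th1 z \<tau> / th1 0 \<tau>)" "G2 z = A * (th2 z \<tau> / th2 0 \<tau>)"
        "G3 z = A * (th3 z \<tau> / th3 0 \<tau>)"
        by (simp_all only: A_def theta_quotient_def elim(1-3)[symmetric] mult.assoc)
      ultimately show ?case
        by (simp add: power2_eq_square field_simps)
    qed
  qed
qed

text \<open>The logarithmic derivative of each quotient series is that of its theta series plus a
  term independent of the index; the weights 1, 1, -2 sum to 0 and remove it.\<close>

lemma taylor_g:
  "taylor (\<lambda>z \<tau>. dv th2 z \<tau> / th2 z \<tau> + dv th3 z \<tau> / th3 z \<tau> - 2 * (dv th1 z \<tau> / th1 z \<tau>)) \<tau>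
     = g_fps (quotient_fps th1 \<tau>) (quotient_fps th2 \<tau>) (quotient_fps th3 \<tau>)" (is "taylor ?g \<tau> = _")
proof -
  have q: "fps_log_deriv (quotient_fps th' \<tau>)
      = fps_log_deriv (theta_fps th' \<tau>) + fps_log_deriv (inverse (fps_shift 1 (theta_fps theta \<tau>)))"
    if "th' \<in> {theta1, theta2, theta3}" for th'
  proof -
    have "fps_nth (theta_fps th' \<tau>) 0 \<noteq> 0"
      using thetas_holomorphic_nonzero[OF \<tau> that] by (simp add: theta_fps_nth_0)
    moreover have "dv theta 0 \<tau> / th' 0 \<tau> \<noteq> 0"
      using thetas_holomorphic_nonzero[OF \<tau> that] dv_theta_0_nonzero[OF \<tau>] by simp
    moreover have "fps_nth (fps_shift 1 (theta_fps theta \<tau>)) 0 \<noteq> 0"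
      using dv_theta_0_nonzero[OF \<tau>] theta_fps_nth_1[of theta \<tau>] by simp
    moreover have "fps_log_deriv (fps_const c) = 0" for c
      by (simp add: fps_log_deriv_def)
    ultimately show ?thesis
      unfolding quotient_fps_def by (subst fps_log_deriv_mult) (auto simp: fps_log_deriv_mult)
  qed
  have L: "(\<lambda>z. dv th' z \<tau> / th' z \<tau>) has_fps_expansion fps_log_deriv (theta_fps th' \<tau>)"
    if "th' \<in> {theta1, theta2, theta3}" for th'
  proof -
    have "(\<lambda>z. th' z \<tau>) has_fps_expansion theta_fps th' \<tau>"
      using thetas_holomorphic_nonzero[OF \<tau> that] by (intro has_fps_expansion_theta_fps)
    then have "(\<lambda>z. deriv (\<lambda>z. th' z \<tau>) z * inverse (th' z \<tau>)) has_fps_expansion fps_log_deriv (theta_fps th' \<tau>)"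
      unfolding fps_log_deriv_def using thetas_holomorphic_nonzero[OF \<tau> that]
      by (intro has_fps_expansion_mult has_fps_expansion_inverse has_fps_expansion_deriv)
         (simp_all add: theta_fps_nth_0)
    then show ?thesis
      by (simp add: dv_def divide_inverse)
  qed
  show ?thesis
  proof (rule taylor_eqI)
    show "(\<lambda>z. ?g z \<tau>) has_fps_expansion g_fps (quotient_fps th1 \<tau>) (quotient_fps th2 \<tau>) (quotient_fps th3 \<tau>)"
      unfolding g_fps_def q[OF th(1)] q[OF th(2)] q[OF th(3)]
      using has_fps_expansion_diff[OF has_fps_expansion_add[OF L[OF th(2)] L[OF th(3)]]
          has_fps_expansion_mult[OF has_fps_expansion_numeral[of "num.Bit0 num.One"] L[OF th(1)]]]
      by (simp add: algebra_simps)
  qed simp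
qed

end

lemma holomorphic_fps_on_h_g:
  assumes F: "holomorphic_fps_on F1 S" "holomorphic_fps_on F2 S" "holomorphic_fps_on F3 S"
    and nz: "\<And>\<tau>. \<tau> \<in> S \<Longrightarrow> fps_nth (F1 \<tau>) 0 \<noteq> 0" "\<And>\<tau>. \<tau> \<in> S \<Longrightarrow> fps_nth (F2 \<tau>) 0 \<noteq> 0"
      "\<And>\<tau>. \<tau> \<in> S \<Longrightarrow> fps_nth (F3 \<tau>) 0 \<noteq> 0"
  shows "holomorphic_fps_on (\<lambda>\<tau>. h_fps (F1 \<tau>) (F2 \<tau>) (F3 \<tau>)) S"
    and "holomorphic_fps_on (\<lambda>\<tau>. g_fps (F1 \<tau>) (F2 \<tau>) (F3 \<tau>)) S"
proof -
  show "holomorphic_fps_on (\<lambda>\<tau>. h_fps (F1 \<tau>) (F2 \<tau>) (F3 \<tau>)) S"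
    unfolding h_fps_def using F nz
    by (intro holomorphic_fps_on_mult holomorphic_fps_on_inverse) auto
  have L: "holomorphic_fps_on (\<lambda>\<tau>. fps_log_deriv (F \<tau>)) S"
    if "holomorphic_fps_on F S" "\<And>\<tau>. \<tau> \<in> S \<Longrightarrow> fps_nth (F \<tau>) 0 \<noteq> 0" for F
    unfolding fps_log_deriv_def using that
    by (intro holomorphic_fps_on_mult holomorphic_fps_on_inverse holomorphic_fps_on_deriv)
  \<comment> \<open>The sum is rearranged as a nested difference, to use closure under differences
    and products.\<close>
  have "holomorphic_fps_on (\<lambda>\<tau>. fps_log_deriv (F2 \<tau>) - (2 * fps_log_deriv (F1 \<tau>) - fps_log_deriv (F3 \<tau>))) S"
    by (intro holomorphic_fps_on_diff holomorphic_fps_on_mult holomorphic_fps_on_constant L F nz)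
  then show "holomorphic_fps_on (\<lambda>\<tau>. g_fps (F1 \<tau>) (F2 \<tau>) (F3 \<tau>)) S"
    unfolding g_fps_def by (simp add: algebra_simps)
qed

section \<open>Dilations z \<mapsto> cz of power series\<close>

definition fps_dilate :: "complex \<Rightarrow> complex fps \<Rightarrow> complex fps" where
  "fps_dilate c F = fps_compose F (fps_const c * fps_X)"

lemma fps_dilate_nth [simp]: "fps_nth (fps_dilate c F) n = c ^ n * fps_nth F n"
  by (simp add: fps_dilate_def fps_compose_linear)

lemma fps_dilate_1 [simp]: "fps_dilate 1 F = F"
  by (simp add: fps_eq_iff)

lemma fps_dilate_mult: "fps_dilate c (F * G) = fps_dilate c F * fps_dilate c G"
  and fps_dilate_inverse: "fps_nth F 0 \<noteq> 0 \<Longrightarrow> fps_dilate c (inverse F) = inverse (fps_dilate c F)"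
  and fps_deriv_dilate: "fps_deriv (fps_dilate c F) = fps_const c * fps_dilate c (fps_deriv F)"
  and fps_compose_dilate: "fps_nth F 0 = 0 \<Longrightarrow> fps_compose G (fps_dilate c F) = fps_dilate c (fps_compose G F)"
  unfolding fps_dilate_def
  by (simp_all add: fps_compose_mult_distrib fps_inverse_compose fps_compose_deriv fps_compose_assoc mult.commute)

lemma h_fps_dilate:
  "fps_nth F1 0 \<noteq> 0 \<Longrightarrow>
     h_fps (fps_dilate c F1) (fps_dilate c F2) (fps_dilate c F3) = fps_dilate c (h_fps F1 F2 F3)"
  by (simp add: h_fps_def fps_dilate_mult fps_dilate_inverse)

lemma g_fps_dilate:
  assumes "fps_nth F1 0 \<noteq> 0" "fps_nth F2 0 \<noteq> 0" "fps_nth F3 0 \<noteq> 0"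
  shows "g_fps (fps_dilate c F1) (fps_dilate c F2) (fps_dilate c F3)
       = fps_const c * fps_dilate c (g_fps F1 F2 F3)"
proof -
  have "fps_log_deriv (fps_dilate c F) = fps_const c * fps_dilate c (fps_log_deriv F)" if "fps_nth F 0 \<noteq> 0" for F
    using that by (simp add: fps_log_deriv_def fps_deriv_dilate fps_dilate_mult fps_dilate_inverse mult.assoc)
  then show ?thesis
    unfolding g_fps_def fps_dilate_def
    by (simp add: assms fps_compose_add_distrib fps_compose_sub_distrib fps_compose_mult_distrib algebra_simps)
qed

lemma h_fps_commute: "h_fps F1 F2 F3 = h_fps F1 F3 F2"
  and g_fps_commute: "g_fps F1 F2 F3 = g_fps F1 F3 F2"
  by (simp_all add: h_fps_def g_fps_def mult_ac add_ac)

text \<open>The factor j = c\<tau> + d in r(z, g\<tau>) = j r'(jz, \<tau>) turns the z in front of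
  the quotient into jz. So the series becomes an exact dilation with constant term still 1, and no
  automorphy factor is left over.\<close>

lemma quotient_fps_moebius:
  assumes \<tau>: "\<tau> \<in> upper_half_plane" and det: "a * d - b * c = (1::int)"
    and \<alpha>\<beta>: "(\<alpha>, \<beta>) \<in> sign_pairs" and \<alpha>\<beta>': "(\<alpha> powi a * \<beta> powi (- c), \<alpha> powi (- b) * \<beta> powi d) = (\<alpha>', \<beta>')"
  shows "quotient_fps (theta_with_multipliers \<alpha> \<beta>) ((of_int a * \<tau> + of_int b) / (of_int c * \<tau> + of_int d))
       = fps_dilate (of_int c * \<tau> + of_int d) (quotient_fps (theta_with_multipliers \<alpha>' \<beta>') \<tau>)"
proof -
  let ?j = "of_int c * \<tau> + of_int d" and ?\<tau> = "(of_int a * \<tau> + of_int b) / (of_int c * \<tau> + of_int d)"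
  have j: "?j \<noteq> 0"
    by (rule cocycle_nonzero[OF \<tau> det])
  have th: "theta_with_multipliers \<gamma> \<delta> \<in> {theta1, theta2, theta3}" for \<gamma> \<delta>
    by (simp add: theta_with_multipliers_def)
  obtain G where G: "G has_fps_expansion quotient_fps (theta_with_multipliers \<alpha>' \<beta>') \<tau>"
      "eventually (\<lambda>z. z * theta_quotient (theta_with_multipliers \<alpha>' \<beta>') z \<tau> = G z) (at 0)"
    by (rule quotient_fps_expansion[OF \<tau> th])
  have lim: "filterlim (\<lambda>w. ?j * w) (at 0) (at 0)"
    using j by (auto simp: filterlim_at eventually_at_filter intro!: tendsto_eq_intros)
  have "taylor (\<lambda>z \<tau>. z * theta_quotient (theta_with_multipliers \<alpha> \<beta>) z \<tau>) ?\<tau>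
      = fps_dilate ?j (quotient_fps (theta_with_multipliers \<alpha>' \<beta>') \<tau>)"
  proof (rule taylor_eqI)
    have "(G \<circ> (\<lambda>z. ?j * z)) has_fps_expansion fps_dilate ?j (quotient_fps (theta_with_multipliers \<alpha>' \<beta>') \<tau>)"
      unfolding fps_dilate_def by (intro has_fps_expansion_compose G(1) fps_expansion_intros) simp
    then show "(\<lambda>z. G (?j * z)) has_fps_expansion fps_dilate ?j (quotient_fps (theta_with_multipliers \<alpha>' \<beta>') \<tau>)"
      by (simp add: o_def)
    have "eventually (\<lambda>z. z \<notin> lattice \<tau> \<and> z * theta_quotient (theta_with_multipliers \<alpha>' \<beta>') z \<tau> = G z) (at 0)"
      using G(2) eventually_not_in_lattice[OF \<tau>] by eventually_elim simp
    then have "eventually (\<lambda>z. ?j * z \<notin> lattice \<tau> \<and>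
        ?j * z * theta_quotient (theta_with_multipliers \<alpha>' \<beta>') (?j * z) \<tau> = G (?j * z)) (at 0)"
      by (rule eventually_compose_filterlim[OF _ lim])
    then show "eventually (\<lambda>z. z * theta_quotient (theta_with_multipliers \<alpha> \<beta>) z ?\<tau> = G (?j * z)) (at 0)"
    proof eventually_elim
      case (elim z)
      then have "theta_quotient (theta_with_multipliers \<alpha> \<beta>) z ?\<tau> / ?j
          = theta_quotient (theta_with_multipliers \<alpha>' \<beta>') (?j * z) \<tau>"
        using theta_quotient_moebius[OF \<tau> det \<alpha>\<beta> \<alpha>\<beta>', of "?j * z"]
        unfolding nonzero_mult_div_cancel_left[OF j] by simp
      moreover have "z * x = ?j * z * (x / ?j)" for x
        using j by simp
      ultimately show ?case
        using elim by metis
    qed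
  qed
  then show ?thesis
    using taylor_theta_quotient[OF moebius_in_upper_half_plane[OF \<tau> det] th] by simp
qed

section \<open>The degree grading of forms\<close>

lemma form_at_zero [simp]: "form_at 0 vs = 0"
  and form_at_one [simp]: "form_at 1 vs = (if vs = [] then 1 else 0)"
  and form_at_add [simp]: "form_at (\<alpha> + \<beta>) vs = form_at \<alpha> vs + form_at \<beta> vs"
  and form_at_mult: "form_at (\<alpha> * \<beta>) vs = shuffle_prod (form_at \<alpha>) (form_at \<beta>) vs"
  by (simp_all add: form_defs one_fun_def)

lemma form_at_sum [simp]: "form_at (sum \<omega> I) vs = (\<Sum>i\<in>I. form_at (\<omega> i) vs)"
  by (induction I rule: infinite_finite_induct) auto

lemma form_at_scale_form [simp]: "form_at (scale_form c \<omega>) vs = c * form_at \<omega> vs"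
  by (simp add: scale_form_def)

lemma form_at_degree_part [simp]: "form_at (degree_part d \<omega>) vs = (if length vs = d then form_at \<omega> vs else 0)"
  by (simp add: degree_part_def)

lemma form_at_fps_at_matrix [simp]:
  "form_at (fps_at_matrix f R $ i $ j) vs = (\<Sum>n\<le>length vs. fps_nth f n * form_at (matrix_power R n $ i $ j) vs)"
  by (simp add: fps_at_matrix_def)

lemma scale_form_scale_form [simp]: "scale_form c (scale_form d \<omega>) = scale_form (c * d) \<omega>"
  by (auto intro!: form_eqI)

lemma scale_form_mult_left: "scale_form c \<alpha> * \<beta> = scale_form c (\<alpha> * \<beta>)"
  and scale_form_mult_right: "\<alpha> * scale_form c \<beta> = scale_form c (\<alpha> * \<beta>)"
  by (auto intro!: form_eqI sum.cong simp: form_at_mult shuffle_prod_def sum_distrib_left)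

lemma scale_form_sum: "scale_form c (sum \<omega> I) = (\<Sum>i\<in>I. scale_form c (\<omega> i))"
  by (auto intro!: form_eqI simp: sum_distrib_left)

definition rescale :: "complex \<Rightarrow> 't form \<Rightarrow> 't form" where
  "rescale s \<omega> = Form (\<lambda>vs. s ^ length vs * form_at \<omega> vs)"

lemma form_at_rescale [simp]: "form_at (rescale s \<omega>) vs = s ^ length vs * form_at \<omega> vs"
  by (simp add: rescale_def)

lemma length_nths_Compl: "length (nths vs S) + length (nths vs (- S)) = length vs"
proof -
  have "{i. i < length vs \<and> i \<in> S} = {..<length vs} \<inter> S"
    "{i. i < length vs \<and> i \<in> - S} = {..<length vs} - S"
    by auto
  then show ?thesis
    using card_Int_Diff[of "{..<length vs}" S] by (simp only: length_nths) simp
qed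

text \<open>Each term of the wedge product evaluates its factors on complementary sublists, whose
  lengths add up. Thus \<open>rescale s\<close> is a ring homomorphism and passes through powers,
  traces and exponentials.\<close>

lemma rescale_mult:
  fixes \<alpha> \<beta> :: "'t form"
  shows "rescale s (\<alpha> * \<beta>) = rescale s \<alpha> * rescale s \<beta>"
proof (rule form_eqI)
  fix vs :: "'t list"
  have *: "s ^ length vs * (e * a * b)
      = e * (s ^ length (nths vs S) * a) * (s ^ length (nths vs (- S)) * b)" for S e a b
    by (subst length_nths_Compl[of vs S, symmetric]) (simp only: power_add mult_ac)
  show "form_at (rescale s (\<alpha> * \<beta>)) vs = form_at (rescale s \<alpha> * rescale s \<beta>) vs"
    unfolding form_at_mult form_at_rescale shuffle_prod_def sum_distrib_left by (intro sum.cong refl *)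
qed

lemma rescale_1 [simp]: "rescale s 1 = 1"
  by (rule form_eqI) simp

lemma rescale_sum: "rescale s (sum \<omega> I) = (\<Sum>i\<in>I. rescale s (\<omega> i))"
  by (rule form_eqI) (simp add: sum_distrib_left)

lemma rescale_scale_form: "rescale s (scale_form c \<omega>) = scale_form c (rescale s \<omega>)"
  by (rule form_eqI) simp

lemma rescale_power: "rescale s (\<omega> ^ n) = rescale s \<omega> ^ n"
  by (induction n) (auto simp: rescale_mult)

lemma rescale_fps_at_form: "fps_at_form f (rescale s \<omega>) = rescale s (fps_at_form f \<omega>)"
  by (auto intro!: form_eqI sum.cong simp: fps_at_form_def sum_distrib_left simp flip: rescale_power)

definition pure_form :: "nat \<Rightarrow> 't form \<Rightarrow> bool" where
  "pure_form d \<omega> \<longleftrightarrow> (\<forall>vs. length vs \<noteq> d \<longrightarrow> form_at \<omega> vs = 0)"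

lemma rescale_pure_form: "pure_form d \<omega> \<Longrightarrow> rescale s \<omega> = scale_form (s ^ d) \<omega>"
  unfolding pure_form_def by (intro form_eqI) (metis form_at_rescale form_at_scale_form mult_zero_right)

lemma rescale_matrix_power:
  assumes "\<And>i j. pure_form 2 (R $ i $ j)"
  shows "rescale s (matrix_power R n $ i $ j) = scale_form ((s\<^sup>2) ^ n) (matrix_power R n $ i $ j)"
proof (induction n arbitrary: i j)
  case 0
  show ?case
    by (auto intro!: form_eqI simp: mat_def)
next
  case (Suc n)
  then show ?case
    using rescale_pure_form[OF assms, of s]
    by (simp add: matrix_matrix_mult_def rescale_sum rescale_mult scale_form_sum scale_form_mult_left
        scale_form_mult_right mult_ac)
qed

text \<open>The n-th power of a matrix of 2-forms has degree 2n: on a list of another length both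
  sides of the identity in the proof are 0, and otherwise s^2 to the power n equals s to the
  length.\<close>

lemma fps_at_matrix_dilate:
  assumes "\<And>i j. pure_form 2 (R $ i $ j)"
  shows "fps_at_matrix (fps_dilate (s\<^sup>2) f) R $ i $ j = rescale s (fps_at_matrix f R $ i $ j)"
proof (rule form_eqI)
  fix vs
  have *: "(s\<^sup>2) ^ n * form_at (matrix_power R n $ i $ j) vs = s ^ length vs * form_at (matrix_power R n $ i $ j) vs" for n
    using arg_cong[OF rescale_matrix_power[OF assms, of s n i j, symmetric], of "\<lambda>\<omega>. form_at \<omega> vs"]
    by (simp only: form_at_rescale form_at_scale_form)
  show "form_at (fps_at_matrix (fps_dilate (s\<^sup>2) f) R $ i $ j) vs = form_at (rescale s (fps_at_matrix f R $ i $ j)) vs"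
    unfolding form_at_fps_at_matrix form_at_rescale sum_distrib_left
    using * by (intro sum.cong refl) (simp add: mult.assoc mult.left_commute[of "s ^ length vs"] mult.left_commute[of "(s\<^sup>2) ^ _"])
qed

text \<open>Constant term 1 makes \<open>f - 1\<close> a series without constant term, so the
  dilation passes through the composition with the logarithm; from there on it is carried by the
  forms.\<close>

lemma det_half_dilate:
  assumes "\<And>i j. pure_form 2 (R $ i $ j)" "fps_nth f 0 = 1"
  shows "det_half (fps_dilate (s\<^sup>2) f) R = rescale s (det_half f R)"
proof -
  have "fps_dilate (s\<^sup>2) f - 1 = fps_dilate (s\<^sup>2) (f - 1)"
    by (simp add: fps_eq_iff algebra_simps)
  then have "fps_compose (fps_ln 1) (fps_dilate (s\<^sup>2) f - 1)
      = fps_dilate (s\<^sup>2) (fps_compose (fps_ln 1) (f - 1))"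
    using assms(2) by (simp add: fps_compose_dilate)
  moreover have "trace (fps_at_matrix (fps_dilate (s\<^sup>2) F) R) = rescale s (trace (fps_at_matrix F R))" for F
    by (simp add: trace_def rescale_sum fps_at_matrix_dilate[OF assms(1)])
  ultimately show ?thesis
    by (simp add: det_half_def flip: rescale_scale_form rescale_fps_at_form)
qed

section \<open>Scaling of the transgressed form\<close>

definition transgression_integrand :: "complex fps \<Rightarrow> complex fps \<Rightarrow> complex fps \<Rightarrow>
    't form^'n^'n \<Rightarrow> 't form^'r^'r \<Rightarrow> 't form^'r^'r \<Rightarrow> 't form" where
  "transgression_integrand f h g RT R B =
     det_half f RT * det_half h R * trace (B ** fps_at_matrix g R)"

text \<open>The series g brings a factor s^2. One s is absorbed in rescaling the 1-form B, the other
  remains in front; this is what makes the exponent even in the odd degree 4k-1.\<close>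

lemma transgression_integrand_dilate:
  assumes RT: "\<And>i j. pure_form 2 (RT $ i $ j)" and R: "\<And>i j. pure_form 2 (R $ i $ j)"
    and B: "\<And>i j. pure_form 1 (B $ i $ j)"
    and f: "fps_nth f 0 = 1" and h: "fps_nth h 0 = 1" and s: "s \<noteq> 0"
  shows "transgression_integrand (fps_dilate (s\<^sup>2) f) (fps_dilate (s\<^sup>2) h)
           (fps_const (s\<^sup>2) * fps_dilate (s\<^sup>2) g) RT R B
       = scale_form s (rescale s (transgression_integrand f h g RT R B))"
proof -
  have 1: "fps_at_matrix (fps_const (s\<^sup>2) * G) R $ i $ j = scale_form (s\<^sup>2) (fps_at_matrix G R $ i $ j)" for G i j
    by (auto intro!: form_eqI simp: sum_distrib_left mult_ac)
  have 2: "scale_form (s\<^sup>2) (B $ i $ k * rescale s \<omega>) = scale_form s (rescale s (B $ i $ k * \<omega>))" for i k \<omega>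
    by (simp add: rescale_mult rescale_pure_form[OF B] scale_form_mult_left power2_eq_square)
  have "trace (B ** fps_at_matrix (fps_const (s\<^sup>2) * fps_dilate (s\<^sup>2) g) R)
      = scale_form s (rescale s (trace (B ** fps_at_matrix g R)))"
    by (simp add: trace_def matrix_matrix_mult_def 1 2 fps_at_matrix_dilate[OF R] scale_form_mult_right
        scale_form_sum rescale_sum)
  then show ?thesis
    by (simp add: transgression_integrand_def det_half_dilate[OF RT f] det_half_dilate[OF R h]
        scale_form_mult_right rescale_mult)
qed

lemma degree_part_integral_dilate:
  assumes "\<And>t. \<omega>' t = scale_form s (rescale s (\<omega> t))"
  shows "degree_part d (integral_form I \<omega>') = scale_form (s ^ Suc d) (degree_part d (integral_form I \<omega>))"
proof (rule form_eqI)
  fix vs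
  have "form_at (integral_form I \<omega>') vs = integral I (\<lambda>t. s * s ^ length vs * form_at (\<omega> t) vs)"
    by (simp add: integral_form_def assms mult_ac)
  \<comment> \<open>\<open>integral\<close> commutes with constant factors also for non-integrable
    functions, by its default value 0.\<close>
  also have "\<dots> = s * s ^ length vs * form_at (integral_form I \<omega>) vs"
    by (simp add: integral_form_def)
  finally show "form_at (degree_part d (integral_form I \<omega>')) vs
      = form_at (scale_form (s ^ Suc d) (degree_part d (integral_form I \<omega>))) vs"
    by simp
qed

section \<open>Forms depending polynomially on $t$ and holomorphically on $\tau$\<close>

text \<open>The degree bound N is uniform in \<tau>. The integral over t is then a fixed finite
  combination of holomorphic coefficients with the moments of t, which replaces differentiation
  under the integral sign.\<close>

definition holomorphic_poly :: "complex set \<Rightarrow> (complex \<Rightarrow> real \<Rightarrow> complex) \<Rightarrow> bool" where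
  "holomorphic_poly S F \<longleftrightarrow> (\<exists>P N. (\<forall>\<tau>\<in>S. \<forall>t. F \<tau> t = poly (P \<tau>) (of_real t)) \<and>
     (\<forall>\<tau>\<in>S. degree (P \<tau>) \<le> N) \<and> (\<forall>i. (\<lambda>\<tau>. coeff (P \<tau>) i) holomorphic_on S))"

lemma holomorphic_polyI:
  assumes "\<And>\<tau> t. \<tau> \<in> S \<Longrightarrow> F \<tau> t = poly (P \<tau>) (of_real t)" "\<And>\<tau>. \<tau> \<in> S \<Longrightarrow> degree (P \<tau>) \<le> N"
    "\<And>i. (\<lambda>\<tau>. coeff (P \<tau>) i) holomorphic_on S"
  shows "holomorphic_poly S F"
  unfolding holomorphic_poly_def using assms by blast

lemma holomorphic_poly_holomorphic:
  assumes "a holomorphic_on S"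
  shows "holomorphic_poly S (\<lambda>\<tau> t. a \<tau>)"
proof (rule holomorphic_polyI[where P = "\<lambda>\<tau>. [:a \<tau>:]" and N = 0])
  show "(\<lambda>\<tau>. coeff [:a \<tau>:] i) holomorphic_on S" for i
    using assms by (cases i) (auto simp: coeff_pCons)
qed auto

lemma holomorphic_poly_const [simp]: "holomorphic_poly S (\<lambda>\<tau> t. c)"
  by (rule holomorphic_poly_holomorphic) auto

lemma holomorphic_poly_poly: "holomorphic_poly S (\<lambda>\<tau> t. poly p (of_real t))"
  by (rule holomorphic_polyI[where P = "\<lambda>_. p" and N = "degree p"]) auto

lemma holomorphic_poly_add:
  assumes "holomorphic_poly S F" "holomorphic_poly S G"
  shows "holomorphic_poly S (\<lambda>\<tau> t. F \<tau> t + G \<tau> t)"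
proof -
  obtain P N where P: "\<And>\<tau> t. \<tau> \<in> S \<Longrightarrow> F \<tau> t = poly (P \<tau>) (of_real t)" "\<And>\<tau>. \<tau> \<in> S \<Longrightarrow> degree (P \<tau>) \<le> N"
    "\<And>i. (\<lambda>\<tau>. coeff (P \<tau>) i) holomorphic_on S"
    using assms(1) unfolding holomorphic_poly_def by metis
  obtain Q M where Q: "\<And>\<tau> t. \<tau> \<in> S \<Longrightarrow> G \<tau> t = poly (Q \<tau>) (of_real t)" "\<And>\<tau>. \<tau> \<in> S \<Longrightarrow> degree (Q \<tau>) \<le> M"
    "\<And>i. (\<lambda>\<tau>. coeff (Q \<tau>) i) holomorphic_on S"
    using assms(2) unfolding holomorphic_poly_def by metis
  show ?thesis
  proof (rule holomorphic_polyI[where P = "\<lambda>\<tau>. P \<tau> + Q \<tau>" and N = "max N M"])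
    show "degree (P \<tau> + Q \<tau>) \<le> max N M" if "\<tau> \<in> S" for \<tau>
      using P(2)[OF that] Q(2)[OF that] by (intro degree_add_le) auto
  qed (auto simp: P Q intro!: holomorphic_intros)
qed

lemma holomorphic_poly_mult:
  assumes "holomorphic_poly S F" "holomorphic_poly S G"
  shows "holomorphic_poly S (\<lambda>\<tau> t. F \<tau> t * G \<tau> t)"
proof -
  obtain P N where P: "\<And>\<tau> t. \<tau> \<in> S \<Longrightarrow> F \<tau> t = poly (P \<tau>) (of_real t)" "\<And>\<tau>. \<tau> \<in> S \<Longrightarrow> degree (P \<tau>) \<le> N"
    "\<And>i. (\<lambda>\<tau>. coeff (P \<tau>) i) holomorphic_on S"
    using assms(1) unfolding holomorphic_poly_def by metis
  obtain Q M where Q: "\<And>\<tau> t. \<tau> \<in> S \<Longrightarrow> G \<tau> t = poly (Q \<tau>) (of_real t)" "\<And>\<tau>. \<tau> \<in> S \<Longrightarrow> degree (Q \<tau>) \<le> M"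
    "\<And>i. (\<lambda>\<tau>. coeff (Q \<tau>) i) holomorphic_on S"
    using assms(2) unfolding holomorphic_poly_def by metis
  show ?thesis
  proof (rule holomorphic_polyI[where P = "\<lambda>\<tau>. P \<tau> * Q \<tau>" and N = "N + M"])
    show "degree (P \<tau> * Q \<tau>) \<le> N + M" if "\<tau> \<in> S" for \<tau>
      using P(2)[OF that] Q(2)[OF that] degree_mult_le[of "P \<tau>" "Q \<tau>"] by simp
  qed (auto simp: P Q coeff_mult intro!: holomorphic_intros)
qed

lemma holomorphic_poly_sum:
  "(\<And>i. i \<in> I \<Longrightarrow> holomorphic_poly S (F i)) \<Longrightarrow> holomorphic_poly S (\<lambda>\<tau> t. \<Sum>i\<in>I. F i \<tau> t)"
  by (induction I rule: infinite_finite_induct) (auto intro: holomorphic_poly_add)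

lemma holomorphic_on_integral_holomorphic_poly:
  assumes "holomorphic_poly S F"
  shows "(\<lambda>\<tau>. integral {a..b} (F \<tau>)) holomorphic_on S"
proof -
  obtain P N where P: "\<And>\<tau> t. \<tau> \<in> S \<Longrightarrow> F \<tau> t = poly (P \<tau>) (of_real t)" "\<And>\<tau>. \<tau> \<in> S \<Longrightarrow> degree (P \<tau>) \<le> N"
    "\<And>i. (\<lambda>\<tau>. coeff (P \<tau>) i) holomorphic_on S"
    using assms unfolding holomorphic_poly_def by metis
  have "integral {a..b} (F \<tau>) = (\<Sum>i\<le>N. coeff (P \<tau>) i * integral {a..b} (\<lambda>t. of_real t ^ i))" if "\<tau> \<in> S" for \<tau>
  proof -
    \<comment> \<open>The sum runs to the uniform bound N; coefficients beyond the actual degree are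
      0.\<close>
    have "F \<tau> = (\<lambda>t. \<Sum>i\<le>N. coeff (P \<tau>) i * of_real t ^ i)"
      unfolding P(1)[OF that] poly_altdef using P(2)[OF that]
      by (intro ext sum.mono_neutral_left) (auto simp: coeff_eq_0)
    then have "integral {a..b} (F \<tau>) = (\<Sum>i\<le>N. integral {a..b} (\<lambda>t. coeff (P \<tau>) i * of_real t ^ i))"
      by (simp only:) (intro integral_sum integrable_continuous_interval continuous_intros, auto)
    then show ?thesis
      by simp
  qed
  moreover have "(\<lambda>\<tau>. \<Sum>i\<le>N. coeff (P \<tau>) i * integral {a..b} (\<lambda>t. of_real t ^ i)) holomorphic_on S"
    by (intro holomorphic_intros P)
  ultimately show ?thesis
    by (simp cong: holomorphic_cong)
qed

section \<open>Closure of this class under operations on forms\<close>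

definition holomorphic_poly_form :: "complex set \<Rightarrow> (complex \<Rightarrow> real \<Rightarrow> 't form) \<Rightarrow> bool" where
  "holomorphic_poly_form S W \<longleftrightarrow> (\<forall>vs. holomorphic_poly S (\<lambda>\<tau> t. form_at (W \<tau> t) vs))"

lemma holomorphic_poly_form_const [simp]: "holomorphic_poly_form S (\<lambda>\<tau> t. \<omega>)"
  by (simp add: holomorphic_poly_form_def)

lemma holomorphic_poly_form_mult:
  "holomorphic_poly_form S V \<Longrightarrow> holomorphic_poly_form S W \<Longrightarrow> holomorphic_poly_form S (\<lambda>\<tau> t. V \<tau> t * W \<tau> t)"
  by (auto simp: holomorphic_poly_form_def form_at_mult shuffle_prod_def
      intro!: holomorphic_poly_sum holomorphic_poly_mult)

lemma holomorphic_poly_form_sum: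
  "(\<And>i. i \<in> I \<Longrightarrow> holomorphic_poly_form S (W i)) \<Longrightarrow> holomorphic_poly_form S (\<lambda>\<tau> t. \<Sum>i\<in>I. W i \<tau> t)"
  by (auto simp: holomorphic_poly_form_def intro!: holomorphic_poly_sum)

lemma holomorphic_poly_form_scale:
  "holomorphic_poly_form S W \<Longrightarrow> holomorphic_poly_form S (\<lambda>\<tau> t. scale_form c (W \<tau> t))"
  by (auto simp: holomorphic_poly_form_def intro!: holomorphic_poly_mult)

lemma holomorphic_poly_form_power:
  "holomorphic_poly_form S W \<Longrightarrow> holomorphic_poly_form S (\<lambda>\<tau> t. W \<tau> t ^ n)"
  by (induction n) (auto intro: holomorphic_poly_form_mult)

lemma holomorphic_poly_form_fps_at_form:
  assumes "holomorphic_poly_form S W"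
  shows "holomorphic_poly_form S (\<lambda>\<tau> t. fps_at_form f (W \<tau> t))"
  using holomorphic_poly_form_power[OF assms]
  by (auto simp: holomorphic_poly_form_def fps_at_form_def intro!: holomorphic_poly_sum holomorphic_poly_mult)

lemma holomorphic_poly_form_matrix_mult:
  assumes "\<And>i j. holomorphic_poly_form S (\<lambda>\<tau> t. V \<tau> t $ i $ j)" "\<And>i j. holomorphic_poly_form S (\<lambda>\<tau> t. W \<tau> t $ i $ j)"
  shows "holomorphic_poly_form S (\<lambda>\<tau> t. (V \<tau> t ** W \<tau> t) $ i $ j)"
  using assms by (auto simp: matrix_matrix_mult_def intro!: holomorphic_poly_form_sum holomorphic_poly_form_mult)

lemma holomorphic_poly_form_fps_at_matrix:
  assumes f: "holomorphic_fps_on f S" and R: "\<And>i j. holomorphic_poly_form S (\<lambda>\<tau> t. R t $ i $ j)"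
  shows "holomorphic_poly_form S (\<lambda>\<tau> t. fps_at_matrix (f \<tau>) (R t) $ i $ j)"
proof -
  have "holomorphic_poly_form S (\<lambda>\<tau> t. matrix_power (R t) n $ i $ j)" for n i j
  proof (induction n arbitrary: i j)
    case (Suc n)
    then show ?case
      using holomorphic_poly_form_matrix_mult[of S "\<lambda>\<tau>. R" "\<lambda>\<tau> t. matrix_power (R t) n"] R by simp
  qed simp
  then show ?thesis
    by (auto simp: holomorphic_poly_form_def
        intro!: holomorphic_poly_sum holomorphic_poly_mult holomorphic_poly_holomorphic holomorphic_fps_onD[OF f])
qed

lemma holomorphic_poly_form_trace:
  "(\<And>i j. holomorphic_poly_form S (\<lambda>\<tau> t. W \<tau> t $ i $ j)) \<Longrightarrow> holomorphic_poly_form S (\<lambda>\<tau> t. trace (W \<tau> t))"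
  unfolding trace_def by (intro holomorphic_poly_form_sum)

lemma holomorphic_poly_form_det_half:
  assumes f: "holomorphic_fps_on f S" and R: "\<And>i j. holomorphic_poly_form S (\<lambda>\<tau> t. R t $ i $ j)"
  shows "holomorphic_poly_form S (\<lambda>\<tau> t. det_half (f \<tau>) (R t))"
  unfolding det_half_def
  by (intro holomorphic_poly_form_fps_at_form holomorphic_poly_form_scale holomorphic_poly_form_trace
      holomorphic_poly_form_fps_at_matrix R holomorphic_fps_on_compose holomorphic_fps_on_diff
      holomorphic_fps_on_constant f)

text \<open>The two parameters are separated: \<tau> enters only through the series, t only through
  the curvature R. Every value of the integrand is a finite sum of products of such terms.\<close>

lemma holomorphic_on_transgression:
  assumes "holomorphic_fps_on f S" "holomorphic_fps_on h S" "holomorphic_fps_on g S"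
    and "\<And>i j. holomorphic_poly_form S (\<lambda>\<tau> t. R t $ i $ j)"
  shows "(\<lambda>\<tau>. form_at (integral_form {a..b} (\<lambda>t. transgression_integrand (f \<tau>) (h \<tau>) (g \<tau>) RT (R t) B)) vs)
           holomorphic_on S"
proof -
  have "holomorphic_poly_form S (\<lambda>\<tau> t. transgression_integrand (f \<tau>) (h \<tau>) (g \<tau>) RT (R t) B)"
    unfolding transgression_integrand_def
    by (intro holomorphic_poly_form_mult holomorphic_poly_form_det_half holomorphic_poly_form_trace
        holomorphic_poly_form_matrix_mult holomorphic_poly_form_fps_at_matrix assms holomorphic_poly_form_const)
  then show ?thesis
    unfolding integral_form_def form_at_Form holomorphic_poly_form_def
    by (intro holomorphic_on_integral_holomorphic_poly) blast
qed

section \<open>Smooth functions on a manifold\<close>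

lemma frechet_derivative_eqI:
  "(f has_derivative f') (at x) \<Longrightarrow> frechet_derivative f (at x) v = f' v"
  using frechet_derivative_at by metis

lemma Ck_on_cong:
  assumes "open S" "\<And>x. x \<in> S \<Longrightarrow> f x = g x" "Ck_on k S f"
  shows "Ck_on k S g"
  using assms(2,3)
proof (induction k arbitrary: f g)
  case 0
  then show ?case
    by (simp cong: continuous_on_cong)
next
  case (Suc k)
  have f: "f differentiable (at x)" if "x \<in> S" for x
    using Suc.prems(2) that assms(1) by (simp add: differentiable_on_eq_differentiable_at)
  have "g differentiable (at x)" if x: "x \<in> S" for x
  proof -
    obtain D where "(f has_derivative D) (at x)"
      using f[OF x] by (auto simp: differentiable_def)
    then have "(g has_derivative D) (at x)"
      by (rule has_derivative_transform_within_open[OF _ assms(1) x Suc.prems(1)])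
    then show ?thesis
      by (auto simp: differentiable_def)
  qed
  then have "g differentiable_on S"
    using assms(1) by (simp add: differentiable_on_eq_differentiable_at)
  moreover have "frechet_derivative f (at x) = frechet_derivative g (at x)" if "x \<in> S" for x
    by (rule frechet_derivative_transform_within_open[OF f[OF that] assms(1) that Suc.prems(1)])
  ultimately show ?case
    using Suc.IH[of "\<lambda>x. frechet_derivative f (at x) _" "\<lambda>x. frechet_derivative g (at x) _"] Suc.prems(2)
    by simp
qed

lemma Ck_on_subset:
  assumes "open S" "open T" "T \<subseteq> S" "Ck_on k S f"
  shows "Ck_on k T f"
  using assms(4)
proof (induction k arbitrary: f)
  case 0
  with assms(3) show ?case
    by (auto intro: continuous_on_subset)
next
  case (Suc k)
  with assms(3) show ?case
    by (auto intro: differentiable_on_subset)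
qed

lemma Ck_on_SucD: "Ck_on (Suc k) S f \<Longrightarrow> Ck_on k S f"
proof (induction k arbitrary: f)
  case 0
  then show ?case
    by (simp add: differentiable_imp_continuous_on)
next
  case (Suc k)
  then show ?case
    by simp
qed

lemma Ck_on_const: "Ck_on k S (\<lambda>x. c)"
  by (induction k arbitrary: c) auto

lemma Ck_on_add:
  assumes "open S" "Ck_on k S f" "Ck_on k S g"
  shows "Ck_on k S (\<lambda>x. f x + g x)"
  using assms(2,3)
proof (induction k arbitrary: f g)
  case 0
  then show ?case
    by (auto intro: continuous_intros)
next
  case (Suc k)
  have d: "f differentiable (at x)" "g differentiable (at x)" if "x \<in> S" for x
    using Suc.prems that assms(1) by (simp_all add: differentiable_on_eq_differentiable_at)
  have D: "frechet_derivative (\<lambda>x. f x + g x) (at x) v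
      = frechet_derivative f (at x) v + frechet_derivative g (at x) v" if "x \<in> S" for x v
    using d[OF that] by (intro frechet_derivative_eqI has_derivative_add) (simp_all add: frechet_derivative_works)
  have "Ck_on k S (\<lambda>x. frechet_derivative (\<lambda>x. f x + g x) (at x) v)" for v
    by (rule Ck_on_cong[OF assms(1) _ Suc.IH[of "\<lambda>x. frechet_derivative f (at x) v" "\<lambda>x. frechet_derivative g (at x) v"]])
       (use Suc.prems in \<open>simp_all add: D\<close>)
  moreover have "(\<lambda>x. f x + g x) differentiable_on S"
    using Suc.prems by (intro differentiable_on_add) simp_all
  ultimately show ?case
    by simp
qed

text \<open>Leibniz's rule multiplies derivatives by the functions themselves, so the induction step
  also needs f and g at the lower order k.\<close>

lemma Ck_on_mult:
  fixes f g :: "'a::euclidean_space \<Rightarrow> real"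
  assumes "open S" "Ck_on k S f" "Ck_on k S g"
  shows "Ck_on k S (\<lambda>x. f x * g x)"
  using assms(2,3)
proof (induction k arbitrary: f g)
  case 0
  then show ?case
    by (auto intro: continuous_intros)
next
  case (Suc k)
  have d: "f differentiable (at x)" "g differentiable (at x)" if "x \<in> S" for x
    using Suc.prems that assms(1) by (simp_all add: differentiable_on_eq_differentiable_at)
  have D: "frechet_derivative (\<lambda>x. f x * g x) (at x) v
      = f x * frechet_derivative g (at x) v + frechet_derivative f (at x) v * g x" if "x \<in> S" for x v
    using d[OF that] by (intro frechet_derivative_eqI has_derivative_mult) (simp_all add: frechet_derivative_works)
  have "Ck_on k S (\<lambda>x. frechet_derivative (\<lambda>x. f x * g x) (at x) v)" for v
  proof (rule Ck_on_cong[OF assms(1)])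
    show "Ck_on k S (\<lambda>x. f x * frechet_derivative g (at x) v + frechet_derivative f (at x) v * g x)"
      using Suc.prems Ck_on_SucD[of k S f] Ck_on_SucD[of k S g]
      by (intro Ck_on_add assms(1) Suc.IH) auto
  qed (simp add: D)
  moreover have "(\<lambda>x. f x * g x) differentiable_on S"
    using Suc.prems by (intro differentiable_on_mult) simp_all
  ultimately show ?case
    by simp
qed

lemma Ck_on_sum:
  assumes "open S" "\<And>i. i \<in> I \<Longrightarrow> Ck_on k S (f i)"
  shows "Ck_on k S (\<lambda>x. \<Sum>i\<in>I. f i x)"
  using assms(2) by (induction I rule: infinite_finite_induct) (auto intro: Ck_on_add Ck_on_const assms(1))

lemma Ck_on_vec_nth:
  fixes h :: "'a::euclidean_space \<Rightarrow> real^'n"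
  assumes "open S" "Ck_on k S h"
  shows "Ck_on k S (\<lambda>x. h x $ i)"
  using assms(2)
proof (induction k arbitrary: h)
  case 0
  then show ?case
    by (auto intro: continuous_intros)
next
  case (Suc k)
  have "((\<lambda>x. h x $ i) has_derivative (\<lambda>v. frechet_derivative h (at x) v $ i)) (at x)" if "x \<in> S" for x
    using Suc.prems that assms(1)
    by (intro bounded_linear.has_derivative[OF bounded_linear_vec_nth])
       (simp add: differentiable_on_eq_differentiable_at frechet_derivative_works)
  note D = this
  have "Ck_on k S (\<lambda>x. frechet_derivative (\<lambda>x. h x $ i) (at x) v)" for v
    by (rule Ck_on_cong[OF assms(1) _ Suc.IH[of "\<lambda>x. frechet_derivative h (at x) v"]])
       (use Suc.prems in \<open>simp_all add: frechet_derivative_eqI[OF D]\<close>)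
  moreover have "(\<lambda>x. h x $ i) differentiable_on S"
    using D assms(1) by (auto simp: differentiable_on_eq_differentiable_at differentiable_def)
  ultimately show ?case
    by simp
qed

text \<open>\<open>Ck_on\<close> controls derivatives in fixed directions, while the chain rule
  differentiates g in the direction Dh(x)v, which varies with x. Expanding this direction in the
  standard basis gives a sum of products to which the induction hypothesis applies.\<close>

lemma Ck_on_compose:
  fixes g :: "real^'n \<Rightarrow> real" and h :: "'a::euclidean_space \<Rightarrow> real^'n"
  assumes S: "open S" and T: "open T" and hS: "h ` S \<subseteq> T" and g: "Ck_on k T g" and h: "Ck_on k S h"
  shows "Ck_on k S (\<lambda>x. g (h x))"
  using g h
proof (induction k arbitrary: g)
  case 0
  then show ?case
    using hS by (auto intro: continuous_on_compose2)
next
  case (Suc k)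
  have dg: "(g has_derivative frechet_derivative g (at (h x))) (at (h x))" if "x \<in> S" for x
  proof -
    have "h x \<in> T"
      using hS that by blast
    with Suc.prems(1) T show ?thesis
      by (simp add: differentiable_on_eq_differentiable_at frechet_derivative_works)
  qed
  have dh: "(h has_derivative frechet_derivative h (at x)) (at x)" if "x \<in> S" for x
    using Suc.prems(2) S that by (simp add: differentiable_on_eq_differentiable_at frechet_derivative_works)
  have D: "((\<lambda>x. g (h x)) has_derivative
      (\<lambda>v. \<Sum>i\<in>UNIV. frechet_derivative h (at x) v $ i * frechet_derivative g (at (h x)) (axis i 1))) (at x)"
    if "x \<in> S" for x
  proof -
    have lin: "linear (frechet_derivative g (at (h x)))"
      by (rule has_derivative_linear[OF dg[OF that]])
    have *: "frechet_derivative g (at (h x)) (\<Sum>i\<in>UNIV. w $ i *s axis i 1)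
        = (\<Sum>i\<in>UNIV. w $ i * frechet_derivative g (at (h x)) (axis i 1))" for w
      unfolding linear_sum[OF lin] scalar_mult_eq_scaleR linear_cmul[OF lin] real_scaleR_def ..
    have "(\<lambda>v. frechet_derivative g (at (h x)) (frechet_derivative h (at x) v))
        = (\<lambda>v. \<Sum>i\<in>UNIV. frechet_derivative h (at x) v $ i * frechet_derivative g (at (h x)) (axis i 1))"
      by (rule ext) (rule *[unfolded basis_expansion])
    with has_derivative_compose[OF dh[OF that] dg[OF that]] show ?thesis
      by (simp only:)
  qed
  have "Ck_on k S (\<lambda>x. frechet_derivative (\<lambda>x. g (h x)) (at x) v)" for v
  proof (rule Ck_on_cong[OF S])
    show "Ck_on k S (\<lambda>x. \<Sum>i\<in>UNIV. frechet_derivative h (at x) v $ i * frechet_derivative g (at (h x)) (axis i 1))"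
      using Suc.prems Ck_on_SucD[of k S h] by (intro Ck_on_sum Ck_on_mult Ck_on_vec_nth Suc.IH S) auto
  qed (simp add: frechet_derivative_eqI[OF D])
  moreover have "(\<lambda>x. g (h x)) differentiable_on S"
    using D S by (auto simp: differentiable_on_eq_differentiable_at differentiable_def)
  ultimately show ?case
    by simp
qed

section \<open>Transfer to functions on the manifold through charts\<close>

context smooth_manifold
begin

lemma chart_inv: "(U, \<phi>) \<in> A \<Longrightarrow> x \<in> U \<Longrightarrow> inv_into U \<phi> (\<phi> x) = x"
  using chart_homeomorphism by (fastforce simp: homeomorphism_def)

lemma open_chart_image:
  assumes c: "(U, \<phi>) \<in> A" and W: "open W"
  shows "open (\<phi> ` (U \<inter> W))"
proof -
  have "openin (top_of_set (\<phi> ` U)) (\<phi> ` (U \<inter> W))"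
    using chart_homeomorphism[OF c] W by (intro homeomorphism_imp_open_map) auto
  then show ?thesis
    using chart_open[OF c] by (simp add: openin_open_eq)
qed

lemma smooth_functionI:
  "(\<And>U \<phi> k. (U, \<phi>) \<in> A \<Longrightarrow> Ck_on k (\<phi> ` (U \<inter> W)) (f \<circ> inv_into U \<phi>)) \<Longrightarrow> smooth_function A W f"
  by (auto simp: smooth_function_def smooth_on_def)

lemma smooth_functionD:
  "smooth_function A W f \<Longrightarrow> (U, \<phi>) \<in> A \<Longrightarrow> Ck_on k (\<phi> ` (U \<inter> W)) (f \<circ> inv_into U \<phi>)"
  by (auto simp: smooth_function_def smooth_on_def)

lemma smooth_function_cong:
  assumes "open W" "\<And>x. x \<in> W \<Longrightarrow> f x = g x" "smooth_function A W f"
  shows "smooth_function A W g"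
proof (rule smooth_functionI)
  fix U \<phi> k assume c: "(U, \<phi>) \<in> A"
  show "Ck_on k (\<phi> ` (U \<inter> W)) (g \<circ> inv_into U \<phi>)"
    by (rule Ck_on_cong[OF open_chart_image[OF c assms(1)] _ smooth_functionD[OF assms(3) c]])
       (use assms(2) chart_inv[OF c] in auto)
qed

lemma smooth_function_subset:
  assumes "open V" "open W" "V \<subseteq> W" "smooth_function A W f"
  shows "smooth_function A V f"
proof (rule smooth_functionI)
  fix U \<phi> k assume c: "(U, \<phi>) \<in> A"
  show "Ck_on k (\<phi> ` (U \<inter> V)) (f \<circ> inv_into U \<phi>)"
    using assms(3)
    by (intro Ck_on_subset[OF open_chart_image[OF c assms(2)] open_chart_image[OF c assms(1)] _
          smooth_functionD[OF assms(4) c]]) auto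
qed

lemma smooth_function_const: "smooth_function A W (\<lambda>x. c)"
  by (rule smooth_functionI) (simp add: o_def Ck_on_const)

lemma smooth_function_add:
  assumes "open W" "smooth_function A W f" "smooth_function A W g"
  shows "smooth_function A W (\<lambda>x. f x + g x)"
  using Ck_on_add[OF open_chart_image[OF _ assms(1)] smooth_functionD[OF assms(2)] smooth_functionD[OF assms(3)]]
  by (intro smooth_functionI) (simp add: o_def)

lemma smooth_function_mult:
  assumes "open W" "smooth_function A W f" "smooth_function A W g"
  shows "smooth_function A W (\<lambda>x. f x * g x)"
  using Ck_on_mult[OF open_chart_image[OF _ assms(1)] smooth_functionD[OF assms(2)] smooth_functionD[OF assms(3)]]
  by (intro smooth_functionI) (simp add: o_def)

lemma smooth_near_common:
  assumes "smooth_near A p f" "smooth_near A p g"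
  obtains W where "open W" "p \<in> W" "smooth_function A W f" "smooth_function A W g"
proof -
  obtain V W where "open V" "p \<in> V" "smooth_function A V f" "open W" "p \<in> W" "smooth_function A W g"
    using assms by (auto simp: smooth_near_def)
  then show ?thesis
    using that[of "V \<inter> W"] smooth_function_subset[of "V \<inter> W"] by auto
qed

lemma smooth_near_const: "smooth_near A p (\<lambda>x. c)"
  unfolding smooth_near_def using smooth_function_const[of UNIV c] open_UNIV by blast

lemma smooth_near_add: "smooth_near A p f \<Longrightarrow> smooth_near A p g \<Longrightarrow> smooth_near A p (\<lambda>x. f x + g x)"
  by (erule (1) smooth_near_common) (auto simp: smooth_near_def intro: smooth_function_add)

lemma smooth_near_mult: "smooth_near A p f \<Longrightarrow> smooth_near A p g \<Longrightarrow> smooth_near A p (\<lambda>x. f x * g x)"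
  by (erule (1) smooth_near_common) (auto simp: smooth_near_def intro: smooth_function_mult)

lemma eventually_smooth_near:
  "smooth_near A p f \<Longrightarrow> eventually (\<lambda>x. smooth_near A x f) (nhds p)"
  unfolding eventually_nhds smooth_near_def by blast

section \<open>Coordinate vector fields and their brackets\<close>

lemma tangent_spaceD:
  assumes "D \<in> tangent_space A p" "smooth_near A p f" "smooth_near A p g"
  shows "eventually (\<lambda>x. f x = g x) (nhds p) \<Longrightarrow> D f = D g"
    and "D (\<lambda>x. f x + g x) = D f + D g" "D (\<lambda>x. c * f x) = c * D f"
    and "D (\<lambda>x. f x * g x) = D f * g p + f p * D g"
  using assms unfolding tangent_space_def by blast+

lemma tangent_const:
  assumes "D \<in> tangent_space A p"
  shows "D (\<lambda>x. c) = 0"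
proof -
  have "D (\<lambda>x. 1 * 1) = D (\<lambda>x. 1) * 1 + 1 * D (\<lambda>x. 1)"
    by (rule tangent_spaceD(4)[OF assms smooth_near_const smooth_near_const])
  then have "D (\<lambda>x. 1) = 0"
    by simp
  then show ?thesis
    using tangent_spaceD(3)[OF assms smooth_near_const smooth_near_const, of c 1] by simp
qed

lemma smooth_near_has_derivative:
  assumes c: "(U, \<phi>) \<in> A" "p \<in> U" and f: "smooth_near A p f"
  shows "(f \<circ> inv_into U \<phi> has_derivative frechet_derivative (f \<circ> inv_into U \<phi>) (at (\<phi> p))) (at (\<phi> p))"
proof -
  obtain W where W: "open W" "p \<in> W" "smooth_function A W f"
    using f by (auto simp: smooth_near_def)
  have "Ck_on (Suc 0) (\<phi> ` (U \<inter> W)) (f \<circ> inv_into U \<phi>)"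
    by (rule smooth_functionD[OF W(3) c(1)])
  then have "(f \<circ> inv_into U \<phi>) differentiable (at (\<phi> p))"
    using open_chart_image[OF c(1) W(1)] c(2) W(2) by (auto simp: differentiable_on_eq_differentiable_at)
  then show ?thesis
    by (simp add: frechet_derivative_works)
qed

lemma coord_vector_in_tangent_space:
  assumes c: "(U, \<phi>) \<in> A" "p \<in> U"
  shows "coord_vector A (U, \<phi>) a p \<in> tangent_space A p"
proof -
  let ?D = "\<lambda>f. frechet_derivative (f \<circ> inv_into U \<phi>) (at (\<phi> p)) (axis a 1)"
  have cong: "?D f = ?D g" if f: "smooth_near A p f" and ev: "eventually (\<lambda>x. f x = g x) (nhds p)" for f g
  proof -
    obtain V where V: "open V" "p \<in> V" "\<And>x. x \<in> V \<Longrightarrow> f x = g x"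
      using ev by (auto simp: eventually_nhds)
    have "frechet_derivative (f \<circ> inv_into U \<phi>) (at (\<phi> p)) = frechet_derivative (g \<circ> inv_into U \<phi>) (at (\<phi> p))"
      using V c smooth_near_has_derivative[OF c f] chart_inv[OF c(1)]
      by (intro frechet_derivative_transform_within_open[OF _ open_chart_image[OF c(1) V(1)]])
         (auto simp: differentiable_def)
    then show ?thesis
      by simp
  qed
  have add: "?D (\<lambda>x. f x + g x) = ?D f + ?D g" if "smooth_near A p f" "smooth_near A p g" for f g
    using frechet_derivative_eqI[OF has_derivative_add[OF smooth_near_has_derivative[OF c that(1)]
          smooth_near_has_derivative[OF c that(2)]]]
    by (simp add: o_def)
  have mult: "?D (\<lambda>x. f x * g x) = ?D f * g p + f p * ?D g" if "smooth_near A p f" "smooth_near A p g" for f g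
    using frechet_derivative_eqI[OF has_derivative_mult[OF smooth_near_has_derivative[OF c that(1)]
          smooth_near_has_derivative[OF c that(2)]]] chart_inv[OF c]
    by (simp add: o_def)
  have const: "?D (\<lambda>x. d) = 0" for d
    by (simp add: o_def)
  have D: "coord_vector A (U, \<phi>) a p f = ?D f" if "smooth_near A p f" for f
    using that by (simp add: coord_vector_def)
  show ?thesis
    unfolding tangent_space_def mem_Collect_eq
  proof (intro conjI allI impI)
    fix f assume "\<not> smooth_near A p f"
    then show "coord_vector A (U, \<phi>) a p f = 0"
      by (simp add: coord_vector_def)
  next
    fix f g assume f: "smooth_near A p f" and g: "smooth_near A p g"
    show "coord_vector A (U, \<phi>) a p f = coord_vector A (U, \<phi>) a p g"
      if "eventually (\<lambda>x. f x = g x) (nhds p)"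
      unfolding D[OF f] D[OF g] by (rule cong[OF f that])
    show "coord_vector A (U, \<phi>) a p (\<lambda>x. f x + g x)
        = coord_vector A (U, \<phi>) a p f + coord_vector A (U, \<phi>) a p g"
      unfolding D[OF f] D[OF g] D[OF smooth_near_add[OF f g]] by (rule add[OF f g])
    show "coord_vector A (U, \<phi>) a p (\<lambda>x. f x * g x)
        = coord_vector A (U, \<phi>) a p f * g p + f p * coord_vector A (U, \<phi>) a p g"
      unfolding D[OF f] D[OF g] D[OF smooth_near_mult[OF f g]] by (rule mult[OF f g])
    show "coord_vector A (U, \<phi>) a p (\<lambda>x. d * f x) = d * coord_vector A (U, \<phi>) a p f" for d
      unfolding D[OF f] D[OF smooth_near_mult[OF smooth_near_const f]]
        mult[OF smooth_near_const f] const by simp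
  qed
qed

text \<open>In the chart \<phi> this is a partial derivative; in any other chart \<psi> it is that
  derivative composed with the transition map from \<psi> to \<phi>.\<close>

lemma smooth_function_coord_vector:
  assumes c: "(U, \<phi>) \<in> A" and W: "open W" and f: "smooth_function A W f"
  shows "smooth_function A (U \<inter> W) (\<lambda>x. coord_vector A (U, \<phi>) a x f)"
proof -
  have U: "open U"
    using chart_open[OF c] by simp
  define g where "g = (\<lambda>y. frechet_derivative (f \<circ> inv_into U \<phi>) (at y) (axis a 1))"
  have g: "Ck_on k (\<phi> ` (U \<inter> W)) g" for k
    using smooth_functionD[OF f c, of "Suc k"] by (simp add: g_def)
  have "smooth_function A (U \<inter> W) (\<lambda>x. g (\<phi> x))"
  proof (rule smooth_functionI)
    fix V \<psi> k assume d: "(V, \<psi>) \<in> A"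
    have "smooth_on (\<psi> ` (V \<inter> U)) (\<phi> \<circ> inv_into V \<psi>)"
      by (rule charts_compatible[OF d c])
    then have "Ck_on k (\<psi> ` (V \<inter> U)) (\<phi> \<circ> inv_into V \<psi>)"
      by (simp add: smooth_on_def)
    then have "Ck_on k (\<psi> ` (V \<inter> (U \<inter> W))) (\<phi> \<circ> inv_into V \<psi>)"
      by (rule Ck_on_subset[OF open_chart_image[OF d U] open_chart_image[OF d open_Int[OF U W]], rotated]) auto
    moreover have "(\<phi> \<circ> inv_into V \<psi>) ` \<psi> ` (V \<inter> (U \<inter> W)) \<subseteq> \<phi> ` (U \<inter> W)"
      using chart_inv[OF d] by auto
    ultimately have "Ck_on k (\<psi> ` (V \<inter> (U \<inter> W))) (\<lambda>y. g ((\<phi> \<circ> inv_into V \<psi>) y))"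
      by (intro Ck_on_compose[OF open_chart_image[OF d open_Int[OF U W]] open_chart_image[OF c W] _ g])
    then show "Ck_on k (\<psi> ` (V \<inter> (U \<inter> W))) ((\<lambda>x. g (\<phi> x)) \<circ> inv_into V \<psi>)"
      by (simp add: o_def)
  qed
  note smooth = this
  have eq: "g (\<phi> x) = coord_vector A (U, \<phi>) a x f" if "x \<in> U \<inter> W" for x
  proof -
    have "smooth_near A x f"
      unfolding smooth_near_def using that W f by blast
    then show ?thesis
      by (simp add: coord_vector_def g_def)
  qed
  show ?thesis
    by (rule smooth_function_cong[OF open_Int[OF U W] eq smooth])
qed

lemma smooth_near_coord_vector:
  assumes c: "(U, \<phi>) \<in> A" "p \<in> U" and f: "smooth_near A p f"
  shows "smooth_near A p (\<lambda>x. coord_vector A (U, \<phi>) a x f)"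
proof -
  obtain W where W: "open W" "p \<in> W" "smooth_function A W f"
    using f by (auto simp: smooth_near_def)
  moreover have "open U"
    using chart_open[OF c(1)] by simp
  ultimately show ?thesis
    unfolding smooth_near_def using smooth_function_coord_vector[OF c(1) W(1,3), of a] c(2)
    by (intro exI[of _ "U \<inter> W"]) auto
qed

text \<open>Ensures that the bracket term of the curvature is a covariant derivative along a genuine
  tangent vector and so lies in the fibre.\<close>

lemma lie_bracket_in_tangent_space:
  assumes U: "open U" "p \<in> U"
    and X: "\<And>x. x \<in> U \<Longrightarrow> X x \<in> tangent_space A x" "\<And>f. smooth_near A p f \<Longrightarrow> smooth_near A p (\<lambda>x. X x f)"
    and Y: "\<And>x. x \<in> U \<Longrightarrow> Y x \<in> tangent_space A x" "\<And>f. smooth_near A p f \<Longrightarrow> smooth_near A p (\<lambda>x. Y x f)"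
  shows "lie_bracket A X Y p \<in> tangent_space A p"
proof -
  have ev_U: "eventually (\<lambda>x. x \<in> U) (nhds p)"
    using U by (rule eventually_nhds_in_open)
  \<comment> \<open>This and the next facts are stated for arbitrary X and Y because each is applied
    a second time with the two fields exchanged.\<close>
  have cong: "X p (\<lambda>x. Y x f) = X p (\<lambda>x. Y x g)"
    if X: "\<And>x. x \<in> U \<Longrightarrow> X x \<in> tangent_space A x"
    and Y: "\<And>x. x \<in> U \<Longrightarrow> Y x \<in> tangent_space A x" "\<And>f. smooth_near A p f \<Longrightarrow> smooth_near A p (\<lambda>x. Y x f)"
    and fg: "smooth_near A p f" "smooth_near A p g" "eventually (\<lambda>x. f x = g x) (nhds p)" for X Y f g
  proof (rule tangent_spaceD(1)[OF X[OF U(2)] Y(2)[OF fg(1)] Y(2)[OF fg(2)]])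
    show "eventually (\<lambda>x. Y x f = Y x g) (nhds p)"
      using ev_U eventually_smooth_near[OF fg(1)] eventually_smooth_near[OF fg(2)]
        fg(3)[THEN eventually_eventually[THEN iffD2]]
      by eventually_elim (rule tangent_spaceD(1)[OF Y(1)])
  qed
  have add: "X p (\<lambda>x. Y x (\<lambda>x. f x + g x)) = X p (\<lambda>x. Y x f) + X p (\<lambda>x. Y x g)"
    if X: "\<And>x. x \<in> U \<Longrightarrow> X x \<in> tangent_space A x"
    and Y: "\<And>x. x \<in> U \<Longrightarrow> Y x \<in> tangent_space A x" "\<And>f. smooth_near A p f \<Longrightarrow> smooth_near A p (\<lambda>x. Y x f)"
    and fg: "smooth_near A p f" "smooth_near A p g" for X Y f g
  proof -
    have "eventually (\<lambda>x. Y x (\<lambda>x. f x + g x) = Y x f + Y x g) (nhds p)"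
      using ev_U eventually_smooth_near[OF fg(1)] eventually_smooth_near[OF fg(2)]
      by eventually_elim (rule tangent_spaceD(2)[OF Y(1)])
    then have "X p (\<lambda>x. Y x (\<lambda>x. f x + g x)) = X p (\<lambda>x. Y x f + Y x g)"
      by (rule tangent_spaceD(1)[OF X[OF U(2)] Y(2)[OF smooth_near_add[OF fg]]
            smooth_near_add[OF Y(2)[OF fg(1)] Y(2)[OF fg(2)]]])
    then show ?thesis
      using tangent_spaceD(2)[OF X[OF U(2)] Y(2)[OF fg(1)] Y(2)[OF fg(2)]] by simp
  qed
  \<comment> \<open>The two mixed terms are symmetric in X and Y and cancel in the commutator, which
    leaves Leibniz's rule.\<close>
  have mult: "X p (\<lambda>x. Y x (\<lambda>x. f x * g x))
      = X p (\<lambda>x. Y x f) * g p + Y p f * X p g + (X p f * Y p g + f p * X p (\<lambda>x. Y x g))"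
    if X: "\<And>x. x \<in> U \<Longrightarrow> X x \<in> tangent_space A x"
    and Y: "\<And>x. x \<in> U \<Longrightarrow> Y x \<in> tangent_space A x" "\<And>f. smooth_near A p f \<Longrightarrow> smooth_near A p (\<lambda>x. Y x f)"
    and fg: "smooth_near A p f" "smooth_near A p g" for X Y f g
  proof -
    note Yf = Y(2)[OF fg(1)] and Yg = Y(2)[OF fg(2)]
    have "eventually (\<lambda>x. Y x (\<lambda>x. f x * g x) = Y x f * g x + f x * Y x g) (nhds p)"
      using ev_U eventually_smooth_near[OF fg(1)] eventually_smooth_near[OF fg(2)]
      by eventually_elim (rule tangent_spaceD(4)[OF Y(1)])
    then have "X p (\<lambda>x. Y x (\<lambda>x. f x * g x)) = X p (\<lambda>x. Y x f * g x + f x * Y x g)"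
      by (rule tangent_spaceD(1)[OF X[OF U(2)] Y(2)[OF smooth_near_mult[OF fg]]
            smooth_near_add[OF smooth_near_mult[OF Yf fg(2)] smooth_near_mult[OF fg(1) Yg]]])
    also have "\<dots> = X p (\<lambda>x. Y x f * g x) + X p (\<lambda>x. f x * Y x g)"
      by (rule tangent_spaceD(2)[OF X[OF U(2)] smooth_near_mult[OF Yf fg(2)] smooth_near_mult[OF fg(1) Yg]])
    finally show ?thesis
      by (simp only: tangent_spaceD(4)[OF X[OF U(2)] Yf fg(2)] tangent_spaceD(4)[OF X[OF U(2)] fg(1) Yg])
  qed
  show ?thesis
    unfolding tangent_space_def mem_Collect_eq
  proof (intro conjI allI impI)
    fix f assume "\<not> smooth_near A p f"
    then show "lie_bracket A X Y p f = 0"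
      by (simp add: lie_bracket_def)
  next
    fix f g assume f: "smooth_near A p f" and g: "smooth_near A p g"
    show "lie_bracket A X Y p f = lie_bracket A X Y p g" if "eventually (\<lambda>x. f x = g x) (nhds p)"
      using cong[OF X(1) Y f g that] cong[OF Y(1) X f g that] f g by (simp add: lie_bracket_def)
    show "lie_bracket A X Y p (\<lambda>x. f x + g x) = lie_bracket A X Y p f + lie_bracket A X Y p g"
      using add[OF X(1) Y f g] add[OF Y(1) X f g] f g smooth_near_add[OF f g] by (simp add: lie_bracket_def)
    show "lie_bracket A X Y p (\<lambda>x. f x * g x) = lie_bracket A X Y p f * g p + f p * lie_bracket A X Y p g"
      using mult[OF X(1) Y f g] mult[OF Y(1) X f g] f g smooth_near_mult[OF f g]
      by (simp add: lie_bracket_def algebra_simps)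
    fix c
    have const: "X p (\<lambda>x. Y x (\<lambda>x. c)) = 0"
      if "\<And>x. x \<in> U \<Longrightarrow> X x \<in> tangent_space A x" "\<And>x. x \<in> U \<Longrightarrow> Y x \<in> tangent_space A x"
        "\<And>f. smooth_near A p f \<Longrightarrow> smooth_near A p (\<lambda>x. Y x f)" for X Y
    proof -
      have "eventually (\<lambda>x. Y x (\<lambda>x. c) = 0) (nhds p)"
        using ev_U by eventually_elim (rule tangent_const[OF that(2)])
      then have "X p (\<lambda>x. Y x (\<lambda>x. c)) = X p (\<lambda>x. 0)"
        by (rule tangent_spaceD(1)[OF that(1)[OF U(2)] that(3)[OF smooth_near_const] smooth_near_const])
      then show ?thesis
        using tangent_const[OF that(1)[OF U(2)]] by simp
    qed
    show "lie_bracket A X Y p (\<lambda>x. c * f x) = c * lie_bracket A X Y p f"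
      using mult[OF X(1) Y smooth_near_const f, of c] mult[OF Y(1) X smooth_near_const f, of c]
        const[OF X(1) Y] const[OF Y(1) X] tangent_const[OF X(1)[OF U(2)]] tangent_const[OF Y(1)[OF U(2)]]
        f smooth_near_mult[OF smooth_near_const f, of c]
      by (simp add: lie_bracket_def algebra_simps)
  qed
qed

end

section \<open>The curvature along a path of connections\<close>

lemma pure_form_scale_form: "pure_form d \<omega> \<Longrightarrow> pure_form d (scale_form c \<omega>)"
  by (simp add: pure_form_def)

lemma pure_form_curvature_matrix: "pure_form 2 (curvature_matrix A F nab p $ i $ j)"
  by (auto simp: pure_form_def curvature_matrix_def Let_def split: list.split)

context vector_bundle
begin

lemma coord_of_add:
  assumes "(V, e) \<in> F" "p \<in> V" "x \<in> E p" "y \<in> E p"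
  shows "coord_of (basis_at e p) (x + y) i = coord_of (basis_at e p) x i + coord_of (basis_at e p) y i"
  using frame_basis[OF assms(1,2)] assms(3,4) by (simp add: coord_of_def representation_add)

lemma coord_of_scale:
  assumes "(V, e) \<in> F" "p \<in> V" "x \<in> E p"
  shows "coord_of (basis_at e p) (c *\<^sub>R x) i = c * coord_of (basis_at e p) x i"
  using frame_basis[OF assms(1,2)] assms(3) by (simp add: coord_of_def representation_scale)

lemma subspace_fibre: "subspace (E p)"
proof -
  obtain V e where "(V, e) \<in> F" "p \<in> V"
    using frames_cover by blast
  then show ?thesis
    using frame_basis by (metis subspace_span)
qed

lemma smooth_section_frame:
  assumes "(V, e) \<in> F"
  shows "smooth_section A E F V (e j)"
proof -
  have "e j p \<in> E p" if "p \<in> V" for p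
    using frame_basis[OF assms that] span_base[of "e j p" "range (basis_at e p)"] by auto
  then show ?thesis
    using frames_compatible[OF _ assms] by (auto simp: smooth_section_def)
qed

lemma smooth_section_subset:
  assumes "open W" "open W'" "W \<subseteq> W'" "smooth_section A E F W' s"
  shows "smooth_section A E F W s"
  unfolding smooth_section_def
proof (intro conjI ballI, safe)
  show "s p \<in> E p" if "p \<in> W" for p
    using assms that by (auto simp: smooth_section_def)
  fix U e i assume "(U, e) \<in> F"
  moreover from this have "smooth_function A (U \<inter> W') (\<lambda>p. coord_of (basis_at e p) (s p) i)"
    using assms(4) by (auto simp: smooth_section_def)
  moreover have "open U"
    using frame_open \<open>(U, e) \<in> F\<close> .
  ultimately show "smooth_function A (U \<inter> W) (\<lambda>p. coord_of (basis_at e p) (s p) i)"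
    using assms(1-3) by (intro smooth_function_subset[of "U \<inter> W" "U \<inter> W'"]) auto
qed

lemma smooth_section_scale:
  assumes "open W" "smooth_section A E F W s"
  shows "smooth_section A E F W (\<lambda>x. c *\<^sub>R s x)"
  unfolding smooth_section_def
proof (intro conjI ballI, safe)
  have s: "s p \<in> E p" if "p \<in> W" for p
    using assms that by (auto simp: smooth_section_def)
  then show "c *\<^sub>R s p \<in> E p" if "p \<in> W" for p
    using that by (intro subspace_scale subspace_fibre)
  fix U e i assume Ue: "(U, e) \<in> F"
  then have UW: "open (U \<inter> W)"
    using frame_open assms(1) by auto
  have "smooth_function A (U \<inter> W) (\<lambda>p. coord_of (basis_at e p) (s p) i)"
    using assms(2) Ue by (auto simp: smooth_section_def)
  then have "smooth_function A (U \<inter> W) (\<lambda>p. c * coord_of (basis_at e p) (s p) i)"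
    by (intro smooth_function_mult UW smooth_function_const)
  then show "smooth_function A (U \<inter> W) (\<lambda>p. coord_of (basis_at e p) (c *\<^sub>R s p) i)"
    by (rule smooth_function_cong[OF UW, rotated]) (use s coord_of_scale[OF Ue] in auto)
qed

lemma connection_scale_section:
  assumes nab: "connection A E F nab" and W: "open W" "p \<in> W" and s: "smooth_section A E F W s"
    and v: "v \<in> tangent_space A p"
  shows "nab p v (\<lambda>x. c *\<^sub>R s x) = c *\<^sub>R nab p v s"
  using connection.nab_leibniz[OF nab W s smooth_function_const v, of c] tangent_const[OF v] by simp

text \<open>For iterating a path of connections: the inner derivative is a combination of two
  sections with coefficients 1 - t and t, constant on the manifold, so Leibniz's rule adds no
  derivative terms.\<close>

lemma connection_combination:
  assumes nab: "connection A E F nab" and W: "open W" "p \<in> W"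
    and s: "smooth_section A E F W s" and s': "smooth_section A E F W s'"
    and v: "v \<in> tangent_space A p"
  shows "nab p v (\<lambda>x. c *\<^sub>R s x + d *\<^sub>R s' x) = c *\<^sub>R nab p v s + d *\<^sub>R nab p v s'"
  using connection.nab_add[OF nab W smooth_section_scale[OF W(1) s] smooth_section_scale[OF W(1) s'] v, of c d]
    connection_scale_section[OF nab W s v] connection_scale_section[OF nab W s' v] by simp

text \<open>Each second covariant derivative expands into four mixed terms with coefficients
  quadratic in t, and the bracket term is affine in t. Coordinates in a frame are additive only
  inside the fibre, which is why membership in \<open>E p\<close> is recorded for every
  term.\<close>

lemma holomorphic_poly_curvature_path:
  assumes nab0: "connection A E F nab0" and nab1: "connection A E F nab1"
    and c: "(U, \<phi>) \<in> A" "p \<in> U" and Ve: "(V, e) \<in> F" "p \<in> V"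
  shows "holomorphic_poly S (\<lambda>\<tau> t. of_real (coord_of (basis_at e p)
           (curvature A (connection_path nab0 nab1 t) (coord_vector A (U, \<phi>) a) (coord_vector A (U, \<phi>) b) (e j) p) i))"
proof -
  define X where "X = coord_vector A (U, \<phi>)"
  define co where "co = (\<lambda>v. coord_of (basis_at e p) v i)"
  have U: "open U" and V: "open V"
    using chart_open[OF c(1)] frame_open[OF Ve(1)] by auto
  have W: "open (U \<inter> V)" "p \<in> U \<inter> V"
    using U V c Ve by auto
  have X: "X k x \<in> tangent_space A x" if "x \<in> U" for k x
    unfolding X_def by (rule coord_vector_in_tangent_space[OF c(1) that])
  have L: "lie_bracket A (X a) (X b) p \<in> tangent_space A p"
    using X smooth_near_coord_vector[OF c] unfolding X_def by (intro lie_bracket_in_tangent_space[OF U c(2)])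
  have s: "smooth_section A E F (U \<inter> V) (e j)"
    using smooth_section_subset[OF W(1) V _ smooth_section_frame[OF Ve(1)]] by auto
  have co: "co (r *\<^sub>R x + r' *\<^sub>R y) = r * co x + r' * co y" if "x \<in> E p" "y \<in> E p" for r r' x y
    using that coord_of_add[OF Ve] coord_of_scale[OF Ve] subspace_scale[OF subspace_fibre] by (simp add: co_def)
  have E: "r *\<^sub>R x + r' *\<^sub>R y \<in> E p" if "x \<in> E p" "y \<in> E p" for r r' x y
    using that subspace_scale[OF subspace_fibre] subspace_add[OF subspace_fibre] by blast
  have co_diff: "co (x - y) = co x - co y" if "x \<in> E p" "y \<in> E p" for x y
    using co[OF that, of 1 "-1"] by simp
  have E_diff: "x - y \<in> E p" if "x \<in> E p" "y \<in> E p" for x y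
    using E[OF that, of 1 "-1"] by simp
  define N where "N = (\<lambda>(n :: ('m, 'v) covariant_derivative) (n' :: ('m, 'v) covariant_derivative) k l. n p (X k p) (\<lambda>x. n' x (X l x) (e j)))"
  have sN: "smooth_section A E F (U \<inter> V) (\<lambda>x. n x (X l x) (e j))" if "n \<in> {nab0, nab1}" for n l
    using that connection.nab_smooth[OF nab0 V smooth_section_frame[OF Ve(1)] c(1)]
      connection.nab_smooth[OF nab1 V smooth_section_frame[OF Ve(1)] c(1)] by (auto simp: X_def)
  have conn: "connection A E F n" if "n \<in> {nab0, nab1}" for n
    using that nab0 nab1 by auto
  have NE: "N n n' k l \<in> E p" if "n \<in> {nab0, nab1}" "n' \<in> {nab0, nab1}" for n n' k l
    unfolding N_def by (rule connection.nab_in[OF conn[OF that(1)] W sN[OF that(2)] X[OF c(2)]])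
  define M where "M = (\<lambda>(n :: ('m, 'v) covariant_derivative). n p (lie_bracket A (X a) (X b) p) (e j))"
  have ME: "M n \<in> E p" if "n \<in> {nab0, nab1}" for n
    unfolding M_def by (rule connection.nab_in[OF conn[OF that] W s L])
  define P where "P = (\<lambda>t k l. (1 - t) *\<^sub>R ((1 - t) *\<^sub>R N nab0 nab0 k l + t *\<^sub>R N nab0 nab1 k l)
      + t *\<^sub>R ((1 - t) *\<^sub>R N nab1 nab0 k l + t *\<^sub>R N nab1 nab1 k l))"
  have PE: "P t k l \<in> E p" for t k l
    unfolding P_def by (intro E NE) auto
  have coP: "co (P t k l) = (1 - t) * ((1 - t) * co (N nab0 nab0 k l) + t * co (N nab0 nab1 k l))
      + t * ((1 - t) * co (N nab1 nab0 k l) + t * co (N nab1 nab1 k l))" for t k l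
    unfolding P_def by (simp add: co E NE)
  have path: "connection_path nab0 nab1 t p (X k p) (\<lambda>x. connection_path nab0 nab1 t x (X l x) (e j)) = P t k l" for t k l
    unfolding connection_path_def P_def N_def
    using connection_combination[OF nab0 W sN sN X[OF c(2)]] connection_combination[OF nab1 W sN sN X[OF c(2)]]
    by simp
  have path_M: "connection_path nab0 nab1 t p (lie_bracket A (X a) (X b) p) (e j)
      = (1 - t) *\<^sub>R M nab0 + t *\<^sub>R M nab1" for t
    by (simp add: connection_path_def M_def)
  have curv: "co (curvature A (connection_path nab0 nab1 t) (X a) (X b) (e j) p)
      = co (P t a b) - co (P t b a) - ((1 - t) * co (M nab0) + t * co (M nab1))" for t
    unfolding curvature_def path path_M
    by (simp add: co_diff E_diff PE E ME co)
  define D where "D = (\<lambda>n n'. co (N n n' a b) - co (N n n' b a))"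
  \<comment> \<open>The coefficients of 1, t and t^2 in (1-t)^2 D00 + t(1-t)(D01 + D10) + t^2 D11 -
    (1-t) M0 - t M1.\<close>
  define r r' r'' where "r = D nab0 nab0 - co (M nab0)"
    and "r' = D nab0 nab1 + D nab1 nab0 - 2 * D nab0 nab0 + co (M nab0) - co (M nab1)"
    and "r'' = D nab0 nab0 - D nab0 nab1 - D nab1 nab0 + D nab1 nab1"
  have "co (curvature A (connection_path nab0 nab1 t) (X a) (X b) (e j) p) = r + t * (r' + t * r'')" for t
    unfolding curv coP D_def r_def r'_def r''_def by (simp add: algebra_simps)
  then have "of_real (co (curvature A (connection_path nab0 nab1 t) (X a) (X b) (e j) p))
      = poly [:of_real r, of_real r', of_real r'':] (complex_of_real t)" for t
    by simp
  then have "holomorphic_poly S (\<lambda>\<tau> t. of_real (co (curvature A (connection_path nab0 nab1 t) (X a) (X b) (e j) p)))"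
    by (simp only: holomorphic_poly_poly)
  then show ?thesis
    by (simp only: co_def X_def)
qed

lemma holomorphic_poly_form_bundle_curvature:
  assumes "connection A E F nab0" "connection A E F nab1"
  shows "holomorphic_poly_form S (\<lambda>\<tau> t. bundle_curvature A F (connection_path nab0 nab1 t) p $ i $ j)"
proof -
  obtain U \<phi> where c: "chart_at A p = (U, \<phi>)" "(U, \<phi>) \<in> A" "p \<in> U"
  proof -
    have "\<exists>c. c \<in> A \<and> p \<in> fst c"
      using charts_cover[of p] by force
    then have "chart_at A p \<in> A \<and> p \<in> fst (chart_at A p)"
      unfolding chart_at_def by (rule someI_ex)
    then show ?thesis
      using that by (cases "chart_at A p") auto
  qed
  obtain V where Ve: "(V, frame_at F p) \<in> F" "p \<in> V"
  proof -
    have "\<exists>c. c \<in> F \<and> p \<in> fst c"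
      using frames_cover[of p] by force
    then have "(SOME c. c \<in> F \<and> p \<in> fst c) \<in> F \<and> p \<in> fst (SOME c. c \<in> F \<and> p \<in> fst c)"
      by (rule someI_ex)
    then show ?thesis
      using that[of "fst (SOME c. c \<in> F \<and> p \<in> fst c)"] by (simp add: frame_at_def)
  qed
  have "holomorphic_poly S (\<lambda>\<tau> t. form_at (curvature_matrix A F (connection_path nab0 nab1 t) p $ i $ j) vs)" for vs
  proof (cases "length vs = 2")
    case True
    then obtain v w where "vs = [v, w]"
      by (auto simp: numeral_2_eq_2 length_Suc_conv)
    then show ?thesis
      unfolding curvature_matrix_def Let_def c(1)
      by (auto intro!: holomorphic_poly_sum holomorphic_poly_mult holomorphic_poly_curvature_path assms c Ve)
  next
    case False
    then show ?thesis
      using pure_form_curvature_matrix[of A F _ p i j] by (simp add: pure_form_def)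
  qed
  then show ?thesis
    unfolding bundle_curvature_def scale_matrix_def vec_lambda_beta
    by (intro holomorphic_poly_form_scale) (simp add: holomorphic_poly_form_def)
qed

end

lemma pure_form_curvature:
  "pure_form 2 (tangent_curvature A nabT p $ i $ j)" "pure_form 2 (bundle_curvature A F nab p $ k $ l)"
  by (simp_all add: tangent_curvature_def bundle_curvature_def scale_matrix_def pure_form_scale_form
      pure_form_curvature_matrix)

lemma pure_form_difference_matrix: "pure_form 1 (difference_matrix F nab0 nab1 p $ i $ j)"
  by (auto simp: pure_form_def difference_matrix_def Let_def split: list.split)

section \<open>Modularity of the transgressed forms\<close>

text \<open>F1 is the series in the tangent factor and in the denominator of h; F2 and F3 enter
  symmetrically. In this form a modular substitution acts by permuting and dilating the three
  arguments.\<close>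

definition transgression ::
    "complex fps \<Rightarrow> complex fps \<Rightarrow> complex fps \<Rightarrow> 't form^'n^'n \<Rightarrow> (real \<Rightarrow> 't form^'r^'r) \<Rightarrow> 't form^'r^'r \<Rightarrow> 't form" where
  "transgression F1 F2 F3 RT R B =
     integral_form {0..1} (\<lambda>t. transgression_integrand F1 (h_fps F1 F2 F3) (g_fps F1 F2 F3) RT (R t) B)"

lemma transgression_commute: "transgression F1 F2 F3 = transgression F1 F3 F2"
  by (simp add: transgression_def[abs_def] h_fps_commute[of F1 F2] g_fps_commute[of F1 F2])

lemma degree_part_transgression_dilate:
  assumes "\<And>i j. pure_form 2 (RT $ i $ j)" "\<And>t i j. pure_form 2 (R t $ i $ j)" "\<And>i j. pure_form 1 (B $ i $ j)"
    and F: "fps_nth F1 0 = 1" "fps_nth F2 0 = 1" "fps_nth F3 0 = 1" and c: "c \<noteq> 0" and k: "k \<ge> 1"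
  shows "degree_part (4 * k - 1) (transgression (fps_dilate c F1) (fps_dilate c F2) (fps_dilate c F3) RT R B)
       = scale_form (c ^ (2 * k)) (degree_part (4 * k - 1) (transgression F1 F2 F3 RT R B))"
proof -
  \<comment> \<open>Forms scale by s to the degree when the series are dilated by s^2. Either root
    would do, since the final exponent is even.\<close>
  define s where "s = csqrt c"
  have s: "c = s\<^sup>2" "s \<noteq> 0"
    using c by (auto simp: s_def)
  have "fps_nth (h_fps F1 F2 F3) 0 = 1"
    by (simp add: h_fps_def F)
  then have "degree_part (4 * k - 1) (transgression (fps_dilate c F1) (fps_dilate c F2) (fps_dilate c F3) RT R B)
       = scale_form (s ^ Suc (4 * k - 1)) (degree_part (4 * k - 1) (transgression F1 F2 F3 RT R B))"
    unfolding transgression_def s(1)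
    by (intro degree_part_integral_dilate)
       (simp add: F h_fps_dilate g_fps_dilate transgression_integrand_dilate[OF assms(1-3)] s)
  \<comment> \<open>Here k \<ge> 1 makes the truncated subtraction exact, so the exponent is
    4k.\<close>
  also have "s ^ Suc (4 * k - 1) = c ^ (2 * k)"
    using k by (simp add: s(1) flip: power_mult)
  finally show ?thesis .
qed

lemma degree_part_scale_form: "degree_part d (scale_form c \<omega>) = scale_form c (degree_part d \<omega>)"
  by (rule form_eqI) simp

lemma integral_form_scale: "integral_form I (\<lambda>t. scale_form c (\<omega> t)) = scale_form c (integral_form I \<omega>)"
  by (rule form_eqI) (simp add: integral_form_def)

context
  fixes A :: "('m::{t2_space, second_countable_topology}, 'n::finite) atlas"
    and E :: "'m \<Rightarrow> 'v::real_vector set"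
    and F :: "('m, 'v, 'r::finite) frames"
    and nabT :: "('m, 'm tangent) covariant_derivative"
    and nab0 nab1 :: "('m, 'v) covariant_derivative"
    and k :: nat
  assumes vb: "vector_bundle A E F"
    and nab0: "connection A E F nab0" and nab1: "connection A E F nab1"
    and k: "k \<ge> 1"
begin

definition CS :: "(complex \<Rightarrow> complex \<Rightarrow> complex) \<Rightarrow> (complex \<Rightarrow> complex \<Rightarrow> complex) \<Rightarrow>
    (complex \<Rightarrow> complex \<Rightarrow> complex) \<Rightarrow> complex \<Rightarrow> 'm \<Rightarrow> 'm tangent form" where
  "CS th1 th2 th3 \<tau> p = transgression (quotient_fps th1 \<tau>) (quotient_fps th2 \<tau>) (quotient_fps th3 \<tau>)
     (tangent_curvature A nabT p) (\<lambda>t. bundle_curvature A F (connection_path nab0 nab1 t) p)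
     (difference_matrix F nab0 nab1 p)"

lemma CSPhi_W_eq:
  assumes \<tau>: "\<tau> \<in> upper_half_plane"
  shows "CSPhi_W A F nabT nab0 nab1 \<tau> p = scale_form (1 / (8 * pi\<^sup>2)) (CS theta2 theta1 theta3 \<tau> p)"
proof -
  have "taylor h_W \<tau> = h_fps (quotient_fps theta2 \<tau>) (quotient_fps theta1 \<tau>) (quotient_fps theta3 \<tau>)"
    using taylor_h[OF \<tau>, of theta2 theta1 theta3] by (simp add: h_W_def[abs_def])
  moreover have "taylor g_W \<tau> = g_fps (quotient_fps theta2 \<tau>) (quotient_fps theta1 \<tau>) (quotient_fps theta3 \<tau>)"
    using taylor_g[OF \<tau>, of theta2 theta3 theta1] by (subst g_fps_commute) (simp add: g_W_def[abs_def])
  ultimately show ?thesis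
    by (simp add: CSPhi_W_def Phi_W_def CS_def transgression_def transgression_integrand_def taylor_f_W[OF \<tau>])
qed

lemma CSPhi_W'_eq:
  assumes \<tau>: "\<tau> \<in> upper_half_plane"
  shows "CSPhi_W' A F nabT nab0 nab1 \<tau> p = scale_form (1 / (8 * pi\<^sup>2)) (CS theta3 theta1 theta2 \<tau> p)"
proof -
  have "taylor h_W' \<tau> = h_fps (quotient_fps theta3 \<tau>) (quotient_fps theta1 \<tau>) (quotient_fps theta2 \<tau>)"
    using taylor_h[OF \<tau>, of theta3 theta2 theta1] by (subst h_fps_commute) (simp add: h_W'_def[abs_def])
  moreover have "taylor g_W' \<tau> = g_fps (quotient_fps theta3 \<tau>) (quotient_fps theta1 \<tau>) (quotient_fps theta2 \<tau>)"
    using taylor_g[OF \<tau>, of theta3 theta2 theta1] by (subst g_fps_commute) (simp add: g_W'_def[abs_def])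
  ultimately show ?thesis
    by (simp add: CSPhi_W'_def Phi_W'_def CS_def transgression_def transgression_integrand_def taylor_f_W'[OF \<tau>])
qed

text \<open>The sqrt 2 of the transgression completes the power 4k - 1 of \<open>Phi_L\<close> to
  sqrt 2 ^ (4k) = 2 ^ (2k).\<close>

lemma CSPhi_L_eq:
  assumes \<tau>: "\<tau> \<in> upper_half_plane"
  shows "CSPhi_L A F nabT k nab0 nab1 \<tau> p = scale_form (2 ^ (2 * k) / (8 * pi\<^sup>2)) (CS theta1 theta2 theta3 \<tau> p)"
proof -
  have "taylor h_L \<tau> = h_fps (quotient_fps theta1 \<tau>) (quotient_fps theta2 \<tau>) (quotient_fps theta3 \<tau>)"
    using taylor_h[OF \<tau>, of theta1 theta2 theta3] by (simp add: h_L_def[abs_def])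
  moreover have "taylor g_L \<tau> = g_fps (quotient_fps theta1 \<tau>) (quotient_fps theta2 \<tau>) (quotient_fps theta3 \<tau>)"
    using taylor_g[OF \<tau>, of theta1 theta2 theta3] by (simp add: g_L_def[abs_def])
  ultimately have "CSPhi_L A F nabT k nab0 nab1 \<tau> p
      = scale_form (complex_of_real (sqrt 2) / (8 * pi\<^sup>2) * complex_of_real (sqrt 2) ^ (4 * k - 1)) (CS theta1 theta2 theta3 \<tau> p)"
    by (simp add: CSPhi_L_def Phi_L_def CS_def transgression_def transgression_integrand_def taylor_f_L[OF \<tau>]
        scale_form_mult_left integral_form_scale)
  also have "complex_of_real (sqrt 2) / (8 * pi\<^sup>2) * complex_of_real (sqrt 2) ^ (4 * k - 1)
      = complex_of_real (sqrt 2) ^ Suc (4 * k - 1) / (8 * pi\<^sup>2)"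
    by simp
  also have "complex_of_real (sqrt 2) ^ Suc (4 * k - 1) = (complex_of_real (sqrt 2) ^ 2) ^ (2 * k)"
    using k by (simp flip: power_mult)
  also have "complex_of_real (sqrt 2) ^ 2 = 2"
    by (simp flip: of_real_power)
  finally show ?thesis
    by simp
qed

lemma degree_part_CS_dilate:
  assumes \<tau>: "\<tau> \<in> upper_half_plane" and c: "c \<noteq> 0"
    and th: "th1 \<in> {theta1, theta2, theta3}" "th2 \<in> {theta1, theta2, theta3}" "th3 \<in> {theta1, theta2, theta3}"
    and q: "quotient_fps ph1 \<sigma> = fps_dilate c (quotient_fps th1 \<tau>)"
      "quotient_fps ph2 \<sigma> = fps_dilate c (quotient_fps th2 \<tau>)"
      "quotient_fps ph3 \<sigma> = fps_dilate c (quotient_fps th3 \<tau>)"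
  shows "degree_part (4 * k - 1) (CS ph1 ph2 ph3 \<sigma> p)
       = scale_form (c ^ (2 * k)) (degree_part (4 * k - 1) (CS th1 th2 th3 \<tau> p))"
  unfolding CS_def q
  by (intro degree_part_transgression_dilate pure_form_curvature pure_form_difference_matrix c k
      quotient_fps_nth_0 \<tau> th)

lemma CS_commute: "CS th1 th2 th3 = CS th1 th3 th2"
  unfolding CS_def[abs_def] by (subst transgression_commute) rule

lemma holomorphic_on_CS:
  assumes th: "th1 \<in> {theta1, theta2, theta3}" "th2 \<in> {theta1, theta2, theta3}" "th3 \<in> {theta1, theta2, theta3}"
  shows "(\<lambda>\<tau>. form_at (CS th1 th2 th3 \<tau> p) vs) holomorphic_on upper_half_plane"
  unfolding CS_def transgression_def
proof (intro holomorphic_on_transgression holomorphic_fps_on_h_g)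
  show "holomorphic_poly_form upper_half_plane
      (\<lambda>\<tau> t. bundle_curvature A F (connection_path nab0 nab1 t) p $ i $ j)" for i j
    by (rule vector_bundle.holomorphic_poly_form_bundle_curvature[OF vb nab0 nab1])
qed (use th quotient_fps_nth_0 in \<open>simp_all add: holomorphic_fps_on_quotient\<close>)

text \<open>The permutation of the three characters read off from the parities: in each case the
  first test asks whether the new multiplier for the period 1 is trivial, the second whether that
  for \<tau> is.\<close>

lemma quotient_fps_moebius_parity:
  assumes \<tau>: "\<tau> \<in> upper_half_plane" and det: "a * d - b * c = (1::int)"
  shows "quotient_fps theta1 ((of_int a * \<tau> + of_int b) / (of_int c * \<tau> + of_int d))
           = fps_dilate (of_int c * \<tau> + of_int d) (quotient_fps (if even c then theta1 else if even d then theta2 else theta3) \<tau>)"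
    and "quotient_fps theta2 ((of_int a * \<tau> + of_int b) / (of_int c * \<tau> + of_int d))
           = fps_dilate (of_int c * \<tau> + of_int d) (quotient_fps (if even a then theta1 else if even b then theta2 else theta3) \<tau>)"
    and "quotient_fps theta3 ((of_int a * \<tau> + of_int b) / (of_int c * \<tau> + of_int d))
           = fps_dilate (of_int c * \<tau> + of_int d)
               (quotient_fps (if even (a + c) then theta1 else if even (b + d) then theta2 else theta3) \<tau>)"
proof -
  have sign: "(- 1 :: complex) powi n = (if even n then 1 else - 1)" for n
    by (simp add: power_int_minus_left)
  have 1: "theta_with_multipliers 1 (- 1) = theta1" "theta_with_multipliers (- 1) 1 = theta2"
    "theta_with_multipliers (- 1) (- 1) = theta3"
    by (simp_all add: theta_with_multipliers_def)
  show "quotient_fps theta1 ((of_int a * \<tau> + of_int b) / (of_int c * \<tau> + of_int d))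
           = fps_dilate (of_int c * \<tau> + of_int d) (quotient_fps (if even c then theta1 else if even d then theta2 else theta3) \<tau>)"
    using quotient_fps_moebius[OF \<tau> det _ refl, of 1 "- 1"]
    by (simp add: 1 sign sign_pairs_def) (simp add: theta_with_multipliers_def)
  show "quotient_fps theta2 ((of_int a * \<tau> + of_int b) / (of_int c * \<tau> + of_int d))
           = fps_dilate (of_int c * \<tau> + of_int d) (quotient_fps (if even a then theta1 else if even b then theta2 else theta3) \<tau>)"
    using quotient_fps_moebius[OF \<tau> det _ refl, of "- 1" 1]
    by (simp add: 1 sign sign_pairs_def) (simp add: theta_with_multipliers_def)
  show "quotient_fps theta3 ((of_int a * \<tau> + of_int b) / (of_int c * \<tau> + of_int d))
           = fps_dilate (of_int c * \<tau> + of_int d)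
               (quotient_fps (if even (a + c) then theta1 else if even (b + d) then theta2 else theta3) \<tau>)"
    using quotient_fps_moebius[OF \<tau> det _ refl, of "- 1" "- 1"]
    by (simp add: 1 sign sign_pairs_def split: if_splits) (simp_all add: theta_with_multipliers_def)
qed

lemma modular_CS:
  assumes th: "th1 \<in> {theta1, theta2, theta3}" "th2 \<in> {theta1, theta2, theta3}" "th3 \<in> {theta1, theta2, theta3}"
    and \<omega>: "\<And>\<tau> p. \<tau> \<in> upper_half_plane \<Longrightarrow> \<omega> \<tau> p = scale_form r (CS th1 th2 th3 \<tau> p)"
    and \<Gamma>: "\<Gamma> \<subseteq> SL2Z"
    and trans: "\<And>\<tau> a b c d p. \<tau> \<in> upper_half_plane \<Longrightarrow> a * d - b * c = (1::int) \<Longrightarrow>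
        (\<chi> i j. if i = 1 then (if j = 1 then a else b) else (if j = 1 then c else d)) \<in> \<Gamma> \<Longrightarrow>
        degree_part (4 * k - 1) (CS th1 th2 th3 ((of_int a * \<tau> + of_int b) / (of_int c * \<tau> + of_int d)) p)
          = scale_form ((of_int c * \<tau> + of_int d) ^ (2 * k)) (degree_part (4 * k - 1) (CS th1 th2 th3 \<tau> p))"
  shows "modular_differential_form A \<Gamma> (2 * int k) (\<lambda>\<tau> p. degree_part (4 * k - 1) (\<omega> \<tau> p))"
  unfolding modular_differential_form_def
proof (intro exI[of _ "\<lambda>_. 1"] conjI allI impI)
  show "group_character \<Gamma> (\<lambda>_. 1)"
    by (simp add: group_character_def)
  fix p vs
  show "modular_form_with \<Gamma> (\<lambda>_. 1) (2 * int k) (\<lambda>\<tau>. form_at (degree_part (4 * k - 1) (\<omega> \<tau> p)) vs)"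
    unfolding modular_form_with_def
  proof (intro conjI ballI)
    have "(\<lambda>\<tau>. if length vs = 4 * k - 1 then r * form_at (CS th1 th2 th3 \<tau> p) vs else 0) holomorphic_on upper_half_plane"
    proof (cases "length vs = 4 * k - 1")
      case True
      then show ?thesis
        unfolding if_P[OF True] by (intro holomorphic_intros holomorphic_on_CS th)
    next
      case False
      then show ?thesis
        by simp
    qed
    then show "(\<lambda>\<tau>. form_at (degree_part (4 * k - 1) (\<omega> \<tau> p)) vs) holomorphic_on upper_half_plane"
      by (rule holomorphic_transform) (simp add: \<omega>)
    fix g \<tau> assume g: "g \<in> \<Gamma>" and \<tau>: "\<tau> \<in> upper_half_plane"
    define a b c d where "a = g $ 1 $ 1" and "b = g $ 1 $ 2" and "c = g $ 2 $ 1" and "d = g $ 2 $ 2"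
    have det: "a * d - b * c = 1"
      using g \<Gamma> by (auto simp: SL2Z_def det_2 a_def b_def c_def d_def)
    have "(\<chi> i j. if i = 1 then (if j = 1 then a else b) else (if j = 1 then c else d)) = g"
      by (simp add: vec_eq_iff forall_2 a_def b_def c_def d_def)
    with g have "degree_part (4 * k - 1) (CS th1 th2 th3 ((of_int a * \<tau> + of_int b) / (of_int c * \<tau> + of_int d)) p)
          = scale_form ((of_int c * \<tau> + of_int d) ^ (2 * k)) (degree_part (4 * k - 1) (CS th1 th2 th3 \<tau> p))"
      by (intro trans \<tau> det) simp
    then have "form_at (degree_part (4 * k - 1) (\<omega> ((of_int a * \<tau> + of_int b) / (of_int c * \<tau> + of_int d)) p)) vs
        = 1 * (of_int c * \<tau> + of_int d) ^ (2 * k) * form_at (degree_part (4 * k - 1) (\<omega> \<tau> p)) vs"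
      unfolding \<omega>[OF \<tau>] \<omega>[OF moebius_in_upper_half_plane[OF \<tau> det]] degree_part_scale_form
      by simp
    moreover have "(of_int c * \<tau> + of_int d) powi (2 * int k) = (of_int c * \<tau> + of_int d) ^ (2 * k)"
      using power_int_of_nat[of "of_int c * \<tau> + of_int d" "2 * k"] by simp
    ultimately show "form_at (degree_part (4 * k - 1)
          (\<omega> ((of_int (g $ 1 $ 1) * \<tau> + of_int (g $ 1 $ 2)) / (of_int (g $ 2 $ 1) * \<tau> + of_int (g $ 2 $ 2))) p)) vs
        = 1 * (of_int (g $ 2 $ 1) * \<tau> + of_int (g $ 2 $ 2)) powi (2 * int k) *
          form_at (degree_part (4 * k - 1) (\<omega> \<tau> p)) vs"
      by (simp add: a_def b_def c_def d_def)
  qed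
qed


text \<open>Even c forces a and d odd, so \<open>theta1\<close> is fixed; for odd b the other two
  series are exchanged, which the symmetry of \<open>CS\<close> in its last two arguments
  absorbs.\<close>

lemma modular_CSPhi_L:
  "modular_differential_form A Gamma_0_2 (2 * int k)
     (\<lambda>\<tau> p. degree_part (4 * k - 1) (CSPhi_L A F nabT k nab0 nab1 \<tau> p))"
proof (rule modular_CS[OF _ _ _ CSPhi_L_eq])
  fix \<tau> a b c d p
  assume \<tau>: "\<tau> \<in> upper_half_plane" and det: "a * d - b * c = (1::int)"
    and g: "(\<chi> i j. if i = 1 then (if j = 1 then a else b) else (if j = 1 then c else d)) \<in> Gamma_0_2"
  have "odd (a * d - b * c)"
    by (simp add: det)
  then have par: "even c" "odd a" "odd d"
    using g by (auto simp: Gamma_0_2_def)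
  note q = quotient_fps_moebius_parity[OF \<tau> det]
  show "degree_part (4 * k - 1) (CS theta1 theta2 theta3 ((of_int a * \<tau> + of_int b) / (of_int c * \<tau> + of_int d)) p)
      = scale_form ((of_int c * \<tau> + of_int d) ^ (2 * k)) (degree_part (4 * k - 1) (CS theta1 theta2 theta3 \<tau> p))"
  proof (cases "even b")
    case True
    then show ?thesis
      using par by (intro degree_part_CS_dilate \<tau> cocycle_nonzero[OF \<tau> det]) (simp_all add: q)
  next
    case False
    then show ?thesis
      using par
      by (subst (2) CS_commute, intro degree_part_CS_dilate \<tau> cocycle_nonzero[OF \<tau> det]) (simp_all add: q)
  qed
qed (auto simp: Gamma_0_2_def)

text \<open>Even b forces a and d odd, so \<open>theta2\<close> is fixed; \<open>theta1\<close> and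
  \<open>theta3\<close> are exchanged exactly when c is odd.\<close>

lemma modular_CSPhi_W:
  "modular_differential_form A Gamma_up_0_2 (2 * int k)
     (\<lambda>\<tau> p. degree_part (4 * k - 1) (CSPhi_W A F nabT nab0 nab1 \<tau> p))"
proof (rule modular_CS[OF _ _ _ CSPhi_W_eq])
  fix \<tau> a b c d p
  assume \<tau>: "\<tau> \<in> upper_half_plane" and det: "a * d - b * c = (1::int)"
    and g: "(\<chi> i j. if i = 1 then (if j = 1 then a else b) else (if j = 1 then c else d)) \<in> Gamma_up_0_2"
  have "odd (a * d - b * c)"
    by (simp add: det)
  then have par: "even b" "odd a" "odd d"
    using g by (auto simp: Gamma_up_0_2_def)
  note q = quotient_fps_moebius_parity[OF \<tau> det]
  show "degree_part (4 * k - 1) (CS theta2 theta1 theta3 ((of_int a * \<tau> + of_int b) / (of_int c * \<tau> + of_int d)) p)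
      = scale_form ((of_int c * \<tau> + of_int d) ^ (2 * k)) (degree_part (4 * k - 1) (CS theta2 theta1 theta3 \<tau> p))"
  proof (cases "even c")
    case True
    then show ?thesis
      using par by (intro degree_part_CS_dilate \<tau> cocycle_nonzero[OF \<tau> det]) (simp_all add: q)
  next
    case False
    then show ?thesis
      using par
      by (subst (2) CS_commute, intro degree_part_CS_dilate \<tau> cocycle_nonzero[OF \<tau> det]) (simp_all add: q)
  qed
qed (auto simp: Gamma_up_0_2_def)

text \<open>Both residue classes of \<open>Gamma_theta\<close> fix \<open>theta3\<close>; the
  antidiagonal one exchanges \<open>theta1\<close> and \<open>theta2\<close>.\<close>

lemma modular_CSPhi_W':
  "modular_differential_form A Gamma_theta (2 * int k)
     (\<lambda>\<tau> p. degree_part (4 * k - 1) (CSPhi_W' A F nabT nab0 nab1 \<tau> p))"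
proof (rule modular_CS[OF _ _ _ CSPhi_W'_eq])
  fix \<tau> a b c d p
  assume \<tau>: "\<tau> \<in> upper_half_plane" and det: "a * d - b * c = (1::int)"
    and "(\<chi> i j. if i = 1 then (if j = 1 then a else b) else (if j = 1 then c else d)) \<in> Gamma_theta"
  then have par: "odd a \<and> even b \<and> even c \<and> odd d \<or> even a \<and> odd b \<and> odd c \<and> even d"
    by (auto simp: Gamma_theta_def)
  note q = quotient_fps_moebius_parity[OF \<tau> det]
  show "degree_part (4 * k - 1) (CS theta3 theta1 theta2 ((of_int a * \<tau> + of_int b) / (of_int c * \<tau> + of_int d)) p)
      = scale_form ((of_int c * \<tau> + of_int d) ^ (2 * k)) (degree_part (4 * k - 1) (CS theta3 theta1 theta2 \<tau> p))"
  proof (cases "even c")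
    case True
    then show ?thesis
      using par by (intro degree_part_CS_dilate \<tau> cocycle_nonzero[OF \<tau> det]) (auto simp: q)
  next
    case False
    then show ?thesis
      using par
      by (subst (2) CS_commute, intro degree_part_CS_dilate \<tau> cocycle_nonzero[OF \<tau> det]) (auto simp: q)
  qed
qed (auto simp: Gamma_theta_def)

text \<open>The matrix with a = d = 0, b = -1, c = 1 exchanges \<open>theta1\<close> and
  \<open>theta2\<close> and dilates by \<tau>. The power of \<tau> comes from the dilation, that of
  2 from the prefactor of the L-form.\<close>

lemma degree_part_CSPhi_L_S:
  assumes \<tau>: "\<tau> \<in> upper_half_plane"
  shows "degree_part (4 * k - 1) (CSPhi_L A F nabT k nab0 nab1 (- 1 / \<tau>) p)
       = scale_form ((2 * \<tau>) ^ (2 * k)) (degree_part (4 * k - 1) (CSPhi_W A F nabT nab0 nab1 \<tau> p))"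
proof -
  have "\<tau> \<noteq> 0" "- 1 / \<tau> \<in> upper_half_plane"
    using \<tau> cocycle_nonzero[OF \<tau>, of 0 0 "- 1" 1] moebius_in_upper_half_plane[OF \<tau>, of 0 0 "- 1" 1] by simp_all
  moreover from this have "degree_part (4 * k - 1) (CS theta1 theta2 theta3 (- 1 / \<tau>) p)
      = scale_form (\<tau> ^ (2 * k)) (degree_part (4 * k - 1) (CS theta2 theta1 theta3 \<tau> p))"
    using quotient_fps_moebius_parity[OF \<tau>, of 0 0 "- 1" 1]
    by (intro degree_part_CS_dilate \<tau>) simp_all
  ultimately show ?thesis
    by (simp add: CSPhi_L_eq CSPhi_W_eq[OF \<tau>] degree_part_scale_form power_mult_distrib)
qed

text \<open>Translation has c\<tau> + d = 1, so nothing is dilated and the equality holds in all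
  degrees at once; it exchanges \<open>theta2\<close> and \<open>theta3\<close>.\<close>

lemma CSPhi_W_T:
  assumes \<tau>: "\<tau> \<in> upper_half_plane"
  shows "CSPhi_W A F nabT nab0 nab1 (\<tau> + 1) p = CSPhi_W' A F nabT nab0 nab1 \<tau> p"
proof -
  have "\<tau> + 1 \<in> upper_half_plane"
    using \<tau> by (simp add: upper_half_plane_def)
  moreover have "CS theta2 theta1 theta3 (\<tau> + 1) p = CS theta3 theta1 theta2 \<tau> p"
    using quotient_fps_moebius_parity[OF \<tau>, of 1 1 1 0] by (simp add: CS_def)
  ultimately show ?thesis
    by (simp add: CSPhi_W_eq CSPhi_W'_eq[OF \<tau>])
qed

end

theorem theorem3p4:
  fixes k :: nat
    and A :: "('m::{t2_space, second_countable_topology}, 'n::finite) atlas"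
    and gM :: "'m \<Rightarrow> 'm tangent \<Rightarrow> 'm tangent \<Rightarrow> real"
    and nabT :: "('m, 'm tangent) covariant_derivative"
    and E :: "'m \<Rightarrow> 'v::real_vector set"
    and F :: "('m, 'v, 2) frames"
    and gE :: "'m \<Rightarrow> 'v \<Rightarrow> 'v \<Rightarrow> real"
    and nab0 nab1 :: "('m, 'v) covariant_derivative"
  assumes "k \<ge> 1"
    and "CARD('n) = 4 * k - 1"
    and "smooth_manifold A"
    and "fibre_metric A (tangent_space A) (coord_frames A) gM"
    and "connection A (tangent_space A) (coord_frames A) nabT"
    and "vector_bundle A E F"
    and "oriented_frames F"
    and "fibre_metric A E F gE"
    and "metric_connection A E F gE nab0"
    and "metric_connection A E F gE nab1"
  shows "modular_differential_form A Gamma_0_2 (2 * int k)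
           (\<lambda>\<tau> p. degree_part (4 * k - 1) (CSPhi_L A F nabT k nab0 nab1 \<tau> p)) \<and>
         modular_differential_form A Gamma_up_0_2 (2 * int k)
           (\<lambda>\<tau> p. degree_part (4 * k - 1) (CSPhi_W A F nabT nab0 nab1 \<tau> p)) \<and>
         modular_differential_form A Gamma_theta (2 * int k)
           (\<lambda>\<tau> p. degree_part (4 * k - 1) (CSPhi_W' A F nabT nab0 nab1 \<tau> p)) \<and>
         (\<forall>\<tau>\<in>upper_half_plane. \<forall>p.
           degree_part (4 * k - 1) (CSPhi_L A F nabT k nab0 nab1 (- 1 / \<tau>) p)
             = scale_form ((2 * \<tau>) ^ (2 * k))
                 (degree_part (4 * k - 1) (CSPhi_W A F nabT nab0 nab1 \<tau> p))) \<and>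
         (\<forall>\<tau>\<in>upper_half_plane. \<forall>p.
           CSPhi_W A F nabT nab0 nab1 (\<tau> + 1) p = CSPhi_W' A F nabT nab0 nab1 \<tau> p)"
proof -
  have nab: "connection A E F nab0" "connection A E F nab1"
    using assms(9,10) by (simp_all add: metric_connection_def)
  note A = assms(6) nab assms(1)
  show ?thesis
    using modular_CSPhi_L[OF A] modular_CSPhi_W[OF A] modular_CSPhi_W'[OF A]
      degree_part_CSPhi_L_S[OF A] CSPhi_W_T[OF A] by blast
qed

end
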